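(* Let $X=X_\triangle$ be a toric Fano manifold of dimension $n$ associated with a reflexive lattice polytope $\triangle\subset\mathbb{R}^n$, let $Y\in|-K_X|$ be a general member, let $\beta\in(0,1]$, and let $\lambda\in\mathbb{R}^n$. Let $F(K_X^{-1},\beta Y)(\lambda)$ denote the log-Futaki invariant of the degeneration (test configuration) of $(X,Y,K_X^{-1})$, with divisor $D=(1-\beta)Y$, associated with the one-parameter subgroup generated by $v_\lambda=\sum_{i=1}^n\lambda_iz_i\frac{\partial}{\partial z_i}$. Let $P_c$ be the barycenter of $\triangle$, $Vol(\triangle)$ its Lebesgue volume, and $W(\lambda)=\max_{p\in\triangle}\langle p,\lambda\rangle$. Then $$F(K_X^{-1},\beta Y)(\lambda)=-\bigl(\beta\langle P_c,\lambda\rangle+(1-\beta)W(\lambda)\bigr)Vol(\triangle).$$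
   Context: **Toric conventions.** $X_\triangle$ is the toric Fano manifold for which, for every $k\ge0$, $H^0(X_\triangle,K_{X_\triangle}^{-k})$ has as basis the monomials $z^p$ with $p\in k\triangle\cap\mathbb{Z}^n$, where $z_1,\dots,z_n$ are the standard coordinates on the dense orbit $(\mathbb{C}^* )^n$. A member $Y\in|-K_X|$ is the zero scheme of $s=\sum_{p\in\triangle\cap\mathbb{Z}^n}b(p)z^p$. "General" means in some nonempty Zariski open subset of $|-K_X|$. **The degeneration.** The one-parameter group $\lambda(t)$ generated by $v_\lambda$ acts on sections by $\lambda(t)\cdot z^p=t^{-\langle p,\lambda\rangle}z^p$. Let $\mathcal{F}_\lambda=\{p\in\triangle:\langle p,\lambda\rangle=W(\lambda)\}$, a face of $\triangle$. As $t\to0$, $[\lambda(t)\cdot s]$ converges in $\mathbb{P}(H^0(X,K_X^{-1}))$ to $[s_0]$ with $s_0=\sum_{p\in\mathcal{F}_\lambda\cap\mathbb{Z}^n}b(p)z^p$. So $(X,Y,K_X^{-1})$ degenerates to $(X,Y_0,K_X^{-1})$, where $Y_0=\{s_0=0\}$ as a scheme. For $\lambda\in\mathbb{Z}^n$ this is the central fibre of the test configuration $\mathcal{X}=X\times\mathbb{C}$ with action $t\cdot(x,z)=(\lambda(t)x,tz)$, $\mathcal{L}$ the pullback of $K_X^{-1}$, and $\mathcal{Y}$ the closure of $\{(\lambda(t)y,t):y\in Y,\ t\in\mathbb{C}^*\}$. **Log-Futaki invariant.** Let $d_k=\dim H^0(X,K_X^{-k})$ and $\tilde d_k=\dim H^0(Y,K_X^{-k}|_Y)$.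 Let $w_k$ and $\tilde w_k$ be the total weights of the action of $\lambda(t)$ on $H^0(X,K_X^{-k})$ and on $H^0(Y_0,K_X^{-k}|_{Y_0})$. These are the sums of the exponents of $t$ over a weight basis; for example, $w_k=-\sum_{p\in k\triangle\cap\mathbb{Z}^n}\langle p,\lambda\rangle$. This makes sense for all real $\lambda$ and agrees with the $\mathbb{C}^*$-weight when $\lambda\in\mathbb{Z}^n$. Expand for $k\gg0$: $$w_k=a_0k^{n+1}+a_1k^n+O(k^{n-1}),\quad d_k=b_0k^n+b_1k^{n-1}+O(k^{n-2}),$$ $$\tilde w_k=\tilde a_0k^n+O(k^{n-1}),\quad \tilde d_k=\tilde b_0k^{n-1}+O(k^{n-2}).$$ The log-Futaki invariant for the pair $(X,\beta Y)$, i.e. with divisor $D=(1-\beta)Y$, is $$F(K_X^{-1},\beta Y)(\lambda)=\frac{2(a_1b_0-a_0b_1)}{b_0}+(1-\beta)\left(-\tilde a_0+\frac{\tilde b_0}{b_0}a_0\right).$$ *)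

theory Defs
  imports "HOL-Analysis.Analysis" "HOL-Library.Poly_Mapping" "HOL-Library.Function_Algebras"
    "HOL-Library.Landau_Symbols"
begin

(* The ring of functions on the dense torus: Poly_Mapping multiplies by convolution, so the
   monomial z^p is  Poly_Mapping.single p 1. *)
type_synonym 'n laurent = "(int^'n) \<Rightarrow>\<^sub>0 complex"

definition rvec :: "int^'n \<Rightarrow> real^'n" where
  "rvec p = (\<chi> i. of_int (p $ i))"


subsection \<open>Polytopes\<close>

definition lattice_polytope :: "(real^'n) set \<Rightarrow> bool" where
  "lattice_polytope P \<longleftrightarrow> (\<exists>S. finite S \<and> P = convex hull (rvec ` S))"

definition polar_dual :: "(real^'n) set \<Rightarrow> (real^'n) set" where
  "polar_dual P = {u. \<forall>x\<in>P. x \<bullet> u \<ge> -1}"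

definition reflexive_polytope :: "(real^'n) set \<Rightarrow> bool" where
  "reflexive_polytope P \<longleftrightarrow>
     lattice_polytope P \<and> 0 \<in> interior P \<and> lattice_polytope (polar_dual P)"

definition tangent_cone :: "(real^'n) set \<Rightarrow> real^'n \<Rightarrow> (real^'n) set" where
  "tangent_cone P v = conic hull ((\<lambda>x. x - v) ` P)"

definition lattice_basis :: "('n \<Rightarrow> int^'n) \<Rightarrow> bool" where
  "lattice_basis e \<longleftrightarrow> (\<forall>p. \<exists>!c :: 'n \<Rightarrow> int. p = (\<Sum>i\<in>UNIV. c i *s e i))"

(* The toric variety of the normal fan of P is a manifold iff every maximal cone of the fan,
   equivalently its dual (the tangent cone at a vertex), is generated by a lattice basis. *)
definition smooth_polytope :: "(real^'n) set \<Rightarrow> bool" where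
  "smooth_polytope P \<longleftrightarrow>
     (\<forall>v. v extreme_point_of P \<longrightarrow>
        (\<exists>e. lattice_basis e \<and>
             tangent_cone P v = {\<Sum>i\<in>UNIV. c i *\<^sub>R rvec (e i) | c. \<forall>i. c i \<ge> 0}))"

definition support_max :: "(real^'n) set \<Rightarrow> real^'n \<Rightarrow> real" where
  "support_max P l = (SUP p\<in>P. p \<bullet> l)"

definition max_face :: "(real^'n) set \<Rightarrow> real^'n \<Rightarrow> (real^'n) set" where
  "max_face P l = {p\<in>P. p \<bullet> l = support_max P l}"

definition barycenter :: "(real^'n) set \<Rightarrow> real^'n" where
  "barycenter P = (1 / measure lebesgue P) *\<^sub>R integral P (\<lambda>x. x)"


subsection \<open>Sections of powers of the anticanonical bundle\<close>

(* H^0(X, K^{-k}) for X = X_P. *)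
definition sections :: "(real^'n) set \<Rightarrow> nat \<Rightarrow> 'n laurent set" where
  "sections P k = {f. \<forall>p\<in>Poly_Mapping.keys f. rvec p \<in> (*\<^sub>R) (real k) ` P}"

(* Sections of K^{-j} over the affine open set U_v \<inter> U_w, where
   U_v = Spec C[tangent_cone P v \<inter> Z^n] is the chart of X at the vertex v.  The dual of the
   intersection of two cones is the sum of the duals, so U_v \<inter> U_w has coordinate ring
   C[(tangent_cone P v + tangent_cone P w) \<inter> Z^n], and K^{-1} is trivialised there by z^v.
   For w = v this is the space of sections over U_v. *)
definition chart_sections :: "(real^'n) set \<Rightarrow> real^'n \<Rightarrow> real^'n \<Rightarrow> int \<Rightarrow> 'n laurent set" where
  "chart_sections P v w j =
     {f. \<forall>p\<in>Poly_Mapping.keys f. \<exists>x\<in>tangent_cone P v. \<exists>y\<in>tangent_cone P w.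
           rvec p = of_int j *\<^sub>R v + x + y}"

(* For the subscheme Y = {s = 0} of X, the sections of K^{-k}|Y over U_v \<inter> U_w are
   chart_sections P v w k modulo this subspace. *)
definition chart_ideal ::
  "(real^'n) set \<Rightarrow> 'n laurent \<Rightarrow> real^'n \<Rightarrow> real^'n \<Rightarrow> int \<Rightarrow> 'n laurent set" where
  "chart_ideal P s v w k = (*) s ` chart_sections P v w (k - 1)"

(* H^0(Y, K^{-k}|Y) is  restr_sections P s k  modulo  restr_null P s k: families of sections over
   the open sets U_v \<inter> Y that agree over U_v \<inter> U_w \<inter> Y, given by representatives f v.
   Nonreduced Y is allowed. *)
definition restr_sections ::
  "(real^'n) set \<Rightarrow> 'n laurent \<Rightarrow> nat \<Rightarrow> (real^'n \<Rightarrow> 'n laurent) set" where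
  "restr_sections P s k =
     {f. (\<forall>v. \<not> v extreme_point_of P \<longrightarrow> f v = 0) \<and>
         (\<forall>v. v extreme_point_of P \<longrightarrow> f v \<in> chart_sections P v v (int k)) \<and>
         (\<forall>v w. v extreme_point_of P \<longrightarrow> w extreme_point_of P \<longrightarrow>
            f v - f w \<in> chart_ideal P s v w (int k))}"

definition restr_null ::
  "(real^'n) set \<Rightarrow> 'n laurent \<Rightarrow> nat \<Rightarrow> (real^'n \<Rightarrow> 'n laurent) set" where
  "restr_null P s k =
     {f. (\<forall>v. \<not> v extreme_point_of P \<longrightarrow> f v = 0) \<and>
         (\<forall>v. v extreme_point_of P \<longrightarrow> f v \<in> chart_ideal P s v v (int k))}"


subsection \<open>Dimension and total weight of a quotient space\<close>

(* B \<subseteq> V represents a basis of V / N. *)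
definition quotient_basis ::
  "(complex \<Rightarrow> 'a \<Rightarrow> 'a) \<Rightarrow> 'a::ab_group_add set \<Rightarrow> 'a set \<Rightarrow> 'a set \<Rightarrow> bool" where
  "quotient_basis smul V N B \<longleftrightarrow>
     finite B \<and> B \<subseteq> V \<and>
     (\<forall>x\<in>V. \<exists>!c. (\<forall>b. b \<notin> B \<longrightarrow> c b = 0) \<and> x - (\<Sum>b\<in>B. smul (c b) b) \<in> N)"

definition quotient_dim ::
  "(complex \<Rightarrow> 'a \<Rightarrow> 'a) \<Rightarrow> 'a::ab_group_add set \<Rightarrow> 'a set \<Rightarrow> nat" where
  "quotient_dim smul V N = (THE d. \<exists>B. quotient_basis smul V N B \<and> d = card B)"

definition weight_basis ::
  "(complex \<Rightarrow> 'a \<Rightarrow> 'a) \<Rightarrow> (real \<Rightarrow> 'a \<Rightarrow> 'a) \<Rightarrow> 'a::ab_group_add set \<Rightarrow> 'a set \<Rightarrow>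
     'a set \<Rightarrow> ('a \<Rightarrow> real) \<Rightarrow> bool" where
  "weight_basis smul act V N B m \<longleftrightarrow>
     quotient_basis smul V N B \<and>
     (\<forall>b\<in>B. \<forall>t>0. act t b - smul (of_real (t powr m b)) b \<in> N)"

definition total_weight ::
  "(complex \<Rightarrow> 'a \<Rightarrow> 'a) \<Rightarrow> (real \<Rightarrow> 'a \<Rightarrow> 'a) \<Rightarrow> 'a::ab_group_add set \<Rightarrow> 'a set \<Rightarrow> real" where
  "total_weight smul act V N =
     (THE w. \<exists>B m. weight_basis smul act V N B m \<and> w = (\<Sum>b\<in>B. m b))"

definition lscale :: "complex \<Rightarrow> 'n::finite laurent \<Rightarrow> 'n laurent" where
  "lscale c f = Poly_Mapping.single 0 c * f"

(* For a real vector l the one-parameter group acts for real t > 0. *)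
definition lact :: "real^'n \<Rightarrow> real \<Rightarrow> 'n laurent \<Rightarrow> 'n laurent" where
  "lact l t f = Poly_Mapping.mapp (\<lambda>p c. of_real (t powr (- (rvec p \<bullet> l))) * c) f"

definition dim_X :: "(real^'n) set \<Rightarrow> nat \<Rightarrow> nat" where
  "dim_X P k = quotient_dim lscale (sections P k) {0}"

definition weight_X :: "(real^'n) set \<Rightarrow> real^'n \<Rightarrow> nat \<Rightarrow> real" where
  "weight_X P l k = total_weight lscale (lact l) (sections P k) {0}"

definition dim_Y :: "(real^'n) set \<Rightarrow> 'n laurent \<Rightarrow> nat \<Rightarrow> nat" where
  "dim_Y P s k =
     quotient_dim (\<lambda>c f v. lscale c (f v)) (restr_sections P s k) (restr_null P s k)"

definition weight_Y :: "(real^'n) set \<Rightarrow> 'n laurent \<Rightarrow> real^'n \<Rightarrow> nat \<Rightarrow> real" where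
  "weight_Y P s l k =
     total_weight (\<lambda>c f v. lscale c (f v)) (\<lambda>t f v. lact l t (f v))
       (restr_sections P s k) (restr_null P s k)"


subsection \<open>The degeneration and the log-Futaki invariant\<close>

(* The equation s_0 of the central fibre Y_0; see tendsto_central_section below. *)
definition central_section :: "(real^'n) set \<Rightarrow> 'n laurent \<Rightarrow> real^'n \<Rightarrow> 'n laurent" where
  "central_section P s l =
     (\<Sum>p | rvec p \<in> max_face P l. Poly_Mapping.single p (Poly_Mapping.lookup s p))"

(* The exponents of k are integers because n - 2 = -1 when n = 1. *)
definition log_futaki_data ::
  "(real^'n) set \<Rightarrow> 'n laurent \<Rightarrow> real^'n \<Rightarrow>
     real \<Rightarrow> real \<Rightarrow> real \<Rightarrow> real \<Rightarrow> real \<Rightarrow> real \<Rightarrow> bool" where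
  "log_futaki_data P s l a0 a1 b0 b1 a0' b0' \<longleftrightarrow>
     (let n = int CARD('n) in
       (\<lambda>k. weight_X P l k - (a0 * real k powi (n + 1) + a1 * real k powi n))
          \<in> O(\<lambda>k. real k powi (n - 1)) \<and>
       (\<lambda>k. real (dim_X P k) - (b0 * real k powi n + b1 * real k powi (n - 1)))
          \<in> O(\<lambda>k. real k powi (n - 2)) \<and>
       (\<lambda>k. weight_Y P (central_section P s l) l k - a0' * real k powi n)
          \<in> O(\<lambda>k. real k powi (n - 1)) \<and>
       (\<lambda>k. real (dim_Y P s k) - b0' * real k powi (n - 1))
          \<in> O(\<lambda>k. real k powi (n - 2)))"

definition log_futaki :: "(real^'n) set \<Rightarrow> 'n laurent \<Rightarrow> real \<Rightarrow> real^'n \<Rightarrow> real" where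
  "log_futaki P s \<beta> l =
     (THE F. \<exists>a0 a1 b0 b1 a0' b0'. log_futaki_data P s l a0 a1 b0 b1 a0' b0' \<and>
        F = 2 * (a1 * b0 - a0 * b1) / b0 + (1 - \<beta>) * (- a0' + b0' / b0 * a0))"


subsection \<open>General members of the anticanonical system\<close>

inductive coeff_polynomial :: "('n::finite laurent \<Rightarrow> complex) \<Rightarrow> bool" where
  const: "coeff_polynomial (\<lambda>s. c)"
| coeff: "coeff_polynomial (\<lambda>s. Poly_Mapping.lookup s p)"
| add: "coeff_polynomial q \<Longrightarrow> coeff_polynomial r \<Longrightarrow> coeff_polynomial (\<lambda>s. q s + r s)"
| mult: "coeff_polynomial q \<Longrightarrow> coeff_polynomial r \<Longrightarrow> coeff_polynomial (\<lambda>s. q s * r s)"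

definition homogeneous_polynomial :: "('n::finite laurent \<Rightarrow> complex) \<Rightarrow> bool" where
  "homogeneous_polynomial q \<longleftrightarrow>
     coeff_polynomial q \<and> (\<exists>d::nat. \<forall>c s. q (lscale c s) = c ^ d * q s)"

(* A Zariski open subset of |-K_X| = P(H^0(X, K^{-1})), given as the set of all nonzero sections
   whose class belongs to it. *)
definition zariski_open_members :: "(real^'n) set \<Rightarrow> 'n laurent set \<Rightarrow> bool" where
  "zariski_open_members P U \<longleftrightarrow>
     (\<exists>Q. (\<forall>q\<in>Q. homogeneous_polynomial q) \<and>
          U = {s \<in> sections P 1. s \<noteq> 0 \<and> (\<exists>q\<in>Q. q s \<noteq> 0)})"


subsection \<open>Compatibility of the definitions\<close>

lemma compact_lattice_polytope: "lattice_polytope P \<Longrightarrow> compact P"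
  unfolding lattice_polytope_def by (auto intro: finite_imp_compact_convex_hull)

lemma convex_lattice_polytope: "lattice_polytope P \<Longrightarrow> convex P"
  unfolding lattice_polytope_def by auto

lemma le_support_max:
  assumes "lattice_polytope P" "p \<in> P"
  shows "p \<bullet> l \<le> support_max P l"
proof -
  have "compact ((\<lambda>p. p \<bullet> l) ` P)"
    by (intro compact_continuous_image continuous_intros compact_lattice_polytope assms)
  then have "bdd_above ((\<lambda>p. p \<bullet> l) ` P)"
    by (intro bounded_imp_bdd_above compact_imp_bounded)
  then show ?thesis
    unfolding support_max_def using assms by (intro cSUP_upper) auto
qed

lemma finite_lattice_points:
  fixes P :: "(real^'n) set"
  assumes "bounded P"
  shows "finite {p. rvec p \<in> P}"
proof -
  obtain B where B: "\<And>x. x \<in> P \<Longrightarrow> norm x \<le> B"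
    using assms unfolding bounded_iff by blast
  have "{p. rvec p \<in> P} \<subseteq> {p :: int^'n. \<forall>i. p $ i \<in> {-\<lceil>B\<rceil>..\<lceil>B\<rceil>}}"
  proof clarify
    fix p :: "int^'n" and i assume "rvec p \<in> P"
    then have "\<bar>rvec p $ i\<bar> \<le> B"
      using B component_le_norm_cart order_trans by blast
    then show "p $ i \<in> {-\<lceil>B\<rceil>..\<lceil>B\<rceil>}"
      by (auto simp: rvec_def) linarith+
  qed
  moreover have "finite {p :: int^'n. \<forall>i. p $ i \<in> {-\<lceil>B\<rceil>..\<lceil>B\<rceil>}}"
    using finite_PiE[of "UNIV :: 'n set" "\<lambda>_. {-\<lceil>B\<rceil>..\<lceil>B\<rceil>}"]
    by (intro finite_subset[OF _ finite_imageI[where h = "\<lambda>f. \<chi> i. f i"]])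
      (auto simp: image_iff PiE_UNIV_domain intro!: bexI[where x = "vec_nth _"])
  ultimately show ?thesis
    by (rule finite_subset)
qed

lemma lookup_lact:
  "Poly_Mapping.lookup (lact l t f) p =
     of_real (t powr (- (rvec p \<bullet> l))) * Poly_Mapping.lookup f p"
  by (simp add: lact_def lookup_mapp when_def in_keys_iff)

lemma lookup_central_section:
  assumes "lattice_polytope P"
  shows "Poly_Mapping.lookup (central_section P s l) p =
     (if rvec p \<in> max_face P l then Poly_Mapping.lookup s p else 0)"
proof -
  have "bounded (max_face P l)"
    using compact_imp_bounded[OF compact_lattice_polytope[OF assms]]
    by (rule bounded_subset) (auto simp: max_face_def)
  from finite_lattice_points[OF this] show ?thesis
    by (simp add: central_section_def lookup_sum lookup_single when_def)
qed

(* Coefficientwise, t^W lambda(t).s tends to s_0; hence [lambda(t).s] tends to [s_0] if s_0 is not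
   zero. *)
lemma tendsto_central_section:
  assumes "lattice_polytope P" "s \<in> sections P 1"
  shows "((\<lambda>t. of_real (t powr support_max P l) * Poly_Mapping.lookup (lact l t s) p)
           \<longlongrightarrow> Poly_Mapping.lookup (central_section P s l) p) (at_right 0)"
proof (cases "p \<in> Poly_Mapping.keys s")
  case False
  then show ?thesis
    by (simp add: lookup_lact lookup_central_section[OF assms(1)] in_keys_iff)
next
  case True
  define e where "e = support_max P l - rvec p \<bullet> l"
  have p: "rvec p \<in> P"
    using True assms(2) by (auto simp: sections_def)
  then have "e \<ge> 0"
    using le_support_max[OF assms(1)] by (simp add: e_def)
  have lim: "((\<lambda>t. t powr e) \<longlongrightarrow> (if e = 0 then 1 else 0)) (at_right 0)"
  proof (cases "e = 0")
    case True
    have "\<forall>\<^sub>F t::real in at_right 0. t powr e = 1"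
      using eventually_at_right_less[of "0::real"] by eventually_elim (simp add: True)
    then show ?thesis
      by (simp add: True tendsto_eventually)
  next
    case False
    then have "e > 0" using \<open>e \<ge> 0\<close> by simp
    have "\<forall>\<^sub>F t::real in at_right 0. 0 \<le> t"
      using eventually_at_right_less[of "0::real"] by eventually_elim simp
    then have "((\<lambda>t::real. t powr e) \<longlongrightarrow> 0 powr e) (at_right 0)"
      using \<open>e > 0\<close> by (intro tendsto_powr') (auto intro: tendsto_ident_at)
    then show ?thesis using False by simp
  qed
  have "((\<lambda>t. complex_of_real (t powr e) * Poly_Mapping.lookup s p)
          \<longlongrightarrow> of_real (if e = 0 then 1 else 0) * Poly_Mapping.lookup s p) (at_right 0)"
    by (intro tendsto_intros lim)
  moreover have "of_real (if e = 0 then 1 else 0) * Poly_Mapping.lookup s p =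
      Poly_Mapping.lookup (central_section P s l) p"
    using p by (auto simp: lookup_central_section[OF assms(1)] max_face_def e_def)
  moreover have "complex_of_real (t powr e) * Poly_Mapping.lookup s p =
      of_real (t powr support_max P l) * Poly_Mapping.lookup (lact l t s) p" for t
    by (simp add: lookup_lact e_def powr_diff powr_minus field_simps)
  ultimately show ?thesis
    by simp
qed

(* The local descriptions of K^{-k} over the charts glue to H^0(X, K^{-k}). *)
lemma sections_eq_glued_chart_sections:
  assumes P: "lattice_polytope P" "P \<noteq> {}"
  shows "sections P k = {f. \<forall>v. v extreme_point_of P \<longrightarrow> f \<in> chart_sections P v v (int k)}"
proof -
  have "rvec p \<in> (*\<^sub>R) (real k) ` P \<longleftrightarrow>
      (\<forall>v. v extreme_point_of P \<longrightarrow>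
         (\<exists>x\<in>tangent_cone P v. \<exists>y\<in>tangent_cone P v. rvec p = real k *\<^sub>R v + x + y))"
    (is "?L \<longleftrightarrow> ?R") for p
  proof
    assume ?L
    then obtain x where x: "x \<in> P" "rvec p = real k *\<^sub>R x" by blast
    show ?R
    proof (intro allI impI)
      fix v assume v: "v extreme_point_of P"
      have "real k *\<^sub>R (x - v) \<in> tangent_cone P v"
        unfolding tangent_cone_def conic_hull_explicit using x(1)
        by (auto intro!: exI[where x = "real k"] exI[where x = "x - v"])
      moreover have "0 \<in> tangent_cone P v"
        using P(2) by (simp add: tangent_cone_def)
      moreover have "rvec p = real k *\<^sub>R v + real k *\<^sub>R (x - v) + 0"
        by (simp add: x algebra_simps)
      ultimately show "\<exists>x\<in>tangent_cone P v. \<exists>y\<in>tangent_cone P v. rvec p = real k *\<^sub>R v + x + y"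
        by blast
    qed
  next
    assume R: ?R
    show ?L
    proof (rule ccontr)
      assume "\<not> ?L"
      moreover have "convex ((*\<^sub>R) (real k) ` P)" "closed ((*\<^sub>R) (real k) ` P)"
        using convex_lattice_polytope[OF P(1)] compact_lattice_polytope[OF P(1)]
        by (auto intro: convex_scaling compact_imp_closed compact_scaling)
      ultimately obtain a b where ab: "a \<bullet> rvec p < b" "\<And>x. x \<in> P \<Longrightarrow> b < a \<bullet> (real k *\<^sub>R x)"
        using separating_hyperplane_closed_point[of "(*\<^sub>R) (real k) ` P" "rvec p"] by auto
      obtain m where m: "m \<in> P" "\<And>x. x \<in> P \<Longrightarrow> a \<bullet> m \<le> a \<bullet> x"
        using continuous_attains_inf[OF compact_lattice_polytope[OF P(1)] P(2),
            of "\<lambda>x. a \<bullet> x"] continuous_on_inner[OF continuous_on_const continuous_on_id]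
        by blast
      define F where "F = P \<inter> {x. a \<bullet> x = a \<bullet> m}"
      have F: "F face_of P"
        unfolding F_def using m
        by (intro face_of_Int_supporting_hyperplane_ge convex_lattice_polytope P)
      have "compact F" "convex F" "F \<noteq> {}"
        using m compact_lattice_polytope[OF P(1)] convex_lattice_polytope[OF P(1)]
        by (auto simp: F_def intro: compact_Int_closed closed_hyperplane convex_Int
            convex_hyperplane)
      then obtain v where "v extreme_point_of F"
        using extreme_point_exists_convex by blast
      then have v: "v extreme_point_of P" "a \<bullet> v = a \<bullet> m" "v \<in> P"
        using extreme_point_of_face[OF F] by (auto simp: F_def extreme_point_of_def)
      have nonneg: "a \<bullet> x \<ge> 0" if "x \<in> tangent_cone P v" for x
        using that m v by (auto simp: tangent_cone_def conic_hull_explicit inner_diff_right)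
      obtain x y where xy: "x \<in> tangent_cone P v" "y \<in> tangent_cone P v"
        "rvec p = real k *\<^sub>R v + x + y"
        using R v by blast
      have "a \<bullet> rvec p \<ge> a \<bullet> (real k *\<^sub>R v)"
        using nonneg[OF xy(1)] nonneg[OF xy(2)] by (simp add: xy(3) inner_add_right)
      with ab(1) ab(2)[OF v(3)] show False by simp
    qed
  qed
  then show ?thesis
    unfolding sections_def chart_sections_def by auto
qed

end

(* Let d k be the number of lattice points of kP and w k the total weight of H^0(X, K^{-k}).

   Multiplication by the equation s of Y (or s_0 of Y_0) embeds H^0(K^{-(k-1)}) into H^0(K^{-k}), and
   since H^1(X, K^{-(k-1)}) = 0 the quotient is the space of sections over Y.  Hence the dimension on Y
   is d k - d (k-1), and the weight on Y_0 is w k - w (k-1) + W d (k-1), because s_0 has weight -W.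

   Reflexivity gives facets <x,u> >= -1 with integral u, so the interior lattice points of kP are those
   of (k-1)P.  Shifting the facet inequalities of kP by bounded integers e_u changes a lattice sum by a
   function that is affine in e up to terms of relative order k^{-2}, because translation by a lattice
   point on a facet moves parallel hyperplane sections onto each other.  Averaging x + Z^n and -x + Z^n
   over a unit cell, where the shifts e and 1 - e appear together, gives S k + S (k-1) = 2 I k^m +
   O(k^{m-2}) for S = d or w; affineness also bounds the second difference of S by O(k^{m-2}).  Together
   these determine the two leading coefficients of S, and the invariant is a computation. *)
theory Submission
  imports Defs
begin

text \<open>The second coefficient of a lattice sum S is a boundary term of relative order 1/k, the
  same order as the error in comparing S with an integral, so the comparison alone cannot detect it.
  The symmetrisation removes this error. Up to relative order k^{-2} one has S(e) = S(0) - sum_u e_u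
  F_u, where F_u is the sum over the lattice points on the facet u. Hence S(e) + S(1 - e) is S(0) +
  S(1) whatever point x of the cell has produced e, and the F_u are eliminated without being
  evaluated. Strict inequalities on the reflected translate are what makes the second shift equal to
  1 - e even when some <x,u> is an integer. The constants in these estimates depend on e, but only
  finitely many e arise from a bounded cell.

  "General" is made concrete by asking for nonzero coefficients at the vertices of P: each face on
  which a linear form is maximal contains a vertex, so a single open set gives s_0 nonzero for all l
  simultaneously.\<close>

subsection \<open>Traces on quotient spaces\<close>

text \<open>Abstract in the scalar multiplication because the trace argument is applied twice: to
  Laurent polynomials (\<open>laurent\<close>) and to families of them indexed by the vertices
  (\<open>family\<close>).\<close>

locale complex_vector_space = vector_space smul
  for smul :: "complex \<Rightarrow> 'a::ab_group_add \<Rightarrow> 'a"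
begin

lemma quotient_basis_independent:
  assumes N: "subspace N" and V: "0 \<in> V" and B: "quotient_basis smul V N B"
    and c: "(\<Sum>b\<in>B. smul (c b) b) \<in> N" and "b \<in> B"
  shows "c b = 0"
proof -
  \<comment> \<open>Uniqueness of coordinates concerns only functions that vanish off
    \<open>B\<close>, so \<open>c\<close> is cut off before it is compared with the zero coordinates
    of the vector 0.\<close>
  define c' where "c' = (\<lambda>b. if b \<in> B then c b else 0)"
  have "(\<Sum>b\<in>B. smul (c' b) b) = (\<Sum>b\<in>B. smul (c b) b)"
    by (intro sum.cong) (auto simp: c'_def)
  with c N have "0 - (\<Sum>b\<in>B. smul (c' b) b) \<in> N"
    by (simp add: subspace_neg)
  moreover have "0 - (\<Sum>b\<in>B. smul 0 b) \<in> N"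
    using N by (simp add: subspace_0)
  moreover have "\<exists>!c. (\<forall>b. b \<notin> B \<longrightarrow> c b = 0) \<and> 0 - (\<Sum>b\<in>B. smul (c b) b) \<in> N"
    using B V unfolding quotient_basis_def by blast
  then obtain d where d: "\<And>e. (\<forall>b. b \<notin> B \<longrightarrow> e b = 0) \<and> 0 - (\<Sum>b\<in>B. smul (e b) b) \<in> N \<Longrightarrow> e = d"
    by (elim ex1E) blast
  ultimately have "c' = d" "(\<lambda>_. 0) = d"
    by (auto intro!: d simp: c'_def)
  then have "c' b = 0" by (metis (no_types))
  with \<open>b \<in> B\<close> show ?thesis
    by (simp add: c'_def)
qed

lemma quotient_basis_span:
  assumes "quotient_basis smul V N B" "x \<in> V"
  obtains c where "x - (\<Sum>b\<in>B. smul (c b) b) \<in> N"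
  using assms unfolding quotient_basis_def by blast

lemma quotient_basisI:
  assumes N: "subspace N" and "finite B" "B \<subseteq> V"
    and indep: "\<And>c b. (\<Sum>b\<in>B. smul (c b) b) \<in> N \<Longrightarrow> b \<in> B \<Longrightarrow> c b = 0"
    and span: "\<And>x. x \<in> V \<Longrightarrow> \<exists>c. x - (\<Sum>b\<in>B. smul (c b) b) \<in> N"
  shows "quotient_basis smul V N B"
  unfolding quotient_basis_def
proof (intro conjI ballI)
  fix x assume "x \<in> V"
  then obtain c where c: "x - (\<Sum>b\<in>B. smul (c b) b) \<in> N"
    using span by blast
  define c0 where "c0 = (\<lambda>b. if b \<in> B then c b else 0)"
  have "(\<Sum>b\<in>B. smul (c0 b) b) = (\<Sum>b\<in>B. smul (c b) b)"
    by (intro sum.cong) (auto simp: c0_def)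
  then have c0: "x - (\<Sum>b\<in>B. smul (c0 b) b) \<in> N"
    using c by simp
  show "\<exists>!c. (\<forall>b. b \<notin> B \<longrightarrow> c b = 0) \<and> x - (\<Sum>b\<in>B. smul (c b) b) \<in> N"
  proof (rule ex1I[of _ c0], goal_cases)
    case 1 then show ?case using c0 by (auto simp: c0_def)
  next
    case (2 d)
    have "(x - (\<Sum>b\<in>B. smul (c0 b) b)) - (x - (\<Sum>b\<in>B. smul (d b) b)) \<in> N"
      by (rule subspace_diff[OF N c0]) (use 2 in blast)
    then have "(\<Sum>b\<in>B. smul (d b - c0 b) b) \<in> N"
      by (simp add: scale_left_diff_distrib sum_subtractf)
    then have "d b = c0 b" if "b \<in> B" for b
      using indep[of "\<lambda>b. d b - c0 b" b] that by simp
    moreover have "d b = c0 b" if "b \<notin> B" for b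
      using 2 that by (simp add: c0_def)
    ultimately show ?case by blast
  qed
qed (use assms in auto)

lemma quotient_basis_0I:
  assumes "finite B" "independent B" "B \<subseteq> V" "V \<subseteq> span B"
  shows "quotient_basis smul V {0} B"
proof (rule quotient_basisI)
  show "\<And>c b. (\<Sum>b\<in>B. smul (c b) b) \<in> {0} \<Longrightarrow> b \<in> B \<Longrightarrow> c b = 0"
    using assms independentD[of B B] by blast
  show "\<exists>c. x - (\<Sum>b\<in>B. smul (c b) b) \<in> {0}" if "x \<in> V" for x
    using that assms span_finite[OF assms(1)] by (auto simp: image_iff)
qed (use assms in auto)

text \<open>Steinitz extension: the vectors added to \<open>C\<close> represent a basis modulo its
  span. It matters that they are taken from \<open>M\<close>, which will consist of monomials, so
  that the representatives are weight vectors.\<close>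

lemma extend_to_quotient_basis:
  assumes C: "finite C" "independent C" and V: "subspace V" "C \<subseteq> V"
    and M: "finite M" "M \<subseteq> V" "V \<subseteq> span M"
  obtains B where "B \<subseteq> M" "B \<inter> C = {}" "quotient_basis smul V (span C) B"
    "quotient_basis smul V {0} (B \<union> C)"
proof -
  obtain B' where B': "C \<subseteq> B'" "B' \<subseteq> C \<union> M" "independent B'" "C \<union> M \<subseteq> span B'"
    using maximal_independent_subset_extend[of C "C \<union> M"] C by blast
  have fin: "finite B'"
    using B' C M finite_subset by blast
  have B'V: "B' \<subseteq> V" using B' V M by blast
  have "span M \<subseteq> span B'"
    using B'(4) by (intro span_minimal) auto
  then have VB': "V \<subseteq> span B'" using M by blast
  have eq: "(B' - C) \<union> C = B'" using B' by blast
  have b0: "quotient_basis smul V {0} ((B' - C) \<union> C)"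
    unfolding eq by (rule quotient_basis_0I) fact+
  have "quotient_basis smul V (span C) (B' - C)"
  proof (rule quotient_basisI)
    fix c b assume c: "(\<Sum>b\<in>B' - C. smul (c b) b) \<in> span C" and b: "b \<in> B' - C"
    then obtain d where d: "(\<Sum>b\<in>B' - C. smul (c b) b) = (\<Sum>b\<in>C. smul (d b) b)"
      using span_finite[OF C(1)] by auto
    have "(\<Sum>b\<in>B'. smul (if b \<in> C then - d b else c b) b) =
      (\<Sum>b\<in>B' - C. smul (if b \<in> C then - d b else c b) b) +
      (\<Sum>b\<in>C. smul (if b \<in> C then - d b else c b) b)"
      by (rule sum.subset_diff) (use B' fin in auto)
    also have "\<dots> = (\<Sum>b\<in>B' - C. smul (c b) b) + (\<Sum>b\<in>C. smul (- d b) b)"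
      by (intro arg_cong2[of _ _ _ _ "(+)"] sum.cong) auto
    also have "\<dots> = 0" by (simp add: d sum_negf)
    finally have "(if b \<in> C then - d b else c b) = 0"
      by (rule independentD[OF B'(3) fin subset_refl, where v = b]) (use b in blast)
    with b show "c b = 0" by simp
  next
    fix x assume "x \<in> V"
    with VB' obtain c where c: "x = (\<Sum>b\<in>B'. smul (c b) b)"
      using span_finite[OF fin] by auto
    also have "\<dots> = (\<Sum>b\<in>B' - C. smul (c b) b) + (\<Sum>b\<in>C. smul (c b) b)"
      by (rule sum.subset_diff) (use B' fin in auto)
    finally have "x - (\<Sum>b\<in>B' - C. smul (c b) b) = (\<Sum>b\<in>C. smul (c b) b)"
      by simp
    then show "\<exists>c. x - (\<Sum>b\<in>B' - C. smul (c b) b) \<in> span C"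
      by (intro exI[of _ c]) (simp add: span_sum span_scale span_base)
  qed (use fin B'V in auto)
  with b0 show thesis
    using B' by (intro that[of "B' - C"]) auto
qed

end

locale linear_action = complex_vector_space smul
  for smul :: "complex \<Rightarrow> 'a::ab_group_add \<Rightarrow> 'a" +
  fixes act :: "real \<Rightarrow> 'a \<Rightarrow> 'a" and V N :: "'a set"
  assumes N: "subspace N" and V0: "0 \<in> V"
    and act_add: "act t (x + y) = act t x + act t y"
    and act_smul: "act t (smul c x) = smul c (act t x)"
    and act_N: "x \<in> N \<Longrightarrow> t > 0 \<Longrightarrow> act t x \<in> N"
begin

lemma act_diff: "act t (x - y) = act t x - act t y"
  by (metis act_add add_diff_cancel_right' diff_add_cancel)

lemma act_zero: "act t 0 = 0"
  using act_diff[of t 0 0] by simp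

lemma act_sum: "act t (\<Sum>b\<in>B. f b) = (\<Sum>b\<in>B. act t (f b))"
  by (induction B rule: infinite_finite_induct) (auto simp: act_add act_zero)

text \<open>Eigenvectors of different weights are independent modulo \<open>N\<close>: applying the
  action to \<open>x\<close> and to its expansion leaves a relation among the basis vectors with
  coefficients c b (2^(m b) - 2^w).\<close>

lemma coordinate_weight_eq:
  assumes B: "weight_basis smul act V N B m"
    and x: "\<forall>t>0. act t x - smul (of_real (t powr w)) x \<in> N"
    and c: "x - (\<Sum>b\<in>B. smul (c b) b) \<in> N"
    and b: "b \<in> B" "c b \<noteq> 0"
  shows "m b = w"
proof -
  define e where "e r = complex_of_real (2 powr r)" for r
  have h: "act 2 (x - (\<Sum>b\<in>B. smul (c b) b)) \<in> N" "act 2 x - smul (e w) x \<in> N"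
    "(\<Sum>b\<in>B. smul (c b) (act 2 b - smul (e (m b)) b)) \<in> N"
    "smul (e w) (x - (\<Sum>b\<in>B. smul (c b) b)) \<in> N"
    using act_N[OF c] x B subspace_scale[OF N c] unfolding weight_basis_def e_def
    by (auto intro!: subspace_sum N subspace_scale)
  have "smul (e w) (x - (\<Sum>b\<in>B. smul (c b) b)) + (act 2 x - smul (e w) x) -
      act 2 (x - (\<Sum>b\<in>B. smul (c b) b)) - (\<Sum>b\<in>B. smul (c b) (act 2 b - smul (e (m b)) b)) \<in> N"
    by (rule subspace_diff[OF N subspace_diff[OF N subspace_add[OF N h(4,2)] h(1)] h(3)])
  also have "smul (e w) (x - (\<Sum>b\<in>B. smul (c b) b)) + (act 2 x - smul (e w) x) -
      act 2 (x - (\<Sum>b\<in>B. smul (c b) b)) - (\<Sum>b\<in>B. smul (c b) (act 2 b - smul (e (m b)) b))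
    = (\<Sum>b\<in>B. smul (c b * (e (m b) - e w)) b)"
    by (simp add: act_diff act_sum act_smul scale_right_diff_distrib sum_subtractf
        scale_sum_right scale_left_diff_distrib right_diff_distrib mult.commute)
  finally have "c b * (e (m b) - e w) = 0"
    using B b(1) N V0 unfolding weight_basis_def
    by (intro quotient_basis_independent[of N V B "\<lambda>b. c b * (e (m b) - e w)"]) auto
  with b(2) have "e (m b) = e w" by simp
  then show ?thesis by (simp add: e_def powr_inj)
qed

(* The sum of the weights is a trace: with the two change-of-basis matrices A and A',
   both sums equal the sum of m b * A b' b * A' b b' over all b and b'. *)
lemma sum_weights_unique:
  assumes B: "weight_basis smul act V N B m" and B': "weight_basis smul act V N B' m'"
  shows "(\<Sum>b\<in>B. m b) = (\<Sum>b\<in>B'. m' b)"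
proof -
  have B1: "quotient_basis smul V N B" "finite B" "B \<subseteq> V"
    and B1': "quotient_basis smul V N B'" "finite B'" "B' \<subseteq> V"
    using B B' by (auto simp: weight_basis_def quotient_basis_def)
  have coords: "\<exists>A. \<forall>x\<in>C. x - (\<Sum>b\<in>D. smul (A x b) b) \<in> N"
    if "quotient_basis smul V N D" "C \<subseteq> V" for C D
  proof (intro bchoice ballI)
    fix x assume "x \<in> C"
    then have "x \<in> V" using that by blast
    with that(1) show "\<exists>a. x - (\<Sum>b\<in>D. smul (a b) b) \<in> N"
      by (rule quotient_basis_span) blast
  qed
  obtain A where A: "\<And>x. x \<in> B' \<Longrightarrow> x - (\<Sum>b\<in>B. smul (A x b) b) \<in> N"
    using coords[OF B1(1) B1'(3)] by blast
  obtain A' where A': "\<And>x. x \<in> B \<Longrightarrow> x - (\<Sum>b\<in>B'. smul (A' x b) b) \<in> N"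
    using coords[OF B1'(1) B1(3)] by blast
  \<comment> \<open>Diagonal entries of the product of the two coordinate matrices: expanding
    \<open>c\<close> in \<open>D\<close> and the result again in \<open>C\<close> returns
    \<open>c\<close> modulo \<open>N\<close>.\<close>
  have inv: "(\<Sum>d\<in>D. F c d * G d c) = 1"
    if C: "quotient_basis smul V N C" "finite C" and c: "c \<in> C" and "finite D"
      and F: "\<And>x. x \<in> C \<Longrightarrow> x - (\<Sum>d\<in>D. smul (F x d) d) \<in> N"
      and G: "\<And>x. x \<in> D \<Longrightarrow> x - (\<Sum>d\<in>C. smul (G x d) d) \<in> N" for C D F G c
  proof -
    have "(c - (\<Sum>d\<in>D. smul (F c d) d)) +
        (\<Sum>d\<in>D. smul (F c d) (d - (\<Sum>e\<in>C. smul (G d e) e))) \<in> N"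
      using F[OF c] G by (intro subspace_add N subspace_sum subspace_scale) auto
    also have "(\<Sum>d\<in>D. smul (F c d) (d - (\<Sum>e\<in>C. smul (G d e) e))) =
        (\<Sum>d\<in>D. smul (F c d) d) - (\<Sum>e\<in>C. \<Sum>d\<in>D. smul (F c d * G d e) e)"
      by (subst sum.swap) (simp add: scale_right_diff_distrib sum_subtractf scale_sum_right)
    also have "(c - (\<Sum>d\<in>D. smul (F c d) d)) + \<dots> =
        (\<Sum>e\<in>C. smul (if e = c then 1 else 0) e) - (\<Sum>e\<in>C. smul (\<Sum>d\<in>D. F c d * G d e) e)"
      using C c by (simp add: scale_sum_left if_distrib[of "\<lambda>x. smul x _"] cong: if_cong)
    also have "\<dots> = (\<Sum>e\<in>C. smul ((if e = c then 1 else 0) - (\<Sum>d\<in>D. F c d * G d e)) e)"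
      by (simp add: sum_subtractf scale_left_diff_distrib)
    finally have "(if c = c then 1 else 0) - (\<Sum>d\<in>D. F c d * G d c) = 0"
      by (rule quotient_basis_independent[OF N V0 C(1)]) (rule c)
    then show ?thesis by simp
  qed
  \<comment> \<open>A nonzero matrix entry only links basis vectors of equal weight.\<close>
  have eq: "A b' b * of_real (m b) = A b' b * of_real (m' b')" if "b' \<in> B'" "b \<in> B" for b b'
    using coordinate_weight_eq[OF B _ A[OF that(1)] that(2)] B' that
    by (cases "A b' b = 0") (auto simp: weight_basis_def)
  have invB: "(\<Sum>b'\<in>B'. A' b b' * A b' b) = 1" if "b \<in> B" for b
    by (rule inv[OF B1(1,2) that B1'(2) A' A])
  have invB': "(\<Sum>b\<in>B. A b' b * A' b b') = 1" if "b' \<in> B'" for b'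
    by (rule inv[OF B1'(1,2) that B1(2) A A'])
  have "complex_of_real (\<Sum>b\<in>B. m b) = (\<Sum>b\<in>B. of_real (m b) * (\<Sum>b'\<in>B'. A' b b' * A b' b))"
    unfolding of_real_sum by (intro sum.cong) (auto simp: invB)
  also have "\<dots> = (\<Sum>b\<in>B. \<Sum>b'\<in>B'. (A b' b * of_real (m b)) * A' b b')"
    unfolding sum_distrib_left by (intro sum.cong refl) (simp only: mult_ac)
  also have "\<dots> = (\<Sum>b\<in>B. \<Sum>b'\<in>B'. (A b' b * of_real (m' b')) * A' b b')"
    by (intro sum.cong refl arg_cong2[of _ _ _ _ "(*)"] eq)
  also have "\<dots> = (\<Sum>b'\<in>B'. of_real (m' b') * (\<Sum>b\<in>B. A b' b * A' b b'))"
    unfolding sum_distrib_left by (subst sum.swap) (intro sum.cong refl, simp only: mult_ac)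
  also have "\<dots> = complex_of_real (\<Sum>b\<in>B'. m' b)"
    unfolding of_real_sum by (intro sum.cong) (auto simp: invB')
  finally show ?thesis
    unfolding of_real_eq_iff .
qed

lemma total_weight_eq:
  assumes "weight_basis smul act V N B m"
  shows "total_weight smul act V N = (\<Sum>b\<in>B. m b)"
  unfolding total_weight_def
proof (rule the_equality)
  show "\<exists>B' m'. weight_basis smul act V N B' m' \<and> (\<Sum>b\<in>B. m b) = (\<Sum>b\<in>B'. m' b)"
    using assms by blast
  show "w = (\<Sum>b\<in>B. m b)"
    if "\<exists>B' m'. weight_basis smul act V N B' m' \<and> w = (\<Sum>b\<in>B'. m' b)" for w
    using that by (elim exE conjE) (simp add: sum_weights_unique[OF _ assms])
qed

end

text \<open>Dimension as a trace: when t acts as the scalar t, every basis vector has weight 1, and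
  uniqueness of the total weight becomes uniqueness of the cardinality.\<close>

lemma (in complex_vector_space) quotient_dim_eq:
  assumes "subspace N" "0 \<in> V" "quotient_basis smul V N B"
  shows "quotient_dim smul V N = card B"
proof -
  interpret linear_action smul "\<lambda>t. smul (of_real t)" V N
    using assms by unfold_locales
      (auto simp: scale_right_distrib scale_left_commute subspace_scale)
  have wb: "weight_basis smul (\<lambda>t. smul (of_real t)) V N B (\<lambda>_. 1)"
    if "quotient_basis smul V N B" for B
    using that assms(1) by (auto simp: weight_basis_def subspace_0)
  have "card B' = card B" if "quotient_basis smul V N B'" for B'
    using sum_weights_unique[OF wb[OF that] wb[OF assms(3)]] by simp
  with assms(3) show ?thesis
    unfolding quotient_dim_def by (intro the_equality) blast+
qed

section \<open>Arithmetic of lattice vectors in the real space\<close>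

lemma rvec_add: "rvec (p + q) = rvec p + rvec q"
  by (simp add: rvec_def vec_eq_iff)

lemma rvec_diff: "rvec (p - q) = rvec p - rvec q"
  by (simp add: rvec_def vec_eq_iff)

lemma rvec_minus: "rvec (- p) = - rvec p"
  by (simp add: rvec_def vec_eq_iff)

lemma rvec_eq_iff: "rvec p = rvec q \<longleftrightarrow> p = q"
  by (simp add: rvec_def vec_eq_iff)

lemma rvec_nth: "rvec p $ i = of_int (p $ i)"
  by (simp add: rvec_def)


subsection \<open>Laurent polynomials\<close>

(* Among the sums p + q of exponents the one of largest norm arises only once, by strict convexity
   of the norm, so its coefficient in the product does not cancel. *)
lemma laurent_mult_eq_0:
  fixes f g :: "'n::finite laurent"
  assumes "f * g = 0"
  shows "f = 0 \<or> g = 0"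
proof (rule ccontr)
  assume "\<not> (f = 0 \<or> g = 0)"
  then have ne: "Poly_Mapping.keys f \<noteq> {}" "Poly_Mapping.keys g \<noteq> {}"
    by auto
  define K where "K = Poly_Mapping.keys f \<times> Poly_Mapping.keys g"
  define N where "N = (\<lambda>(p, q). norm (rvec (p + q) :: real^'n))"
  have K: "finite K" "K \<noteq> {}" using ne by (auto simp: K_def)
  have "Max (N ` K) \<in> N ` K"
    using K by (intro Max_in) auto
  then obtain p q where pq: "(p, q) \<in> K" "Max (N ` K) = N (p, q)"
    by auto
  then have max: "N x \<le> N (p, q)" if "x \<in> K" for x
    using that K by (metis Max_ge finite_imageI imageI)
  have uniq: "p' = p" if "(p', q') \<in> K" "p' + q' = p + q" for p' q'
  proof (rule ccontr)
    assume "p' \<noteq> p"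
    define a b where "a = rvec (p' + q) - rvec (p + q)" and "b = rvec (p + q)"
    have "q' = p + q - p'" using that(2) by (simp add: algebra_simps)
    then have b: "rvec (p + q') = b - a" "rvec (p' + q) = b + a"
      by (simp_all add: a_def b_def vec_eq_iff rvec_nth)
    have "(p', q) \<in> K" "(p, q') \<in> K" using that pq by (auto simp: K_def)
    from this[THEN max] have "norm (b + a) \<le> norm b" "norm (b - a) \<le> norm b"
      using b by (simp_all add: N_def b_def)
    \<comment> \<open>By the parallelogram law the left side is 2 |b|^2 + 2 |a|^2.\<close>
    then have "(norm (b + a))\<^sup>2 + (norm (b - a))\<^sup>2 \<le> 2 * (norm b)\<^sup>2"
      by (smt (verit) norm_ge_zero power_mono)
    then have "(norm a)\<^sup>2 \<le> 0"
      by (simp add: power2_norm_eq_inner inner_add inner_diff inner_commute)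
    then have "a = 0" by simp
    then have "p' + q = p + q" unfolding a_def using rvec_eq_iff by (metis eq_iff_diff_eq_0)
    with \<open>p' \<noteq> p\<close> show False by simp
  qed
  have "Poly_Mapping.lookup (f * g) (p + q) =
      (\<Sum>a\<in>Poly_Mapping.keys f. Poly_Mapping.lookup f a *
        (\<Sum>b\<in>Poly_Mapping.keys g. Poly_Mapping.lookup g b when p + q = a + b))"
    unfolding lookup_mult
    by (subst Sum_any.expand_superset[of "Poly_Mapping.keys f"],
      simp, use in_keys_iff in fastforce)
     (intro sum.cong refl arg_cong2[of _ _ _ _ "(*)"] Sum_any.expand_superset,
      auto simp: in_keys_iff when_def)
  also have "\<dots> = (\<Sum>a\<in>Poly_Mapping.keys f. if a = p then
      Poly_Mapping.lookup f p * Poly_Mapping.lookup g q else 0)"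
  proof (intro sum.cong refl)
    fix a assume a: "a \<in> Poly_Mapping.keys f"
    show "Poly_Mapping.lookup f a *
        (\<Sum>b\<in>Poly_Mapping.keys g. Poly_Mapping.lookup g b when p + q = a + b) =
      (if a = p then Poly_Mapping.lookup f p * Poly_Mapping.lookup g q else 0)"
    proof (cases "a = p")
      case True
      then have "(\<Sum>b\<in>Poly_Mapping.keys g. Poly_Mapping.lookup g b when p + q = a + b) =
          (\<Sum>b\<in>Poly_Mapping.keys g. if b = q then Poly_Mapping.lookup g b else 0)"
        by (intro sum.cong) (auto simp: when_def)
      also have "\<dots> = Poly_Mapping.lookup g q"
        using pq by (simp add: K_def)
      finally show ?thesis using True by simp
    next
      case False
      have "(\<Sum>b\<in>Poly_Mapping.keys g. Poly_Mapping.lookup g b when p + q = a + b) = 0"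
        using False a uniq[of a] by (intro sum.neutral) (auto simp: K_def when_def)
      then show ?thesis using False by simp
    qed
  qed
  also have "\<dots> = Poly_Mapping.lookup f p * Poly_Mapping.lookup g q"
    using pq by (simp add: K_def)
  also have "\<dots> \<noteq> 0"
    using pq by (simp add: K_def in_keys_iff)
  finally show False using assms by simp
qed

lemma laurent_mult_left_cancel:
  fixes f g h :: "'n::finite laurent"
  shows "f \<noteq> 0 \<Longrightarrow> f * g = f * h \<longleftrightarrow> g = h"
  using laurent_mult_eq_0[of f "g - h"] by (auto simp: right_diff_distrib)

lemma laurent_expand:
  fixes f :: "'n::finite laurent"
  assumes "finite K" "Poly_Mapping.keys f \<subseteq> K"
  shows "f = (\<Sum>p\<in>K. lscale (Poly_Mapping.lookup f p) (Poly_Mapping.single p 1))"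
  using assms by (intro poly_mapping_eqI)
    (auto simp: lscale_def mult_single lookup_sum lookup_single when_def in_keys_iff)

lemma lookup_lscale: "Poly_Mapping.lookup (lscale c f) p = c * Poly_Mapping.lookup f p"
  by (simp add: lscale_def mult_map_scale_conv_mult[symmetric] map.rep_eq when_def)

lemma keys_lscale: "Poly_Mapping.keys (lscale c f) \<subseteq> Poly_Mapping.keys f"
  by (auto simp: in_keys_iff lookup_lscale)

lemma mult_lscale: "s * lscale c f = lscale c (s * f)"
  by (simp add: lscale_def mult.left_commute)

interpretation laurent: complex_vector_space lscale
  by unfold_locales
    (auto simp: poly_mapping_eq_iff fun_eq_iff lookup_lscale lookup_add algebra_simps)

interpretation family: complex_vector_space "\<lambda>c (f :: 'a \<Rightarrow> 'n::finite laurent) v. lscale c (f v)"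
  by unfold_locales
    (auto simp: fun_eq_iff laurent.scale_right_distrib laurent.scale_left_distrib)

lemma lact_add: "lact l t (f + g) = lact l t f + lact l t g"
  by (intro poly_mapping_eqI) (simp add: lookup_lact lookup_add algebra_simps)

lemma lact_lscale: "lact l t (lscale c f) = lscale c (lact l t f)"
  by (intro poly_mapping_eqI) (simp add: lookup_lact lookup_lscale)

lemma lact_0: "lact l t 0 = 0"
  by (intro poly_mapping_eqI) (simp add: lookup_lact)

lemma lact_homogeneous:
  assumes "\<And>p. p \<in> Poly_Mapping.keys f \<Longrightarrow> rvec p \<bullet> l = w"
  shows "lact l t f = lscale (of_real (t powr (- w))) f"
  using assms by (intro poly_mapping_eqI) (auto simp: lookup_lact lookup_lscale in_keys_iff)

text \<open>The torus acts by ring homomorphisms and \<open>s\<close> is an eigenvector with factor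
  t^(-w); this is checked on monomials and extended linearly. It makes the ideal of the central
  fibre stable under the action.\<close>

lemma lact_mult_homogeneous:
  fixes s f :: "'n::finite laurent"
  assumes "\<And>p. p \<in> Poly_Mapping.keys s \<Longrightarrow> rvec p \<bullet> l = w"
  shows "lact l t (s * f) = s * lscale (of_real (t powr (- w))) (lact l t f)"
proof -
  have mono: "lact l t (Poly_Mapping.single q 1) =
      lscale (of_real (t powr - (rvec q \<bullet> l))) (Poly_Mapping.single q 1)" for q :: "int^'n"
    by (rule lact_homogeneous) simp
  have mon: "lact l t (s * Poly_Mapping.single q 1) =
      s * lscale (of_real (t powr (- w))) (lact l t (Poly_Mapping.single q 1))" for q
  proof -
    have "lact l t (s * Poly_Mapping.single q 1) =
        lscale (of_real (t powr (- (w + rvec q \<bullet> l)))) (s * Poly_Mapping.single q 1)"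
      using keys_mult[of s "Poly_Mapping.single q 1"] assms
      by (intro lact_homogeneous) (auto simp: rvec_add inner_add_left)
    then show ?thesis
      by (simp add: mono mult_lscale laurent.scale_scale flip: of_real_mult powr_add)
  qed
  have sum: "lact l t (\<Sum>i\<in>A. F i) = (\<Sum>i\<in>A. lact l t (F i))" for A and F :: "int^'n \<Rightarrow> 'n laurent"
    by (induction A rule: infinite_finite_induct) (auto simp: lact_0 lact_add)
  have f: "f = (\<Sum>p\<in>Poly_Mapping.keys f. lscale (Poly_Mapping.lookup f p) (Poly_Mapping.single p 1))"
    by (rule laurent_expand) auto
  show ?thesis
    by (subst (1 2) f) (simp add: sum_distrib_left mult_lscale lact_lscale mon sum
        laurent.scale_sum_right mult.commute[of "complex_of_real _"])
qed

section \<open>Global sections, their monomial bases and weights\<close>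

lemma subspace_sections: "laurent.subspace (sections P k)"
  unfolding laurent.subspace_def
proof (intro conjI ballI allI)
  show "f + g \<in> sections P k" if "f \<in> sections P k" "g \<in> sections P k" for f g
    using that Poly_Mapping.keys_add[of f g] by (auto simp: sections_def)
  show "lscale c f \<in> sections P k" if "f \<in> sections P k" for c f
    using that keys_lscale[of c f] by (auto simp: sections_def)
qed (simp add: sections_def)

lemma subspace_mult_sections: "laurent.subspace ((*) s ` sections P k)"
  unfolding laurent.subspace_def
proof (intro conjI ballI allI)
  have sub: "laurent.subspace (sections P k)"
    by (rule subspace_sections)
  have "s * 0 \<in> (*) s ` sections P k"
    using laurent.subspace_0[OF sub] by (rule imageI)
  then show "0 \<in> (*) s ` sections P k" by simp
  fix x y c assume "x \<in> (*) s ` sections P k" "y \<in> (*) s ` sections P k"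
  then obtain a b where ab: "a \<in> sections P k" "b \<in> sections P k" "x = s * a" "y = s * b"
    by blast
  have "s * (a + b) \<in> (*) s ` sections P k"
    using laurent.subspace_add[OF sub ab(1,2)] by (rule imageI)
  then show "x + y \<in> (*) s ` sections P k" by (simp add: ab distrib_left)
next
  have sub: "laurent.subspace (sections P k)"
    by (rule subspace_sections)
  fix x c assume "x \<in> (*) s ` sections P k"
  then obtain a where a: "a \<in> sections P k" "x = s * a"
    by blast
  have "s * lscale c a \<in> (*) s ` sections P k"
    using laurent.subspace_scale[OF sub a(1)] by (rule imageI)
  then show "lscale c x \<in> (*) s ` sections P k" by (simp add: a mult_lscale)
qed

definition lattice_points :: "(real^'n) set \<Rightarrow> nat \<Rightarrow> (int^'n) set" where
  "lattice_points P k = {p. rvec p \<in> (*\<^sub>R) (real k) ` P}"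

abbreviation monom :: "int^'n \<Rightarrow> 'n::finite laurent" where
  "monom p \<equiv> Poly_Mapping.single p 1"

lemma keys_monom: "Poly_Mapping.keys (monom p) = {p}"
  by simp

lemma monom_eq_iff: "monom p = monom q \<longleftrightarrow> p = q"
  by (metis keys_monom singleton_inject)

lemma monom_neq_0: "monom p \<noteq> 0"
  by (metis keys_monom Poly_Mapping.keys_zero insert_not_empty)

lemma finite_lattice_points_scaled: "bounded P \<Longrightarrow> finite (lattice_points P k)"
  unfolding lattice_points_def by (intro finite_lattice_points bounded_scaling)

lemma sections_iff: "f \<in> sections P k \<longleftrightarrow> Poly_Mapping.keys f \<subseteq> lattice_points P k"
  by (auto simp: sections_def lattice_points_def)

lemma inj_mult_monom:
  fixes s :: "'n::finite laurent"
  assumes "s \<noteq> 0"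
  shows "inj (\<lambda>p. s * monom p)"
  using assms by (auto simp: inj_on_def laurent_mult_left_cancel monom_eq_iff)

text \<open>Laurent polynomials form a domain, so a relation among the products is \<open>s\<close>
  times a relation among distinct monomials, which must be trivial.\<close>

lemma independent_mult_monom:
  fixes s :: "'n::finite laurent"
  assumes "finite K" "s \<noteq> 0"
  shows "laurent.independent ((\<lambda>p. s * monom p) ` K)"
proof (rule laurent.independent_if_scalars_zero)
  fix u b assume u: "(\<Sum>b\<in>(\<lambda>p. s * monom p) ` K. lscale (u b) b) = 0"
    and b: "b \<in> (\<lambda>p. s * monom p) ` K"
  define F where "F = (\<Sum>p\<in>K. lscale (u (s * monom p)) (monom p))"
  have "inj_on (\<lambda>p. s * monom p) K"
    using inj_mult_monom[OF assms(2)] by (rule inj_on_subset) simp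
  then have "s * F = 0"
    using u by (simp add: F_def sum.reindex sum_distrib_left mult_lscale)
  then have "F = 0"
    using laurent_mult_eq_0 assms(2) by blast
  moreover obtain p where p: "p \<in> K" "b = s * monom p"
    using b by blast
  have "Poly_Mapping.lookup F p = (\<Sum>q\<in>K. if q = p then u (s * monom q) else 0)"
    unfolding F_def lookup_sum by (intro sum.cong refl) (simp add: lookup_lscale lookup_single when_def)
  then have "Poly_Mapping.lookup F p = u b"
    using p assms(1) by simp
  ultimately show "u b = 0" by simp
qed (use assms in simp)

lemma span_mult_monom:
  fixes s :: "'n::finite laurent"
  assumes "bounded P"
  shows "laurent.span ((\<lambda>p. s * monom p) ` lattice_points P k) = (*) s ` sections P k"
proof (intro equalityI laurent.span_minimal subspace_mult_sections)
  show "(\<lambda>p. s * monom p) ` lattice_points P k \<subseteq> (*) s ` sections P k"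
    by (auto simp: sections_iff)
  show "(*) s ` sections P k \<subseteq> laurent.span ((\<lambda>p. s * monom p) ` lattice_points P k)"
  proof (rule image_subsetI)
    fix f assume "f \<in> sections P k"
    then have f: "f = (\<Sum>p\<in>lattice_points P k. lscale (Poly_Mapping.lookup f p) (monom p))"
      using assms by (intro laurent_expand finite_lattice_points_scaled) (auto simp: sections_iff)
    have "(\<Sum>p\<in>lattice_points P k. lscale (Poly_Mapping.lookup f p) (s * monom p))
        \<in> laurent.span ((\<lambda>p. s * monom p) ` lattice_points P k)"
      by (intro laurent.span_sum laurent.span_scale laurent.span_base) auto
    then show "s * f \<in> laurent.span ((\<lambda>p. s * monom p) ` lattice_points P k)"
      by (subst f) (simp add: sum_distrib_left mult_lscale)
  qed
qed

lemmas independent_monom = independent_mult_monom[of _ 1, simplified]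
  and span_monom = span_mult_monom[of _ 1, simplified]
  and inj_monom = inj_mult_monom[of 1, simplified]

lemma quotient_basis_monom:
  assumes "bounded P"
  shows "quotient_basis lscale (sections P k) {0} (monom ` lattice_points P k)"
  using assms span_monom[of P k] laurent.span_superset[of "monom ` lattice_points P k"]
  by (intro laurent.quotient_basis_0I independent_monom finite_imageI finite_lattice_points_scaled)
    (auto simp: image_id)

text \<open>Read off at an arbitrary exponent, since \<open>weight_basis\<close> assigns weights to
  basis vectors and not to exponents; for homogeneous nonzero \<open>b\<close> the choice does not
  affect the value.\<close>

definition basis_weight :: "real^'n \<Rightarrow> 'n::finite laurent \<Rightarrow> real" where
  "basis_weight l b = - (rvec (SOME p. p \<in> Poly_Mapping.keys b) \<bullet> l)"

lemma basis_weight_homogeneous: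
  assumes "\<And>p. p \<in> Poly_Mapping.keys b \<Longrightarrow> rvec p \<bullet> l = w" "b \<noteq> 0"
  shows "basis_weight l b = - w" "lact l t b = lscale (of_real (t powr basis_weight l b)) b"
proof -
  have "\<exists>p. p \<in> Poly_Mapping.keys b"
    using assms(2) by (metis all_not_in_conv poly_mapping_eqI lookup_zero in_keys_iff)
  then show w: "basis_weight l b = - w"
    unfolding basis_weight_def using assms(1) someI_ex[of "\<lambda>p. p \<in> Poly_Mapping.keys b"] by simp
  show "lact l t b = lscale (of_real (t powr basis_weight l b)) b"
    unfolding w by (rule lact_homogeneous) (use assms(1) in simp)
qed

lemma basis_weight_monom:
  "basis_weight l (monom p) = - (rvec p \<bullet> l)"
  "lact l t (monom p) = lscale (of_real (t powr basis_weight l (monom p))) (monom p)"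
  using basis_weight_homogeneous[of "monom p" l "rvec p \<bullet> l"] by (simp_all add: monom_neq_0)

lemma linear_action_sections:
  "linear_action lscale (lact l) (sections P k) {0}"
  by unfold_locales (auto simp: lact_add lact_lscale lact_0 sections_def)

lemma dim_X_eq:
  assumes "bounded P"
  shows "dim_X P k = card (lattice_points P k)"
  unfolding dim_X_def
  by (subst laurent.quotient_dim_eq[OF _ _ quotient_basis_monom[OF assms]])
    (auto simp: sections_def card_image[OF inj_on_subset[OF inj_monom]])

lemma weight_X_eq:
  assumes "bounded P"
  shows "weight_X P l k = - (\<Sum>p\<in>lattice_points P k. rvec p \<bullet> l)"
proof -
  interpret linear_action lscale "lact l" "sections P k" "{0}"
    by (rule linear_action_sections)
  have "weight_basis lscale (lact l) (sections P k) {0} (monom ` lattice_points P k) (basis_weight l)"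
    unfolding weight_basis_def
    using quotient_basis_monom[OF assms] by (auto simp: basis_weight_monom(2))
  from total_weight_eq[OF this] show ?thesis
    unfolding weight_X_def using inj_monom
    by (simp add: sum.reindex[OF inj_on_subset[OF inj_monom]] basis_weight_monom(1) sum_negf)
qed

text \<open>On exponents this is P + kP inside (k+1)P, from the convex combination with weights
  1/(k+1) and k/(k+1).\<close>

lemma mult_sections:
  assumes P: "convex P" and s: "s \<in> sections P 1" and f: "f \<in> sections P k"
  shows "s * f \<in> sections P (Suc k)"
  unfolding sections_def
proof safe
  fix r assume "r \<in> Poly_Mapping.keys (s * f)"
  then obtain p q where pq: "r = p + q" "p \<in> Poly_Mapping.keys s" "q \<in> Poly_Mapping.keys f"
    using keys_mult[of s f] by auto
  from pq(2,3) s f have "rvec p \<in> P" "rvec q \<in> (*\<^sub>R) (real k) ` P"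
    by (auto simp: sections_def)
  then obtain x y where xy: "x \<in> P" "y \<in> P" "rvec p = x" "rvec q = real k *\<^sub>R y"
    by blast
  have "(1 / real (Suc k)) *\<^sub>R x + (real k / real (Suc k)) *\<^sub>R y \<in> P"
    using P xy by (intro convexD) (auto simp: field_simps)
  moreover have "rvec r = real (Suc k) *\<^sub>R ((1 / real (Suc k)) *\<^sub>R x + (real k / real (Suc k)) *\<^sub>R y)"
    by (simp add: pq(1) rvec_add xy scaleR_add_right del: of_nat_Suc)
  ultimately show "rvec r \<in> (*\<^sub>R) (real (Suc k)) ` P"
    by (rule rev_image_eqI)
qed

text \<open>The cokernel of multiplication by \<open>s\<close>. The multiples of level-k monomials
  are completed by monomials to a basis of level k+1, and cardinalities and weights add up over the
  two pieces. For homogeneous \<open>s\<close> the product with z^q has weight -(w + <q,l>), which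
  is the source of the term w d_k. \<open>B\<close> is chosen before \<open>l\<close> and works for
  all of them.\<close>

lemma sections_quotient_basis:
  fixes P :: "(real^'n) set"
  assumes P: "convex P" "bounded P" and s: "s \<in> sections P 1" "s \<noteq> 0"
  obtains B where
    "quotient_basis lscale (sections P (Suc k)) ((*) s ` sections P k) (monom ` B)"
    "int (card B) = int (dim_X P (Suc k)) - int (dim_X P k)"
    "\<forall>l w. (\<forall>p\<in>Poly_Mapping.keys s. rvec p \<bullet> l = w) \<longrightarrow>
       - (\<Sum>p\<in>B. rvec p \<bullet> l) = weight_X P l (Suc k) - weight_X P l k + w * real (dim_X P k)"
proof -
  let ?L = "lattice_points P"
  define C where "C = (\<lambda>p. s * monom p) ` ?L k"
  have fin: "finite (?L j)" for j
    by (rule finite_lattice_points_scaled) fact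
  have C: "finite C" "laurent.independent C" "laurent.span C = (*) s ` sections P k"
    unfolding C_def
    using independent_mult_monom[OF fin s(2)] span_mult_monom[OF P(2)] fin by auto
  have CV: "C \<subseteq> sections P (Suc k)"
    unfolding C_def using mult_sections[OF P(1) s(1)] by (auto simp: sections_iff)
  obtain B' where B': "B' \<subseteq> monom ` ?L (Suc k)" "B' \<inter> C = {}"
    "quotient_basis lscale (sections P (Suc k)) (laurent.span C) B'"
    "quotient_basis lscale (sections P (Suc k)) {0} (B' \<union> C)"
  proof (rule laurent.extend_to_quotient_basis[OF C(1,2) subspace_sections CV])
    show "monom ` ?L (Suc k) \<subseteq> sections P (Suc k)"
      by (auto simp: sections_iff)
    show "sections P (Suc k) \<subseteq> laurent.span (monom ` ?L (Suc k))"
      using span_monom[OF P(2), of "Suc k"] by (simp add: image_id)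
  qed (use fin in auto)
  obtain B where B: "B \<subseteq> ?L (Suc k)" "B' = monom ` B"
    using B'(1) by (meson subset_image_iff)
  have finB: "finite B" using B(1) fin finite_subset by blast
  have injB: "inj_on monom B" and injL: "inj_on monom (?L j)"
    and injC: "inj_on (\<lambda>p. s * monom p) (?L j)" for j
    using inj_monom inj_mult_monom[OF s(2)] by (auto intro: inj_on_subset)
  have "dim_X P (Suc k) = card (B' \<union> C)"
    unfolding dim_X_def by (rule laurent.quotient_dim_eq[OF _ _ B'(4)]) (auto simp: sections_def)
  also have "\<dots> = card B' + card C"
    using B' B finB C by (intro card_Un_disjoint) auto
  also have "card C = dim_X P k"
    unfolding C_def using injC by (simp add: card_image dim_X_eq P)
  finally have card: "int (card B) = int (dim_X P (Suc k)) - int (dim_X P k)"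
    using injB by (simp add: B card_image)
  have weight: "- (\<Sum>p\<in>B. rvec p \<bullet> l) =
      weight_X P l (Suc k) - weight_X P l k + w * real (dim_X P k)"
    if hom: "\<And>p. p \<in> Poly_Mapping.keys s \<Longrightarrow> rvec p \<bullet> l = w" for l w
  proof -
    interpret linear_action lscale "lact l" "sections P (Suc k)" "{0}"
      by (rule linear_action_sections)
    have hC: "rvec p \<bullet> l = w + rvec q \<bullet> l" if "p \<in> Poly_Mapping.keys (s * monom q)" for p q
      using keys_mult[of s "monom q"] that hom by (auto simp: rvec_add inner_add_left)
    have nz: "s * monom q \<noteq> 0" for q
      using laurent_mult_eq_0[of s "monom q"] s(2) by (auto simp: monom_neq_0)
    have "weight_basis lscale (lact l) (sections P (Suc k)) {0} (B' \<union> C) (basis_weight l)"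
      unfolding weight_basis_def
      using B'(4) basis_weight_homogeneous(2)[OF hC nz]
      by (auto simp: B C_def basis_weight_monom(2))
    from total_weight_eq[OF this]
    have "weight_X P l (Suc k) = (\<Sum>b\<in>B'. basis_weight l b) + (\<Sum>b\<in>C. basis_weight l b)"
      unfolding weight_X_def using B' B finB C by (simp add: sum.union_disjoint)
    also have "(\<Sum>b\<in>B'. basis_weight l b) = - (\<Sum>p\<in>B. rvec p \<bullet> l)"
      using injB by (simp add: B sum.reindex basis_weight_monom(1) sum_negf)
    also have "(\<Sum>b\<in>C. basis_weight l b) = (\<Sum>p\<in>?L k. - (w + rvec p \<bullet> l))"
      unfolding C_def using injC basis_weight_homogeneous(1)[OF hC nz]
      by (simp add: sum.reindex)
    also have "\<dots> = weight_X P l k - w * real (dim_X P k)"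
      by (simp add: weight_X_eq dim_X_eq P sum_negf sum.distrib sum_subtractf)
    finally show ?thesis by simp
  qed
  show thesis
    using B'(3) C(3) card by (intro that[of B] allI impI weight) (auto simp: B)
qed

subsection \<open>Facet inequalities of a reflexive polytope\<close>

text \<open>The form in which reflexivity is used: integral normals and the common bound -1. A
  lattice point on every bounding hyperplane allows translations that move one hyperplane section
  onto another, and it excludes u = 0.\<close>

locale facet_polytope =
  fixes P :: "(real^'n) set" and U :: "(int^'n) set"
  assumes lattice: "lattice_polytope P"
    and finite_U: "finite U"
    and P_eq: "P = {x. \<forall>u\<in>U. x \<bullet> rvec u \<ge> - 1}"
    and tight: "u \<in> U \<Longrightarrow> \<exists>v. rvec v \<in> P \<and> rvec v \<bullet> rvec u = - 1"

text \<open>The bipolar theorem (\<open>PS\<close>) describes P by all generators of the polar dual;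
  those that are not tight at a lattice point of P are then discarded. A discarded inequality is
  strict at the lattice points generating P, hence strict on all of P.\<close>

lemma reflexive_polytope_facets:
  fixes P :: "(real^'n) set"
  assumes "reflexive_polytope P"
  obtains U where "facet_polytope P U"
proof -
  obtain S where S: "finite S" "polar_dual P = convex hull (rvec ` S)"
    using assms unfolding reflexive_polytope_def lattice_polytope_def by blast
  obtain T where T: "finite T" "P = convex hull (rvec ` T)"
    using assms unfolding reflexive_polytope_def lattice_polytope_def by blast
  have lat: "lattice_polytope P" and "0 \<in> P"
    using assms interior_subset unfolding reflexive_polytope_def by auto
  have SP: "x \<bullet> rvec s \<ge> - 1" if "x \<in> P" "s \<in> S" for x s
    using that S(2) hull_inc[of "rvec s" "rvec ` S"] by (auto simp: polar_dual_def)
  have PS: "x \<in> P" if x: "\<And>s. s \<in> S \<Longrightarrow> x \<bullet> rvec s \<ge> - 1" for x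
  proof (rule ccontr)
    assume "x \<notin> P"
    then obtain a b where ab: "a \<bullet> x < b" "\<And>y. y \<in> P \<Longrightarrow> b < a \<bullet> y"
      using separating_hyperplane_closed_point[of P x] convex_lattice_polytope[OF lat]
        compact_imp_closed[OF compact_lattice_polytope[OF lat]] by blast
    then have "b < 0" using \<open>0 \<in> P\<close> by force
    \<comment> \<open>The origin lies in P, so b is negative and the separating functional can be
      rescaled to have the bound -1 that defines the polar dual.\<close>
    define u where "u = (1 / (- b)) *\<^sub>R a"
    have "u \<in> polar_dual P"
      unfolding polar_dual_def u_def using ab(2) \<open>b < 0\<close>
      by (force simp: field_simps inner_commute)
    also have "polar_dual P \<subseteq> {u. x \<bullet> u \<ge> - 1}"
      unfolding S(2) using x
      by (intro hull_minimal) (auto simp: convex_halfspace_ge)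
    finally have "x \<bullet> u \<ge> - 1" by simp
    with ab(1) \<open>b < 0\<close> show False
      by (simp add: u_def field_simps inner_commute)
  qed
  define U where "U = {s \<in> S. \<exists>v. rvec v \<in> P \<and> rvec v \<bullet> rvec s = - 1}"
  have strict: "x \<bullet> rvec s > - 1" if "x \<in> P" "s \<in> S - U" for x s
  proof -
    have "rvec ` T \<subseteq> {x. rvec s \<bullet> x > - 1}"
    proof (rule image_subsetI, rule CollectI)
      fix t assume "t \<in> T"
      then have "rvec t \<in> P" unfolding T(2) by (intro hull_inc) auto
      with that(2) SP[of "rvec t" s] show "rvec s \<bullet> rvec t > - 1"
        by (force simp: U_def inner_commute)
    qed
    then have "P \<subseteq> {x. rvec s \<bullet> x > - 1}"
      unfolding T(2) by (intro hull_minimal convex_halfspace_gt)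
    with that(1) show ?thesis by (auto simp: inner_commute)
  qed
  have "x \<in> P" if x: "\<forall>u\<in>U. x \<bullet> rvec u \<ge> - 1" for x
  proof (rule ccontr)
    assume "x \<notin> P"
    then obtain s0 where s0: "s0 \<in> S" "x \<bullet> rvec s0 < - 1"
      using PS by force
    have "Min ((\<lambda>s. x \<bullet> rvec s) ` S) \<in> (\<lambda>s. x \<bullet> rvec s) ` S"
      using S(1) s0(1) by (intro Min_in) auto
    then obtain s where s: "s \<in> S" "x \<bullet> rvec s = Min ((\<lambda>s. x \<bullet> rvec s) ` S)"
      by auto
    then have min: "x \<bullet> rvec s \<le> x \<bullet> rvec s'" if "s' \<in> S" for s'
      using S(1) that by simp
    with s0 have neg: "x \<bullet> rvec s < - 1" by force
    \<comment> \<open>Shrinking x until its most violated inequality becomes an equality gives a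
      point of P; the inequality of \<open>s\<close> is tight there although it was
      discarded.\<close>
    define t where "t = - 1 / (x \<bullet> rvec s)"
    have t: "t > 0" "t * (x \<bullet> rvec s) = - 1" using neg by (auto simp: t_def field_simps)
    have "t *\<^sub>R x \<in> P"
      using t min by (intro PS) (metis inner_scaleR_left mult_le_cancel_left_pos)
    moreover have "s \<notin> U" using x neg by force
    ultimately show False
      using strict[of "t *\<^sub>R x" s] s(1) t(2) by simp
  qed
  moreover have "\<forall>u\<in>U. x \<bullet> rvec u \<ge> - 1" if "x \<in> P" for x
    using SP[OF that] by (simp add: U_def)
  ultimately have "P = {x. \<forall>u\<in>U. x \<bullet> rvec u \<ge> - 1}"
    by blast
  moreover have "finite U" "\<And>u. u \<in> U \<Longrightarrow> \<exists>v. rvec v \<in> P \<and> rvec v \<bullet> rvec u = - 1"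
    using S(1) by (auto simp: U_def)
  ultimately have "facet_polytope P U"
    using lat by (intro facet_polytope.intro)
  then show thesis by (rule that)
qed

section \<open>Vertices and their normal cones\<close>

lemma finite_extreme_points:
  assumes "lattice_polytope P"
  shows "finite {v. v extreme_point_of P}" "v extreme_point_of P \<Longrightarrow> v \<in> range rvec"
proof -
  obtain T where T: "finite T" "P = convex hull (rvec ` T)"
    using assms unfolding lattice_polytope_def by blast
  have sub: "{v. v extreme_point_of P} \<subseteq> rvec ` T"
    unfolding T(2) using extreme_point_of_convex_hull by blast
  show "finite {v. v extreme_point_of P}"
    using sub T(1) by (meson finite_imageI finite_subset)
  show "v extreme_point_of P \<Longrightarrow> v \<in> range rvec"
    using sub by blast
qed

text \<open>The normal cones of the vertices cover the whole space, because P is the convex hull of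
  its finitely many vertices.\<close>

lemma minimizing_extreme_point:
  fixes P :: "(real^'n) set" and y :: "real^'n"
  assumes "lattice_polytope P" "P \<noteq> {}"
  obtains v where "v extreme_point_of P" "\<And>x. x \<in> P \<Longrightarrow> v \<bullet> y \<le> x \<bullet> y"
proof -
  let ?E = "{v. v extreme_point_of P}"
  have hull: "P = convex hull ?E"
    by (intro Krein_Milman_Minkowski compact_lattice_polytope convex_lattice_polytope assms)
  then have "?E \<noteq> {}" using assms(2) by (metis convex_hull_empty)
  have "Min ((\<lambda>v. v \<bullet> y) ` ?E) \<in> (\<lambda>v. v \<bullet> y) ` ?E"
    using finite_extreme_points(1)[OF assms(1)] \<open>?E \<noteq> {}\<close> by (intro Min_in) auto
  then obtain v where v: "v \<in> ?E" "v \<bullet> y = Min ((\<lambda>v. v \<bullet> y) ` ?E)" by auto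
  have "?E \<subseteq> {x. y \<bullet> x \<ge> v \<bullet> y}"
    using v(2) finite_extreme_points(1)[OF assms(1)] by (auto simp: inner_commute intro!: Min_le)
  then have "P \<subseteq> {x. y \<bullet> x \<ge> v \<bullet> y}"
    by (subst hull) (intro hull_minimal convex_halfspace_ge)
  then show thesis using v(1) by (intro that[of v]) (auto simp: inner_commute)
qed

(* The cone of all y with z . y < j (x . y) for every x in P is convex, hence connected, and it is
   covered by the closed normal cones of the vertices. *)
lemma constant_on_negative_vertices:
  fixes z :: "real^'n"
  assumes P: "lattice_polytope P" "P \<noteq> {}"
    and c: "\<And>v w y. v extreme_point_of P \<Longrightarrow> w extreme_point_of P \<Longrightarrow>
       (\<And>x. x \<in> P \<Longrightarrow> v \<bullet> y \<le> x \<bullet> y) \<Longrightarrow> (\<And>x. x \<in> P \<Longrightarrow> w \<bullet> y \<le> x \<bullet> y) \<Longrightarrow>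
       (\<And>x. x \<in> P \<Longrightarrow> z \<bullet> y < j * (x \<bullet> y)) \<Longrightarrow> c v = c w"
    and v: "v extreme_point_of P" "\<And>x. x \<in> P \<Longrightarrow> v \<bullet> y \<le> x \<bullet> y"
      "\<And>x. x \<in> P \<Longrightarrow> z \<bullet> y < j * (x \<bullet> y)"
    and w: "w extreme_point_of P" "\<And>x. x \<in> P \<Longrightarrow> w \<bullet> y' \<le> x \<bullet> y'"
      "\<And>x. x \<in> P \<Longrightarrow> z \<bullet> y' < j * (x \<bullet> y')"
  shows "c v = c w"
proof (rule ccontr)
  assume ne: "c v \<noteq> c w"
  define \<sigma> where "\<sigma> a = {y. \<forall>x\<in>P. a \<bullet> y \<le> x \<bullet> y}" for a
  define E1 where "E1 = {a. a extreme_point_of P \<and> c a = c v}"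
  define E2 where "E2 = {a. a extreme_point_of P \<and> c a \<noteq> c v}"
  have closed: "closed (\<Union>a\<in>E. \<sigma> a)" if "E \<subseteq> {a. a extreme_point_of P}" for E
  proof (intro closed_UN ballI)
    show "finite E" using that finite_extreme_points(1)[OF P(1)] finite_subset by blast
    have "\<sigma> a = (\<Inter>x\<in>P. {y. (a - x) \<bullet> y \<le> 0})" for a
      by (auto simp: \<sigma>_def inner_diff_left)
    then show "\<And>a. a \<in> E \<Longrightarrow> closed (\<sigma> a)"
      by (auto intro!: closed_INT closed_halfspace_le)
  qed
  \<comment> \<open>Connectedness is used only along the segment from y to y', which stays in the
    convex cone. \<open>E1\<close> and \<open>E2\<close> split the covering cones by the value of
    \<open>c\<close>, giving two closed sets that are disjoint on the segment.\<close>
  let ?T = "closed_segment y y'"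
  have neg: "z \<bullet> t < j * (x \<bullet> t)" if "t \<in> ?T" "x \<in> P" for t x
  proof -
    have "convex {t. (z - j *\<^sub>R x) \<bullet> t < 0}" by (rule convex_halfspace_lt)
    moreover have "{y, y'} \<subseteq> {t. (z - j *\<^sub>R x) \<bullet> t < 0}"
      using v(3) w(3) that(2) by (auto simp: inner_diff_left)
    ultimately have "?T \<subseteq> {t. (z - j *\<^sub>R x) \<bullet> t < 0}"
      by (metis hull_minimal segment_convex_hull)
    with that(1) show ?thesis by (auto simp: inner_diff_left)
  qed
  have cover: "?T \<subseteq> (\<Union>a\<in>E1. \<sigma> a) \<union> (\<Union>a\<in>E2. \<sigma> a)"
  proof
    fix t assume "t \<in> ?T"
    obtain a where "a extreme_point_of P" "\<And>x. x \<in> P \<Longrightarrow> a \<bullet> t \<le> x \<bullet> t"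
      using minimizing_extreme_point[OF P] by metis
    then have "a extreme_point_of P" "t \<in> \<sigma> a" by (auto simp: \<sigma>_def)
    then show "t \<in> (\<Union>a\<in>E1. \<sigma> a) \<union> (\<Union>a\<in>E2. \<sigma> a)"
      by (auto simp: E1_def E2_def)
  qed
  have disj: "(\<Union>a\<in>E1. \<sigma> a) \<inter> (\<Union>a\<in>E2. \<sigma> a) \<inter> ?T = {}"
  proof (rule ccontr)
    assume "(\<Union>a\<in>E1. \<sigma> a) \<inter> (\<Union>a\<in>E2. \<sigma> a) \<inter> ?T \<noteq> {}"
    then obtain a b t where abt: "a \<in> E1" "b \<in> E2" "t \<in> \<sigma> a" "t \<in> \<sigma> b" "t \<in> ?T"
      by blast
    have "c a = c b"
      using abt neg by (intro c[of a b t]) (auto simp: E1_def E2_def \<sigma>_def)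
    with abt(1,2) show False by (auto simp: E1_def E2_def)
  qed
  have "closed (\<Union>a\<in>E1. \<sigma> a)" "closed (\<Union>a\<in>E2. \<sigma> a)"
    by (auto intro!: closed simp: E1_def E2_def)
  from connected_closedD[OF convex_connected[OF convex_closed_segment] disj cover this]
  have "(\<Union>a\<in>E1. \<sigma> a) \<inter> ?T = {} \<or> (\<Union>a\<in>E2. \<sigma> a) \<inter> ?T = {}" .
  moreover have "y \<in> (\<Union>a\<in>E1. \<sigma> a) \<inter> ?T"
    using v by (auto simp: E1_def \<sigma>_def)
  moreover have "y' \<in> (\<Union>a\<in>E2. \<sigma> a) \<inter> ?T"
    using w ne by (auto simp: E2_def \<sigma>_def)
  ultimately show False by blast
qed

context facet_polytope
begin

lemma zero_in_P: "0 \<in> P"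
  by (simp add: P_eq)

lemma bounded_P: "bounded P" and convex_P: "convex P" and closed_P: "closed P"
  using compact_imp_bounded compact_imp_closed
    compact_lattice_polytope[OF lattice] convex_lattice_polytope[OF lattice] by auto

text \<open>The inequalities that are strict at \<open>v\<close> survive a short step in any
  direction, so only the active ones restrict the directions into P.\<close>

lemma tangent_cone_eq:
  assumes "v \<in> P"
  shows "tangent_cone P v = {x. \<forall>u\<in>U. v \<bullet> rvec u = - 1 \<longrightarrow> x \<bullet> rvec u \<ge> 0}"
proof (intro equalityI subsetI)
  fix x assume "x \<in> tangent_cone P v"
  then obtain c y where "x = c *\<^sub>R (y - v)" "c \<ge> 0" "y \<in> P"
    by (auto simp: tangent_cone_def conic_hull_explicit)
  then show "x \<in> {x. \<forall>u\<in>U. v \<bullet> rvec u = - 1 \<longrightarrow> x \<bullet> rvec u \<ge> 0}"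
    by (auto simp: P_eq inner_diff_left)
next
  fix x assume x: "x \<in> {x. \<forall>u\<in>U. v \<bullet> rvec u = - 1 \<longrightarrow> x \<bullet> rvec u \<ge> 0}"
  have "\<forall>\<^sub>F e in at_right 0. \<forall>u\<in>U. (v + e *\<^sub>R x) \<bullet> rvec u \<ge> - 1"
  proof (intro eventually_ball_finite finite_U ballI)
    fix u assume u: "u \<in> U"
    show "\<forall>\<^sub>F e in at_right 0. (v + e *\<^sub>R x) \<bullet> rvec u \<ge> - 1"
    proof (cases "v \<bullet> rvec u = - 1")
      case True
      then have nonneg: "x \<bullet> rvec u \<ge> 0" using x u by blast
      show ?thesis
        using eventually_at_right_less[of "0::real"]
        by eventually_elim (simp add: inner_add_left True nonneg)
    next
      case False
      then have "v \<bullet> rvec u > - 1" using assms u by (force simp: P_eq)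
      moreover have "((\<lambda>e. (v + e *\<^sub>R x) \<bullet> rvec u) \<longlongrightarrow> (v + 0 *\<^sub>R x) \<bullet> rvec u) (at_right 0)"
        by (intro tendsto_intros)
      ultimately have "\<forall>\<^sub>F e in at_right 0. (v + e *\<^sub>R x) \<bullet> rvec u > - 1"
        by (intro order_tendstoD(1)) auto
      then show ?thesis by eventually_elim simp
    qed
  qed
  then have "\<forall>\<^sub>F e in at_right 0. v + e *\<^sub>R x \<in> P \<and> e > 0"
    using eventually_at_right_less[of "0::real"]
    by eventually_elim (auto simp: P_eq)
  then obtain e where e: "v + e *\<^sub>R x \<in> P" "e > 0"
    using eventually_happens[of _ "at_right (0::real)"] trivial_limit_at_right_real by fastforce
  have "x = (1 / e) *\<^sub>R ((v + e *\<^sub>R x) - v)" using e(2) by simp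
  then show "x \<in> tangent_cone P v"
    unfolding tangent_cone_def conic_hull_explicit using e by fastforce
qed

end

subsection \<open>Sections over an anticanonical divisor\<close>

lemma chart_sections_0: "0 \<in> chart_sections P v w j"
  by (simp add: chart_sections_def)

lemma chart_sections_add:
  "f \<in> chart_sections P v w j \<Longrightarrow> g \<in> chart_sections P v w j \<Longrightarrow> f + g \<in> chart_sections P v w j"
  using Poly_Mapping.keys_add[of f g] unfolding chart_sections_def by blast

lemma chart_sections_lscale:
  "f \<in> chart_sections P v w j \<Longrightarrow> lscale c f \<in> chart_sections P v w j"
  using keys_lscale[of c f] unfolding chart_sections_def by blast

lemma chart_sections_lact:
  assumes "f \<in> chart_sections P v w j"
  shows "lact l t f \<in> chart_sections P v w j"
proof -
  have "Poly_Mapping.keys (lact l t f) \<subseteq> Poly_Mapping.keys f"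
    by (auto simp: in_keys_iff lookup_lact)
  with assms show ?thesis unfolding chart_sections_def by blast
qed

text \<open>The restriction to Y of a global section, with the same representative in each chart;
  the value 0 off the vertices follows the convention of \<open>restr_sections\<close>.\<close>

definition constant_family :: "(real^'n) set \<Rightarrow> 'n::finite laurent \<Rightarrow> real^'n \<Rightarrow> 'n laurent" where
  "constant_family P F = (\<lambda>v. if v extreme_point_of P then F else 0)"

lemma subspace_restr_null: "family.subspace (restr_null P s k)"
  unfolding family.subspace_def
proof (intro conjI ballI allI)
  show "0 \<in> restr_null P s k"
    using chart_sections_0 by (force simp: restr_null_def chart_ideal_def)
  show "f + g \<in> restr_null P s k" if "f \<in> restr_null P s k" "g \<in> restr_null P s k" for f g
    using that unfolding restr_null_def chart_ideal_def
    by (auto simp flip: distrib_left intro!: imageI chart_sections_add dest!: spec)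
  show "(\<lambda>v. lscale c (f v)) \<in> restr_null P s k" if "f \<in> restr_null P s k" for c f
    using that unfolding restr_null_def chart_ideal_def
    by (auto simp flip: mult_lscale intro!: imageI chart_sections_lscale dest!: spec)
qed

lemma zero_in_restr_sections: "0 \<in> restr_sections P s k"
  using chart_sections_0 by (force simp: restr_sections_def chart_ideal_def)

text \<open>A homogeneous equation generates an ideal stable under the torus, so the action descends
  to sections over the divisor.\<close>

lemma linear_action_restr:
  assumes "\<And>p. p \<in> Poly_Mapping.keys s \<Longrightarrow> rvec p \<bullet> l = w"
  shows "linear_action (\<lambda>c f v. lscale c (f v)) (\<lambda>t f v. lact l t (f v))
    (restr_sections P s k) (restr_null P s k)"
proof unfold_locales
  show "family.subspace (restr_null P s k)" by (rule subspace_restr_null)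
  show "(\<lambda>v. lact l t (f v)) \<in> restr_null P s k" if "f \<in> restr_null P s k" "t > 0" for f t
    using that(1) unfolding restr_null_def chart_ideal_def
    by (auto simp: lact_0 lact_mult_homogeneous[OF assms]
        intro!: imageI chart_sections_lscale chart_sections_lact dest!: spec)
qed (auto simp: zero_in_restr_sections lact_add lact_lscale fun_eq_iff)

context facet_polytope
begin

lemma extreme_in_P: "v extreme_point_of P \<Longrightarrow> v \<in> P"
  by (simp add: extreme_point_of_def)

text \<open>On a single chart the sum of the cone with itself collapses to that cone (take y = 0),
  leaving the inequalities active at \<open>v\<close>. As <v,u> = -1 there, the trivialisation by
  z^v turns the bound 0 into -j.\<close>

lemma chart_sections_diag:
  assumes "v \<in> P"
  shows "f \<in> chart_sections P v v j \<longleftrightarrow> (\<forall>p\<in>Poly_Mapping.keys f. \<forall>u\<in>U.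
     v \<bullet> rvec u = - 1 \<longrightarrow> rvec p \<bullet> rvec u \<ge> - of_int j)"
proof -
  have "(\<exists>x\<in>tangent_cone P v. \<exists>y\<in>tangent_cone P v. z = of_int j *\<^sub>R v + x + y) \<longleftrightarrow>
      (\<forall>u\<in>U. v \<bullet> rvec u = - 1 \<longrightarrow> z \<bullet> rvec u \<ge> - of_int j)" for z
  proof
    assume r: "\<forall>u\<in>U. v \<bullet> rvec u = - 1 \<longrightarrow> z \<bullet> rvec u \<ge> - of_int j"
    show "\<exists>x\<in>tangent_cone P v. \<exists>y\<in>tangent_cone P v. z = of_int j *\<^sub>R v + x + y"
      by (rule bexI[of _ "z - of_int j *\<^sub>R v"], rule bexI[of _ 0])
        (use r in \<open>auto simp: tangent_cone_eq[OF assms] inner_diff_left\<close>)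
  qed (auto simp: tangent_cone_eq[OF assms] inner_add_left)
  then show ?thesis by (simp add: chart_sections_def)
qed

lemma mult_chart_sections:
  assumes "v \<in> P" "s \<in> sections P 1" "h \<in> chart_sections P v v j"
  shows "s * h \<in> chart_sections P v v (j + 1)"
  unfolding chart_sections_diag[OF assms(1)]
proof (intro ballI impI)
  fix r u assume r: "r \<in> Poly_Mapping.keys (s * h)" and u: "u \<in> U" "v \<bullet> rvec u = - 1"
  obtain p q where pq: "r = p + q" "p \<in> Poly_Mapping.keys s" "q \<in> Poly_Mapping.keys h"
    using r keys_mult[of s h] by auto
  then have "rvec p \<bullet> rvec u \<ge> - 1"
    using assms(2) u by (auto simp: sections_def P_eq)
  moreover have "rvec q \<bullet> rvec u \<ge> - of_int j"
    using assms(1,3) pq(3) u by (auto simp: chart_sections_diag)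
  ultimately show "rvec r \<bullet> rvec u \<ge> - of_int (j + 1)"
    by (simp add: pq(1) rvec_add inner_add_left)
qed

(* Vanishing of H^1(X, K^{-j}) for Cech cocycles. *)
lemma cocycle_trivial:
  fixes c :: "real^'n \<Rightarrow> 'n laurent" and j :: nat
  assumes c: "\<And>v w. v extreme_point_of P \<Longrightarrow> w extreme_point_of P \<Longrightarrow>
    c v - c w \<in> chart_sections P v w (int j)"
  obtains m where "\<And>v. v extreme_point_of P \<Longrightarrow> c v - m \<in> chart_sections P v v (int j)"
proof -
  \<comment> \<open>The vertices over whose charts z^p is not a section of K^{-j}. Once the
    coefficient of z^p in \<open>c\<close> is known to be constant on them, subtracting this
    constant repairs all these charts, while on the other charts z^p is an admissible
    section.\<close>
  define neg where "neg p = {v. v extreme_point_of P \<and>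
    (\<exists>u\<in>U. v \<bullet> rvec u = - 1 \<and> rvec p \<bullet> rvec u < - real j)}" for p :: "int^'n"
  have const: "Poly_Mapping.lookup (c v) p = Poly_Mapping.lookup (c w) p"
    if "v \<in> neg p" "w \<in> neg p" for v w p
  proof -
    have neg: "rvec p \<bullet> rvec u < real j * (x \<bullet> rvec u)"
      if "rvec p \<bullet> rvec u < - real j" "x \<in> P" "u \<in> U" for u x
    proof -
      have "real j * (- 1) \<le> real j * (x \<bullet> rvec u)"
        using that by (intro mult_left_mono) (auto simp: P_eq)
      with that(1) show ?thesis by simp
    qed
    obtain u where u: "u \<in> U" "v \<bullet> rvec u = - 1" "rvec p \<bullet> rvec u < - real j"
      using \<open>v \<in> neg p\<close> by (auto simp: neg_def)
    obtain u' where u': "u' \<in> U" "w \<bullet> rvec u' = - 1" "rvec p \<bullet> rvec u' < - real j"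
      using \<open>w \<in> neg p\<close> by (auto simp: neg_def)
    show ?thesis
    \<comment> \<open>The violated normals u and u' take their minimum -1 over P at v and w, so they
      lie in the two normal cones; the violation itself gives <p,u> < j <x,u> for all x in
      P.\<close>
    proof (rule constant_on_negative_vertices[OF lattice, of "rvec p" "real j"
          "\<lambda>v. Poly_Mapping.lookup (c v) p" v "rvec u" w "rvec u'"])
      fix v w y assume vw: "v extreme_point_of P" "w extreme_point_of P"
        and y: "\<And>x. x \<in> P \<Longrightarrow> v \<bullet> y \<le> x \<bullet> y" "\<And>x. x \<in> P \<Longrightarrow> w \<bullet> y \<le> x \<bullet> y"
          "\<And>x. x \<in> P \<Longrightarrow> rvec p \<bullet> y < real j * (x \<bullet> y)"
      show "Poly_Mapping.lookup (c v) p = Poly_Mapping.lookup (c w) p"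
      proof (rule ccontr)
        assume "Poly_Mapping.lookup (c v) p \<noteq> Poly_Mapping.lookup (c w) p"
        \<comment> \<open>An exponent on the intersection of two charts is j v plus elements of both
          tangent cones, and \<open>y\<close> is nonnegative on both; this contradicts the strict
          inequality at v.\<close>
        then have "p \<in> Poly_Mapping.keys (c v - c w)"
          by (simp add: in_keys_iff lookup_minus)
        then obtain a b where ab: "a \<in> tangent_cone P v" "b \<in> tangent_cone P w"
          "rvec p = real j *\<^sub>R v + a + b"
          using c[OF vw] by (auto simp: chart_sections_def)
        have "a \<bullet> y \<ge> 0" "b \<bullet> y \<ge> 0"
          using ab(1,2) y(1,2)
          by (auto simp: tangent_cone_def conic_hull_explicit inner_diff_left)
        with ab(3) have "rvec p \<bullet> y \<ge> real j * (v \<bullet> y)"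
          by (simp add: inner_add_left)
        with y(3)[OF extreme_in_P[OF vw(1)]] show False by simp
      qed
    next
      show "v extreme_point_of P" "w extreme_point_of P"
        using that by (auto simp: neg_def)
      show "v \<bullet> rvec u \<le> x \<bullet> rvec u" "rvec p \<bullet> rvec u < real j * (x \<bullet> rvec u)"
        "w \<bullet> rvec u' \<le> x \<bullet> rvec u'" "rvec p \<bullet> rvec u' < real j * (x \<bullet> rvec u')" if "x \<in> P" for x
        using neg[OF u(3) that u(1)] neg[OF u'(3) that u'(1)] u(1,2) u'(1,2) that by (auto simp: P_eq)
    qed (use zero_in_P in blast)
  qed
  define K where "K = {p \<in> (\<Union>v\<in>{v. v extreme_point_of P}. Poly_Mapping.keys (c v)). neg p \<noteq> {}}"
  \<comment> \<open>By \<open>const\<close> the common coefficient on \<open>neg p\<close> does not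
    depend on the vertex selected here.\<close>
  define m where "m = (\<Sum>p\<in>K. Poly_Mapping.single p (Poly_Mapping.lookup (c (SOME v. v \<in> neg p)) p))"
  have "finite K"
    using finite_extreme_points(1)[OF lattice] by (auto simp: K_def)
  then have lookup_m: "Poly_Mapping.lookup m p =
      (if p \<in> K then Poly_Mapping.lookup (c (SOME v. v \<in> neg p)) p else 0)" for p
    by (simp add: m_def lookup_sum lookup_single when_def)
  have "c v - m \<in> chart_sections P v v (int j)" if v: "v extreme_point_of P" for v
    unfolding chart_sections_diag[OF extreme_in_P[OF v]]
  proof (intro ballI impI)
    fix p u assume p: "p \<in> Poly_Mapping.keys (c v - m)" and u: "u \<in> U" "v \<bullet> rvec u = - 1"
    show "rvec p \<bullet> rvec u \<ge> - of_int (int j)"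
    proof (rule ccontr)
      assume "\<not> ?thesis"
      then have vn: "v \<in> neg p" using u v by (auto simp: neg_def)
      define w where "w = (SOME v. v \<in> neg p)"
      have wn: "w \<in> neg p" unfolding w_def using vn by (rule someI)
      have "Poly_Mapping.lookup m p = Poly_Mapping.lookup (c w) p"
      proof (cases "p \<in> K")
        case False
        with wn have "p \<notin> Poly_Mapping.keys (c w)" by (auto simp: K_def neg_def)
        with False show ?thesis by (simp add: lookup_m in_keys_iff)
      qed (simp add: lookup_m w_def)
      with const[OF vn wn] p show False by (simp add: in_keys_iff lookup_minus)
    qed
  qed
  then show thesis by (rule that)
qed

text \<open>Surjectivity of restriction to Y. Dividing the differences f v - f w by \<open>s\<close>
  gives a Cech cocycle of K^{-j}; its trivialisation corrects the representatives by multiples of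
  \<open>s\<close> until they agree.\<close>

lemma restr_sections_lift:
  assumes s: "s \<in> sections P 1" "s \<noteq> 0" and f: "f \<in> restr_sections P s (Suc j)"
  obtains F where "F \<in> sections P (Suc j)" "f - constant_family P F \<in> restr_null P s (Suc j)"
proof -
  obtain v0 where v0: "v0 extreme_point_of P"
    using minimizing_extreme_point[OF lattice, of 0] zero_in_P by blast
  have f_chart: "f v \<in> chart_sections P v v (int (Suc j))" if "v extreme_point_of P" for v
    using f that by (auto simp: restr_sections_def)
  have "\<forall>v w. \<exists>g. v extreme_point_of P \<longrightarrow> w extreme_point_of P \<longrightarrow>
      f v - f w = s * g \<and> g \<in> chart_sections P v w (int j)"
  proof (intro allI)
    fix v w
    show "\<exists>g. v extreme_point_of P \<longrightarrow> w extreme_point_of P \<longrightarrow>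
      f v - f w = s * g \<and> g \<in> chart_sections P v w (int j)"
    proof (cases "v extreme_point_of P \<and> w extreme_point_of P")
      case True
      then have "f v - f w \<in> chart_ideal P s v w (int (Suc j))"
        using f by (simp add: restr_sections_def)
      then show ?thesis by (auto simp: chart_ideal_def)
    qed auto
  qed
  then obtain g where g: "\<And>v w. v extreme_point_of P \<Longrightarrow> w extreme_point_of P \<Longrightarrow>
      f v - f w = s * g v w \<and> g v w \<in> chart_sections P v w (int j)"
    by metis
  \<comment> \<open>Cancelling \<open>s\<close> gives g v w = g v v0 - g w v0, so fixing the second
    vertex produces a cochain whose coboundary is the cocycle.\<close>
  have "g v v0 - g w v0 \<in> chart_sections P v w (int j)"
    if "v extreme_point_of P" "w extreme_point_of P" for v w
  proof -
    have "s * (g v v0 - g w v0) = (f v - f v0) - (f w - f v0)"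
      using g that v0 by (simp add: right_diff_distrib)
    also have "\<dots> = s * g v w" using g that by simp
    finally have "g v v0 - g w v0 = g v w"
      using s(2) by (simp add: laurent_mult_left_cancel)
    with g that show ?thesis by simp
  qed
  then obtain m where m: "\<And>v. v extreme_point_of P \<Longrightarrow> g v v0 - m \<in> chart_sections P v v (int j)"
    using cocycle_trivial[of "\<lambda>v. g v v0"] by blast
  define F where "F = f v0 + s * m"
  have fF: "f v - F = s * (g v v0 - m)" if "v extreme_point_of P" for v
    using g[OF that v0] by (simp add: F_def right_diff_distrib algebra_simps)
  have "F \<in> chart_sections P v v (int (Suc j))" if v: "v extreme_point_of P" for v
  proof -
    have "s * (g v v0 - m) \<in> chart_sections P v v (int (Suc j))"
      using mult_chart_sections[OF extreme_in_P[OF v] s(1) m[OF v]] by (simp add: add.commute)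
    then have "f v + lscale (- 1) (s * (g v v0 - m)) \<in> chart_sections P v v (int (Suc j))"
      by (intro chart_sections_add chart_sections_lscale f_chart v)
    also have "f v + lscale (- 1) (s * (g v v0 - m)) = F"
      using fF[OF v] by (simp add: algebra_simps)
    finally show ?thesis .
  qed
  then have "F \<in> sections P (Suc j)"
    using sections_eq_glued_chart_sections[OF lattice] zero_in_P by blast
  moreover have "f - constant_family P F \<in> restr_null P s (Suc j)"
    unfolding restr_null_def
  proof (intro CollectI conjI allI impI)
    show "(f - constant_family P F) v = 0" if "\<not> v extreme_point_of P" for v
      using that f by (simp add: constant_family_def restr_sections_def)
    show "(f - constant_family P F) v \<in> chart_ideal P s v v (int (Suc j))"
      if "v extreme_point_of P" for v
      using that m[OF that] by (simp add: constant_family_def fF chart_ideal_def)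
  qed
  ultimately show thesis by (rule that)
qed

lemma constant_family_in_restr_sections:
  assumes "F \<in> sections P k"
  shows "constant_family P F \<in> restr_sections P s k"
proof -
  have "F \<in> chart_sections P v v (int k)" if "v extreme_point_of P" for v
    using assms that sections_eq_glued_chart_sections[OF lattice, of k] zero_in_P by blast
  moreover have "0 \<in> chart_ideal P s v w (int k)" for v w
    unfolding chart_ideal_def using chart_sections_0 by (rule rev_image_eqI) simp
  ultimately show ?thesis
    by (simp add: restr_sections_def constant_family_def)
qed

text \<open>The kernel of restriction: the local quotients of \<open>F\<close> by \<open>s\<close>
  coincide because \<open>s\<close> can be cancelled, so they glue to a global section.\<close>

lemma constant_family_in_restr_null:
  assumes "s \<noteq> 0"
  shows "constant_family P F \<in> restr_null P s (Suc j) \<longleftrightarrow> F \<in> (*) s ` sections P j"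
proof
  assume l: "constant_family P F \<in> restr_null P s (Suc j)"
  obtain v0 where v0: "v0 extreme_point_of P"
    using minimizing_extreme_point[OF lattice, of 0] zero_in_P by blast
  have ex: "\<exists>h. F = s * h \<and> h \<in> chart_sections P v v (int j)" if "v extreme_point_of P" for v
    using l that by (auto simp: restr_null_def constant_family_def chart_ideal_def)
  then obtain h where h: "F = s * h" using v0 by blast
  have "h \<in> chart_sections P v v (int j)" if "v extreme_point_of P" for v
    using ex[OF that] h assms by (auto simp: laurent_mult_left_cancel)
  then have "h \<in> sections P j"
    using sections_eq_glued_chart_sections[OF lattice] zero_in_P by blast
  with h show "F \<in> (*) s ` sections P j" by blast
next
  assume "F \<in> (*) s ` sections P j"
  then obtain h where h: "h \<in> sections P j" "F = s * h" by blast
  have "h \<in> chart_sections P v v (int j)" if "v extreme_point_of P" for v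
    using h(1) that sections_eq_glued_chart_sections[OF lattice, of j] zero_in_P by blast
  then show "constant_family P F \<in> restr_null P s (Suc j)"
    by (simp add: restr_null_def constant_family_def chart_ideal_def h(2))
qed

lemma inj_constant_family: "inj (constant_family P)"
proof -
  obtain v0 where v0: "v0 extreme_point_of P"
    using minimizing_extreme_point[OF lattice, of 0] zero_in_P by blast
  then show ?thesis
    by (intro inj_on_inverseI[of _ "\<lambda>f. f v0"]) (simp add: constant_family_def)
qed

lemma constant_family_sum:
  "(\<Sum>b\<in>B. (\<lambda>v. lscale (c b) (constant_family P b v))) = constant_family P (\<Sum>b\<in>B. lscale (c b) b)"
  by (induction B rule: infinite_finite_induct) (auto simp: constant_family_def fun_eq_iff)

text \<open>Constant families induce an isomorphism from the cokernel of multiplication by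
  \<open>s\<close> to the sections over Y: \<open>constant_family_in_restr_null\<close> gives
  injectivity and \<open>restr_sections_lift\<close> surjectivity. Bases are carried along
  it.\<close>

lemma restr_quotient_basis:
  assumes s: "s \<in> sections P 1" "s \<noteq> 0"
    and B: "quotient_basis lscale (sections P (Suc j)) ((*) s ` sections P j) B"
  shows "quotient_basis (\<lambda>c f v. lscale c (f v)) (restr_sections P s (Suc j))
    (restr_null P s (Suc j)) (constant_family P ` B)"
proof (rule family.quotient_basisI[OF subspace_restr_null])
  have inj: "inj_on (constant_family P) B"
    using inj_constant_family by (rule inj_on_subset) simp
  have sum: "(\<Sum>b\<in>constant_family P ` B. (\<lambda>v. lscale (c b) (b v))) =
      constant_family P (\<Sum>b\<in>B. lscale (c (constant_family P b)) b)" for c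
    by (simp add: sum.reindex[OF inj] constant_family_sum)
  show "finite (constant_family P ` B)"
    using B by (simp add: quotient_basis_def)
  show "constant_family P ` B \<subseteq> restr_sections P s (Suc j)"
    using B constant_family_in_restr_sections by (auto simp: quotient_basis_def)
  show "c b = 0" if c0: "(\<Sum>b\<in>constant_family P ` B. (\<lambda>v. lscale (c b) (b v))) \<in> restr_null P s (Suc j)"
    and b: "b \<in> constant_family P ` B" for c b
  proof -
    obtain a where a: "a \<in> B" "b = constant_family P a" using b by blast
    have "(\<Sum>b\<in>B. lscale (c (constant_family P b)) b) \<in> (*) s ` sections P j"
      using c0 by (simp only: sum constant_family_in_restr_null[OF s(2)])
    from laurent.quotient_basis_independent[OF subspace_mult_sections
        laurent.subspace_0[OF subspace_sections] B this a(1)]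
    show ?thesis by (simp add: a(2))
  qed
  show "\<exists>c. f - (\<Sum>b\<in>constant_family P ` B. (\<lambda>v. lscale (c b) (b v))) \<in> restr_null P s (Suc j)"
    if f: "f \<in> restr_sections P s (Suc j)" for f
  proof -
    obtain F where F: "F \<in> sections P (Suc j)" "f - constant_family P F \<in> restr_null P s (Suc j)"
      by (rule restr_sections_lift[OF s f])
    obtain c where c: "F - (\<Sum>b\<in>B. lscale (c b) b) \<in> (*) s ` sections P j"
      by (rule laurent.quotient_basis_span[OF B F(1)])
    define c' where "c' = c \<circ> inv_into B (constant_family P)"
    have c': "(\<Sum>b\<in>B. lscale (c' (constant_family P b)) b) = (\<Sum>b\<in>B. lscale (c b) b)"
      by (intro sum.cong refl) (simp add: c'_def inv_into_f_f[OF inj])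
    have "constant_family P (F - (\<Sum>b\<in>B. lscale (c b) b)) \<in> restr_null P s (Suc j)"
      using c by (simp only: constant_family_in_restr_null[OF s(2)])
    from family.subspace_add[OF subspace_restr_null F(2) this]
    have "f - constant_family P F + constant_family P (F - (\<Sum>b\<in>B. lscale (c b) b))
      \<in> restr_null P s (Suc j)" .
    also have "f - constant_family P F + constant_family P (F - (\<Sum>b\<in>B. lscale (c b) b)) =
        f - constant_family P (\<Sum>b\<in>B. lscale (c b) b)"
      by (auto simp: constant_family_def fun_eq_iff)
    finally show ?thesis
      by (intro exI[of _ c']) (simp only: sum c')
  qed
qed

lemma dim_Y_eq:
  assumes s: "s \<in> sections P 1" "s \<noteq> 0"
  shows "real (dim_Y P s (Suc j)) = real (dim_X P (Suc j)) - real (dim_X P j)"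
proof -
  obtain B where B: "quotient_basis lscale (sections P (Suc j)) ((*) s ` sections P j) (monom ` B)"
    "int (card B) = int (dim_X P (Suc j)) - int (dim_X P j)"
    "\<forall>l w. (\<forall>p\<in>Poly_Mapping.keys s. rvec p \<bullet> l = w) \<longrightarrow>
       - (\<Sum>p\<in>B. rvec p \<bullet> l) = weight_X P l (Suc j) - weight_X P l j + w * real (dim_X P j)"
    by (rule sections_quotient_basis[OF convex_P bounded_P s, of j])
  have "dim_Y P s (Suc j) = card (constant_family P ` monom ` B)"
    unfolding dim_Y_def
    by (rule family.quotient_dim_eq[OF subspace_restr_null zero_in_restr_sections
          restr_quotient_basis[OF s B(1)]])
  also have "\<dots> = card B"
    by (simp add: card_image inj_on_subset[OF inj_constant_family] inj_on_subset[OF inj_monom])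
  finally show ?thesis using B(2) by linarith
qed

lemma weight_Y_eq:
  assumes s: "s \<in> sections P 1" "s \<noteq> 0"
    and hom: "\<And>p. p \<in> Poly_Mapping.keys s \<Longrightarrow> rvec p \<bullet> l = w"
  shows "weight_Y P s l (Suc j) = weight_X P l (Suc j) - weight_X P l j + w * real (dim_X P j)"
proof -
  obtain B where B: "quotient_basis lscale (sections P (Suc j)) ((*) s ` sections P j) (monom ` B)"
    "int (card B) = int (dim_X P (Suc j)) - int (dim_X P j)"
    "\<forall>l w. (\<forall>p\<in>Poly_Mapping.keys s. rvec p \<bullet> l = w) \<longrightarrow>
       - (\<Sum>p\<in>B. rvec p \<bullet> l) = weight_X P l (Suc j) - weight_X P l j + w * real (dim_X P j)"
    by (rule sections_quotient_basis[OF convex_P bounded_P s, of j])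
  obtain v0 where v0: "v0 extreme_point_of P"
    using minimizing_extreme_point[OF lattice, of 0] zero_in_P by blast
  interpret linear_action "\<lambda>c f v. lscale c (f v)" "\<lambda>t f v. lact l t (f v)"
    "restr_sections P s (Suc j)" "restr_null P s (Suc j)"
    by (rule linear_action_restr[OF hom])
  \<comment> \<open>The weight of a family is read off at one fixed vertex, where a constant family
    takes its common value.\<close>
  have act: "(\<lambda>v. lact l t (constant_family P (monom p) v)) =
      (\<lambda>v. lscale (of_real (t powr basis_weight l (constant_family P (monom p) v0)))
        (constant_family P (monom p) v))" for t p
    using v0 by (simp add: fun_eq_iff constant_family_def basis_weight_monom(2)[of l] lact_0)
  have "weight_basis (\<lambda>c f v. lscale c (f v)) (\<lambda>t f v. lact l t (f v)) (restr_sections P s (Suc j))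
      (restr_null P s (Suc j)) (constant_family P ` monom ` B) (\<lambda>f. basis_weight l (f v0))"
    unfolding weight_basis_def
    using restr_quotient_basis[OF s B(1)] family.subspace_0[OF subspace_restr_null]
    by (auto simp: act)
  from total_weight_eq[OF this]
  have "weight_Y P s l (Suc j) = (\<Sum>f\<in>constant_family P ` monom ` B. basis_weight l (f v0))"
    unfolding weight_Y_def .
  also have "\<dots> = (\<Sum>p\<in>B. basis_weight l (constant_family P (monom p) v0))"
    by (simp add: sum.reindex inj_on_subset[OF inj_constant_family] inj_on_subset[OF inj_monom])
  also have "\<dots> = - (\<Sum>p\<in>B. rvec p \<bullet> l)"
    using v0 by (simp add: constant_family_def basis_weight_monom(1) sum_negf)
  finally show ?thesis using B(3) hom by simp
qed

end

subsection \<open>Counting lattice points near the faces\<close>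

definition ip :: "int^'n \<Rightarrow> int^'n \<Rightarrow> int" where
  "ip p u = (\<Sum>i\<in>UNIV. p $ i * u $ i)"

lemma inner_rvec: "rvec p \<bullet> rvec u = of_int (ip p u)"
  by (simp add: ip_def inner_vec_def rvec_nth)

lemma ip_add: "ip (p + q) u = ip p u + ip q u"
  by (simp add: ip_def algebra_simps sum.distrib)

lemma ip_diff: "ip (p - q) u = ip p u - ip q u"
  by (simp add: ip_def algebra_simps sum_subtractf)

lemma ip_scale: "ip (c *s p) u = c * ip p u"
  by (simp add: ip_def sum_distrib_left mult.assoc)

section \<open>Lattice points of a box in hyperplanes and slabs\<close>

definition int_box :: "nat \<Rightarrow> (int^'n) set" where
  "int_box R = {p. \<forall>i. \<bar>p $ i\<bar> \<le> int R}"

lemma finite_int_box: "finite (int_box R :: (int^'n) set)"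
proof -
  have "int_box R \<subseteq> {p :: int^'n. rvec p \<in> cbox (- (\<chi> i. real R)) (\<chi> i. real R)}"
    by (auto simp: int_box_def mem_box_cart rvec_nth abs_le_iff)
      (metis abs_le_iff minus_le_iff of_int_le_iff of_int_minus of_int_of_nat_eq)+
  then show ?thesis
    using finite_lattice_points[OF bounded_cbox] finite_subset by blast
qed

text \<open>Elimination count: if the coordinates outside \<open>I\<close> together with
  \<open>h\<close> determine a point, each coordinate in \<open>I\<close> saves a factor 2R + 1 at
  the cost of the number of values of \<open>h\<close>.\<close>

lemma card_box_le:
  fixes S :: "(int^'n) set"
  assumes S: "S \<subseteq> int_box R" and h: "h ` S \<subseteq> H" "finite H"
    and inj: "\<And>p q. p \<in> S \<Longrightarrow> q \<in> S \<Longrightarrow> (\<And>i. i \<notin> I \<Longrightarrow> p $ i = q $ i) \<Longrightarrow> h p = h q \<Longrightarrow> p = q"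
  shows "card S \<le> (2 * R + 1) ^ (CARD('n) - card I) * card H"
proof -
  let ?X = "PiE (- I) (\<lambda>_. {- int R..int R})"
  have "card S \<le> card (?X \<times> H)"
  proof (rule card_inj_on_le)
    show "inj_on (\<lambda>p. (restrict (vec_nth p) (- I), h p)) S"
    proof (rule inj_onI)
      fix p q assume pq: "p \<in> S" "q \<in> S"
        and eq: "(restrict (vec_nth p) (- I), h p) = (restrict (vec_nth q) (- I), h q)"
      show "p = q"
      proof (rule inj[OF pq])
        fix i assume "i \<notin> I"
        then show "p $ i = q $ i" using eq by (metis ComplI Pair_inject restrict_apply')
      qed (use eq in simp)
    qed
    show "(\<lambda>p. (restrict (vec_nth p) (- I), h p)) ` S \<subseteq> ?X \<times> H"
    proof (rule image_subsetI)
      fix p assume p: "p \<in> S"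
      have "\<bar>p $ i\<bar> \<le> int R" for i
        using p S by (auto simp: int_box_def)
      then have "p $ i \<in> {- int R..int R}" for i
        using abs_le_iff[of "p $ i" "int R"] by auto
      with p h(1) show "(restrict (vec_nth p) (- I), h p) \<in> ?X \<times> H"
        by auto
    qed
    show "finite (?X \<times> H)" using h(2) by (intro finite_cartesian_product finite_PiE) auto
  qed
  also have "card (?X \<times> H) = (2 * R + 1) ^ (CARD('n) - card I) * card H"
    by (simp add: card_cartesian_product card_PiE Compl_eq_Diff_UNIV card_Diff_subset nat_add_distrib nat_mult_distrib)
  finally show ?thesis .
qed

lemma card_box_hyperplane:
  fixes u :: "int^'n"
  assumes "u \<noteq> 0"
  shows "card {p \<in> int_box R. ip p u = b} \<le> (2 * R + 1) ^ (CARD('n) - 1)"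
proof -
  obtain i where i: "u $ i \<noteq> 0" using assms by (auto simp: vec_eq_iff)
  have "card {p \<in> int_box R. ip p u = b} \<le> (2 * R + 1) ^ (CARD('n) - card {i}) * card {()}"
  proof (rule card_box_le[where h = "\<lambda>_. ()"])
    fix p q :: "int^'n"
    assume pq: "p \<in> {p \<in> int_box R. ip p u = b}" "q \<in> {p \<in> int_box R. ip p u = b}"
      and eq: "\<And>k. k \<notin> {i} \<Longrightarrow> p $ k = q $ k"
    have "ip (p - q) u = (\<Sum>k\<in>UNIV. if k = i then (p $ i - q $ i) * u $ i else 0)"
      unfolding ip_def using eq by (intro sum.cong) auto
    then have "(p $ i - q $ i) * u $ i = 0" using pq by (simp add: ip_diff)
    then have "p $ i = q $ i" using i by simp
    with eq have "p $ k = q $ k" for k by (cases "k = i") auto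
    then show "p = q" by (simp add: vec_eq_iff)
  qed auto
  then show ?thesis by simp
qed

text \<open>A nonvanishing 2 by 2 minor lets Cramer's rule recover two coordinates from the values
  of both forms: one value is prescribed and the other has 2D + 1 possibilities.\<close>

lemma card_box_two_slabs:
  fixes u u' :: "int^'n"
  assumes ij: "u $ i * u' $ j \<noteq> u $ j * u' $ i"
  shows "card {p \<in> int_box R. ip p u = b \<and> \<bar>ip p u' - b'\<bar> \<le> int D}
    \<le> (2 * R + 1) ^ (CARD('n) - 2) * (2 * D + 1)"
proof -
  let ?S = "{p \<in> int_box R. ip p u = b \<and> \<bar>ip p u' - b'\<bar> \<le> int D}"
  have ne: "i \<noteq> j" using ij by auto
  have "card ?S \<le> (2 * R + 1) ^ (CARD('n) - card {i, j}) * card {b' - int D..b' + int D}"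
  proof (rule card_box_le[where h = "\<lambda>p. ip p u'"])
    fix p q :: "int^'n"
    assume pq: "p \<in> ?S" "q \<in> ?S" and eq: "\<And>k. k \<notin> {i, j} \<Longrightarrow> p $ k = q $ k"
      and h: "ip p u' = ip q u'"
    define x y where "x = p $ i - q $ i" and "y = p $ j - q $ j"
    have exp: "ip (p - q) w = x * w $ i + y * w $ j" for w
    proof -
      have "ip (p - q) w = (\<Sum>k\<in>{i, j}. (p - q) $ k * w $ k)"
        unfolding ip_def using eq by (intro sum.mono_neutral_right) auto
      then show ?thesis using ne by (simp add: x_def y_def)
    qed
    have 1: "x * u $ i + y * u $ j = 0" "x * u' $ i + y * u' $ j = 0"
      using exp[of u] exp[of u'] pq h by (simp_all add: ip_diff)
    have "x * (u $ i * u' $ j - u $ j * u' $ i) =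
        (x * u $ i + y * u $ j) * u' $ j - (x * u' $ i + y * u' $ j) * u $ j"
      "y * (u $ i * u' $ j - u $ j * u' $ i) =
        (x * u' $ i + y * u' $ j) * u $ i - (x * u $ i + y * u $ j) * u' $ i"
      by (simp_all add: algebra_simps)
    then have "x = 0" "y = 0" using ij 1 by auto
    with eq have "p $ k = q $ k" for k by (cases "k = i \<or> k = j") (auto simp: x_def y_def)
    then show "p = q" by (simp add: vec_eq_iff)
  qed auto
  also have "card {i, j} = 2" using ne by simp
  also have "card {b' - int D..b' + int D} = 2 * D + 1" by simp
  finally show ?thesis .
qed

text \<open>Error orders are written as quotients k^n / k^m because k^(n-2) with truncated
  subtraction would be the wrong power in dimension 1.\<close>

lemma power_box_bigo:
  assumes "m \<le> n"
  shows "(\<lambda>k. real ((2 * (R * k) + 1) ^ (n - m))) \<in> O(\<lambda>k. real k ^ n / real k ^ m)"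
proof (rule bigoI)
  show "\<forall>\<^sub>F k in sequentially. norm (real ((2 * (R * k) + 1) ^ (n - m))) \<le>
      (2 * real R + 1) ^ (n - m) * norm (real k ^ n / real k ^ m)"
    using eventually_gt_at_top[of 0]
  proof eventually_elim
    case (elim k)
    have "real (2 * (R * k) + 1) \<le> (2 * real R + 1) * real k"
      using elim by (simp add: algebra_simps)
    then have "real (2 * (R * k) + 1) ^ (n - m) \<le> ((2 * real R + 1) * real k) ^ (n - m)"
      by (intro power_mono) auto
    also have "\<dots> = (2 * real R + 1) ^ (n - m) * (real k ^ n / real k ^ m)"
      using elim assms by (simp add: power_mult_distrib power_diff)
    finally show ?case by simp
  qed
qed

(* Functions on the lattice that behave like homogeneous polynomials of degree a \<le> 1. *)
definition lattice_weight :: "nat \<Rightarrow> (int^'n \<Rightarrow> real) \<Rightarrow> bool" where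
  "lattice_weight a f \<longleftrightarrow>
     (\<exists>K. \<forall>R\<ge>1. \<forall>p\<in>int_box R. \<bar>f p\<bar> \<le> K * real R ^ a) \<and>
     (\<forall>q. \<exists>K. \<forall>R\<ge>1. \<forall>p\<in>int_box R. \<bar>f (p - q) - f p\<bar> \<le> K * (real R ^ a / real R))"

context facet_polytope
begin

text \<open>The sign is such that a positive \<open>e u\<close> moves the facet inwards; e = 1
  selects the interior lattice points of kP.\<close>

definition shifted_points :: "(int^'n \<Rightarrow> int) \<Rightarrow> nat \<Rightarrow> (int^'n) set" where
  "shifted_points e k = {p. \<forall>u\<in>U. ip p u \<ge> e u - int k}"

lemma shifted_points_0:
  assumes "k > 0"
  shows "shifted_points (\<lambda>_. 0) k = lattice_points P k"
proof -
  have "rvec p \<in> (*\<^sub>R) (real k) ` P \<longleftrightarrow> (\<forall>u\<in>U. ip p u \<ge> - int k)" for p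
  proof -
    have "rvec p \<in> (*\<^sub>R) (real k) ` P \<longleftrightarrow> (1 / real k) *\<^sub>R rvec p \<in> P"
      using assms by (force simp: image_iff)
    also have "\<dots> \<longleftrightarrow> (\<forall>u\<in>U. real_of_int (ip p u) \<ge> - real k)"
      using assms by (simp add: P_eq inner_rvec field_simps)
    also have "\<dots> \<longleftrightarrow> (\<forall>u\<in>U. ip p u \<ge> - int k)"
      by (metis of_int_le_iff of_int_minus of_int_of_nat_eq)
    finally show ?thesis .
  qed
  then show ?thesis by (simp add: shifted_points_def lattice_points_def)
qed

text \<open>All facets lie at the same integral distance 1 from the origin, so a constant shift is a
  change of the dilation factor.\<close>

lemma shifted_points_add_const:
  "shifted_points (\<lambda>u. e u - 1) k = shifted_points e (Suc k)"
  "k > 0 \<Longrightarrow> shifted_points (\<lambda>u. e u + 1) k = shifted_points e (k - 1)"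
  by (auto simp: shifted_points_def algebra_simps of_nat_diff)

lemma shifted_points_cong:
  "(\<And>u. u \<in> U \<Longrightarrow> e u = e' u) \<Longrightarrow> shifted_points e k = shifted_points e' k"
  by (auto simp: shifted_points_def)

lemma U_nonzero: "u \<in> U \<Longrightarrow> u \<noteq> 0"
  using tight[of u] by (auto simp: inner_rvec ip_def)

lemma tight_ip:
  assumes "u \<in> U"
  obtains v where "ip v u = - 1" "\<And>u'. u' \<in> U \<Longrightarrow> ip v u' \<ge> - 1"
proof -
  obtain v where v: "rvec v \<in> P" "rvec v \<bullet> rvec u = - 1" using tight[OF assms] by blast
  have "ip v u = - 1"
    using v(2) unfolding inner_rvec by (metis of_int_1 of_int_eq_iff of_int_minus)
  moreover have "ip v u' \<ge> - 1" if "u' \<in> U" for u'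
  proof -
    have "real_of_int (ip v u') \<ge> - 1" using v(1) that by (auto simp: P_eq inner_rvec)
    then show ?thesis by linarith
  qed
  ultimately show thesis by (rule that)
qed

text \<open>For shifts bounded below by -C the points lie in (k + C)P, and k + C <= (1 + C) k. Thus
  the box is linear in k with one constant for all such \<open>e\<close>.\<close>

lemma shifted_points_bounded:
  obtains R where "R > 0" "\<forall>k>0. \<forall>e. (\<forall>u\<in>U. e u \<ge> - int C) \<longrightarrow>
    shifted_points e k \<subseteq> int_box (R * k)"
proof -
  obtain B where B: "\<And>x. x \<in> P \<Longrightarrow> norm x \<le> B"
    using bounded_P unfolding bounded_iff by blast
  define R where "R = nat \<lceil>max B 1 * (1 + real C)\<rceil>"
  have R: "real R \<ge> max B 1 * (1 + real C)" unfolding R_def by linarith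
  have "max B 1 * (1 + real C) \<ge> 1 * 1" by (intro mult_mono) auto
  with R have "R > 0" by linarith
  moreover have "shifted_points e k \<subseteq> int_box (R * k)"
    if k: "k > 0" and e: "\<And>u. u \<in> U \<Longrightarrow> e u \<ge> - int C" for k e
  proof
    fix p assume p: "p \<in> shifted_points e k"
    define r where "r = real k + real C"
    have r: "r > 0" using k by (simp add: r_def)
    have "real_of_int (ip p u) \<ge> - r" if "u \<in> U" for u
    proof -
      have "ip p u \<ge> - int k - int C" using p e that by (force simp: shifted_points_def)
      then have "real_of_int (ip p u) \<ge> real_of_int (- int k - int C)" by (simp only: of_int_le_iff)
      then show ?thesis by (simp add: r_def)
    qed
    then have "(1 / r) *\<^sub>R rvec p \<in> P"
      using r by (simp add: P_eq inner_rvec field_simps)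
    then have "norm ((1 / r) *\<^sub>R rvec p) \<le> B" by (rule B)
    then have norm: "norm (rvec p) \<le> B * r" using r by (simp add: field_simps)
    have "real C * 1 \<le> real C * real k" using k by (intro mult_left_mono) auto
    then have "r \<le> (1 + real C) * real k" using k by (simp add: r_def algebra_simps)
    then have "B * r \<le> max B 1 * ((1 + real C) * real k)"
      using r by (intro mult_mono) auto
    also have "\<dots> \<le> real R * real k"
      using R k by (simp add: mult.assoc[symmetric])
    finally have bound: "norm (rvec p) \<le> real R * real k" using norm by linarith
    show "p \<in> int_box (R * k)"
      unfolding int_box_def
    proof (rule CollectI, rule allI)
      fix i
      have "\<bar>rvec p $ i\<bar> \<le> real R * real k"
        using component_le_norm_cart bound by (rule order_trans)
      then have "real_of_int \<bar>p $ i\<bar> \<le> real_of_int (int (R * k))" by (simp add: rvec_nth)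
      then show "\<bar>p $ i\<bar> \<le> int (R * k)" by (simp only: of_int_le_iff)
    qed
  qed
  ultimately show thesis using that by simp
qed

definition shifted_sum :: "(int^'n \<Rightarrow> real) \<Rightarrow> (int^'n \<Rightarrow> int) \<Rightarrow> nat \<Rightarrow> real" where
  "shifted_sum f e k = (\<Sum>p\<in>shifted_points e k. f p)"

definition facet_points :: "(int^'n \<Rightarrow> int) \<Rightarrow> int^'n \<Rightarrow> nat \<Rightarrow> (int^'n) set" where
  "facet_points e u k = {p \<in> shifted_points e k. ip p u = e u - int k}"

definition facet_sum :: "(int^'n \<Rightarrow> real) \<Rightarrow> int^'n \<Rightarrow> nat \<Rightarrow> real" where
  "facet_sum f u k = (\<Sum>p\<in>facet_points (\<lambda>_. 0) u k. f p)"

lemma finite_shifted_points: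
  assumes "k > 0"
  shows "finite (shifted_points e k)"
proof -
  define C where "C = nat (Max (insert 0 ((\<lambda>u. - e u) ` U)))"
  have "e u \<ge> - int C" if "u \<in> U" for u
  proof -
    have "- e u \<le> Max (insert 0 ((\<lambda>u. - e u) ` U))"
      using finite_U that by (intro Max_ge) auto
    then show ?thesis by (simp add: C_def)
  qed
  moreover obtain R where "\<forall>k>0. \<forall>e. (\<forall>u\<in>U. e u \<ge> - int C) \<longrightarrow> shifted_points e k \<subseteq> int_box (R * k)"
    by (rule shifted_points_bounded)
  ultimately have "shifted_points e k \<subseteq> int_box (R * k)" using assms by simp
  then show ?thesis using finite_int_box by (rule finite_subset)
qed

text \<open>Moving one facet inwards by one removes a single lattice hyperplane section.\<close>

lemma shifted_sum_step:
  assumes "k > 0" "u \<in> U"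
  shows "shifted_sum f e k = shifted_sum f (e(u := e u + 1)) k + (\<Sum>p\<in>facet_points e u k. f p)"
proof -
  have split_u: "shifted_points e k =
      {p. ip p u \<ge> e u - int k \<and> (\<forall>w\<in>U - {u}. ip p w \<ge> e w - int k)}" for e
    using assms(2) by (auto simp: shifted_points_def)
  have upd: "shifted_points (e(u := e u + 1)) k =
      {p. ip p u \<ge> e u + 1 - int k \<and> (\<forall>w\<in>U - {u}. ip p w \<ge> e w - int k)}"
    unfolding split_u by simp
  have "shifted_points e k = shifted_points (e(u := e u + 1)) k \<union> facet_points e u k"
    unfolding facet_points_def upd split_u[of e] by auto
  moreover have "shifted_points (e(u := e u + 1)) k \<inter> facet_points e u k = {}"
    unfolding facet_points_def upd by auto
  moreover have "finite (facet_points e u k)"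
    using finite_shifted_points[OF assms(1)] by (simp add: facet_points_def)
  ultimately show ?thesis
    unfolding shifted_sum_def using finite_shifted_points[OF assms(1)]
    by (simp add: sum.union_disjoint)
qed

text \<open>Two normals on the same ray must coincide, since both inequalities have the bound -1 and
  both are attained. Distinct proportional normals therefore point in opposite directions.\<close>

lemma dependent_facets:
  assumes u: "u \<in> U" "u' \<in> U" "u \<noteq> u'" and dep: "\<And>i j. u $ i * u' $ j = u $ j * u' $ i"
  obtains c :: real where "c > 0" "\<And>p. real_of_int (ip p u') = - c * real_of_int (ip p u)"
proof -
  obtain i where i: "u $ i \<noteq> 0" using U_nonzero[OF u(1)] by (auto simp: vec_eq_iff)
  define c where "c = real_of_int (u' $ i) / real_of_int (u $ i)"
  have uj: "real_of_int (u' $ j) = c * real_of_int (u $ j)" for j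
    using i dep[of i j, THEN arg_cong[where f = real_of_int]]
    by (simp add: c_def field_simps)
  have ip: "real_of_int (ip p u') = c * real_of_int (ip p u)" for p
    by (simp add: ip_def uj sum_distrib_left mult.left_commute)
  obtain v where v: "ip v u = - 1" "ip v u' \<ge> - 1"
    using tight_ip[OF u(1)] u(2) by metis
  obtain v' where v': "ip v' u' = - 1" "ip v' u \<ge> - 1"
    using tight_ip[OF u(2)] u(1) by metis
  have "c \<noteq> 0" using ip[of v'] v'(1) by auto
  moreover have "\<not> c > 0"
  proof
    assume "c > 0"
    have "real_of_int (ip v u') \<ge> - 1" "real_of_int (ip v' u) \<ge> - 1" using v v' by simp_all
    then have "c \<le> 1" "c * real_of_int (ip v' u) \<ge> c * (- 1)"
      using ip[of v] v(1) \<open>c > 0\<close> mult_left_mono[of "- 1" "real_of_int (ip v' u)" c] by simp_all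
    then have "c = 1" using ip[of v'] v'(1) by simp
    with uj have "u = u'" by (simp add: vec_eq_iff)
    with u(3) show False by simp
  qed
  ultimately show thesis using that[of "- c"] ip by simp
qed

text \<open>Near the intersection of two facets two independent conditions leave codimension 2. For
  opposite facets the set is empty once k > D: the second form equals c k >= 0 on the first facet,
  far from -k. Dimension 1 falls into this second case.\<close>

lemma card_ridge_bigo:
  assumes u: "u \<in> U" "u' \<in> U" "u \<noteq> u'"
  shows "(\<lambda>k. real (card {p \<in> int_box (R * k). ip p u = - int k \<and> \<bar>ip p u' + int k\<bar> \<le> int D}))
    \<in> O(\<lambda>k. real k ^ CARD('n) / real k ^ 2)"
proof (cases "\<exists>i j. u $ i * u' $ j \<noteq> u $ j * u' $ i")
  case True
  then obtain i j where ij: "u $ i * u' $ j \<noteq> u $ j * u' $ i" by blast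
  then have "i \<noteq> j" by auto
  then have "card {i, j} \<le> CARD('n)" by (intro card_mono) auto
  then have "2 \<le> CARD('n)" using \<open>i \<noteq> j\<close> by simp
  have "(\<lambda>k. real (card {p \<in> int_box (R * k). ip p u = - int k \<and> \<bar>ip p u' + int k\<bar> \<le> int D}))
    \<in> O(\<lambda>k. real ((2 * (R * k) + 1) ^ (CARD('n) - 2)))"
  proof (rule bigoI)
    show "\<forall>\<^sub>F k in sequentially.
       norm (real (card {p \<in> int_box (R * k). ip p u = - int k \<and> \<bar>ip p u' + int k\<bar> \<le> int D}))
       \<le> real (2 * D + 1) * norm (real ((2 * (R * k) + 1) ^ (CARD('n) - 2)))"
    proof (intro always_eventually allI)
      fix k
      from card_box_two_slabs[OF ij, of "R * k" "- int k" "- int k" D]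
      have "real (card {p \<in> int_box (R * k). ip p u = - int k \<and> \<bar>ip p u' - - int k\<bar> \<le> int D})
        \<le> real ((2 * (R * k) + 1) ^ (CARD('n) - 2) * (2 * D + 1))"
        by (simp only: of_nat_le_iff)
      then show "norm (real (card {p \<in> int_box (R * k). ip p u = - int k \<and> \<bar>ip p u' + int k\<bar> \<le> int D}))
       \<le> real (2 * D + 1) * norm (real ((2 * (R * k) + 1) ^ (CARD('n) - 2)))"
        by (simp add: algebra_simps)
    qed
  qed
  also have "(\<lambda>k. real ((2 * (R * k) + 1) ^ (CARD('n) - 2))) \<in> O(\<lambda>k. real k ^ CARD('n) / real k ^ 2)"
    by (rule power_box_bigo) fact
  finally show ?thesis .
next
  case False
  then obtain c where c: "c > 0" "\<And>p. real_of_int (ip p u') = - c * real_of_int (ip p u)"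
    using dependent_facets[OF u] by metis
  have "\<forall>\<^sub>F k in sequentially.
    real (card {p \<in> int_box (R * k). ip p u = - int k \<and> \<bar>ip p u' + int k\<bar> \<le> int D}) = 0"
    using eventually_gt_at_top[of D]
  proof eventually_elim
    case (elim k)
    have False if "ip p u = - int k" "\<bar>ip p u' + int k\<bar> \<le> int D" for p
    proof -
      have "real_of_int \<bar>ip p u' + int k\<bar> \<le> real D"
        using that(2) by (metis of_int_le_iff of_int_of_nat_eq)
      moreover have "real_of_int (ip p u') = c * real k" using c(2)[of p] that(1) by simp
      ultimately have "\<bar>c * real k + real k\<bar> \<le> real D" by simp
      moreover have "c * real k \<ge> 0" using c(1) by simp
      ultimately show False using elim by simp
    qed
    then have "{p \<in> int_box (R * k). ip p u = - int k \<and> \<bar>ip p u' + int k\<bar> \<le> int D} = {}"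
      by blast
    then show ?case by (simp only: card.empty of_nat_0)
  qed
  from landau_o.big.in_cong[OF this] show ?thesis by simp
qed

text \<open>A hyperplane section of a box of size O(k) has O(k^(n-1)) lattice points, on each of
  which \<open>f\<close> is O(k^a).\<close>

lemma facet_sum_bigo:
  fixes f :: "int^'n \<Rightarrow> real"
  assumes f: "lattice_weight a f" and u: "u \<in> U"
  shows "facet_sum f u \<in> O(\<lambda>k. real k ^ (CARD('n) + a) / real k)"
proof -
  obtain R where "R > 0" "\<forall>k>0. \<forall>e. (\<forall>u\<in>U. e u \<ge> - int 0) \<longrightarrow>
    shifted_points e k \<subseteq> int_box (R * k)"
    by (rule shifted_points_bounded)
  then have R: "R > 0" "\<And>k e. k > 0 \<Longrightarrow> \<forall>u\<in>U. e u \<ge> - int 0 \<Longrightarrow>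
    shifted_points e k \<subseteq> int_box (R * k)"
    by simp_all
  obtain K where K: "\<And>R p. R \<ge> 1 \<Longrightarrow> p \<in> int_box R \<Longrightarrow> \<bar>f p\<bar> \<le> K * real R ^ a"
    using f unfolding lattice_weight_def by blast
  have "facet_sum f u \<in> O(\<lambda>k. real ((2 * (R * k) + 1) ^ (CARD('n) - 1)) * real k ^ a)"
  proof (rule bigoI)
    show "\<forall>\<^sub>F k in sequentially. norm (facet_sum f u k) \<le> \<bar>K\<bar> * real R ^ a *
        norm (real ((2 * (R * k) + 1) ^ (CARD('n) - 1)) * real k ^ a)"
      using eventually_gt_at_top[of 0]
    proof eventually_elim
      case (elim k)
      have sub: "facet_points (\<lambda>_. 0) u k \<subseteq> {p \<in> int_box (R * k). ip p u = - int k}"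
        using R(2)[OF elim, of "\<lambda>_. 0"] by (auto simp: facet_points_def)
      then have "card (facet_points (\<lambda>_. 0) u k) \<le> card {p \<in> int_box (R * k). ip p u = - int k}"
        by (intro card_mono finite_subset[OF _ finite_int_box[of "R * k"]]) auto
      also have "\<dots> \<le> (2 * (R * k) + 1) ^ (CARD('n) - 1)"
        by (rule card_box_hyperplane[OF U_nonzero[OF u]])
      finally have card: "real (card (facet_points (\<lambda>_. 0) u k)) \<le> real ((2 * (R * k) + 1) ^ (CARD('n) - 1))"
        by (simp only: of_nat_le_iff)
      have "\<bar>f p\<bar> \<le> \<bar>K\<bar> * real (R * k) ^ a" if "p \<in> facet_points (\<lambda>_. 0) u k" for p
      proof -
        have "\<bar>f p\<bar> \<le> K * real (R * k) ^ a" using sub that R(1) elim by (intro K) auto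
        also have "\<dots> \<le> \<bar>K\<bar> * real (R * k) ^ a" by (intro mult_right_mono) auto
        finally show ?thesis .
      qed
      then have "(\<Sum>p\<in>facet_points (\<lambda>_. 0) u k. \<bar>f p\<bar>) \<le>
          real (card (facet_points (\<lambda>_. 0) u k)) * (\<bar>K\<bar> * real (R * k) ^ a)"
        by (rule sum_bounded_above)
      also have "\<dots> \<le> real ((2 * (R * k) + 1) ^ (CARD('n) - 1)) * (\<bar>K\<bar> * real (R * k) ^ a)"
        by (intro mult_right_mono card) auto
      finally have "\<bar>facet_sum f u k\<bar> \<le> real ((2 * (R * k) + 1) ^ (CARD('n) - 1)) * (\<bar>K\<bar> * real (R * k) ^ a)"
        unfolding facet_sum_def using sum_abs by (rule order_trans[rotated])
      also have "\<dots> = \<bar>K\<bar> * real R ^ a * norm (real ((2 * (R * k) + 1) ^ (CARD('n) - 1)) * real k ^ a)"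
        by (simp add: power_mult_distrib abs_mult)
      finally show ?case by simp
    qed
  qed
  also have "(\<lambda>k. real ((2 * (R * k) + 1) ^ (CARD('n) - 1)) * real k ^ a)
      \<in> O(\<lambda>k. real k ^ CARD('n) / real k ^ 1 * real k ^ a)"
    by (intro landau_o.big.mult power_box_bigo) (auto simp: Suc_leI)
  finally show ?thesis by (simp add: power_add)
qed

(* Translating by a multiple of a lattice point v with <v,u> = -1 moves one hyperplane section onto
   the other, up to points near the intersection with a second facet. *)
lemma facet_points_shift_bigo:
  fixes f :: "int^'n \<Rightarrow> real"
  assumes f: "lattice_weight a f" and u: "u \<in> U"
  shows "(\<lambda>k. (\<Sum>p\<in>facet_points e u k. f p) - facet_sum f u k)
    \<in> O(\<lambda>k. real k ^ (CARD('n) + a) / real k ^ 2)"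
proof -
  obtain v where v: "ip v u = - 1" using tight_ip[OF u] by metis
  \<comment> \<open>Since <v,u> = -1, adding \<open>q\<close> carries the hyperplane <p,u> = e u - k
    to <p,u> = -k; the remaining facets acquire the shifts \<open>e'\<close>.\<close>
  define q where "q = e u *s v"
  have qu: "ip q u = - e u" by (simp add: q_def ip_scale v)
  \<comment> \<open>The distance by which the facet u' is displaced after the translation; the
    translated section \<open>T\<close> and the unshifted section \<open>S\<close> differ only
    within it.\<close>
  define D where "D u' = nat \<bar>e u' + ip q u'\<bar>" for u'
  define C where "C = nat (Max (insert 0 ((\<lambda>u'. - (e u' + ip q u')) ` U)))"
  have C: "e u' + ip q u' \<ge> - int C" if "u' \<in> U" for u'
  proof -
    have "- (e u' + ip q u') \<le> Max (insert 0 ((\<lambda>u'. - (e u' + ip q u')) ` U))"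
      using finite_U that by (intro Max_ge) auto
    then show ?thesis by (simp add: C_def)
  qed
  obtain R where "R > 0" "\<forall>k>0. \<forall>e. (\<forall>u\<in>U. e u \<ge> - int C) \<longrightarrow>
    shifted_points e k \<subseteq> int_box (R * k)"
    by (rule shifted_points_bounded)
  then have R: "R > 0" "\<And>k e. k > 0 \<Longrightarrow> \<forall>u\<in>U. e u \<ge> - int C \<Longrightarrow>
    shifted_points e k \<subseteq> int_box (R * k)"
    by simp_all
  obtain K where K: "\<And>R p. R \<ge> 1 \<Longrightarrow> p \<in> int_box R \<Longrightarrow> \<bar>f p\<bar> \<le> K * real R ^ a"
    using f unfolding lattice_weight_def by blast
  obtain K' where K': "\<And>R p. R \<ge> 1 \<Longrightarrow> p \<in> int_box R \<Longrightarrow>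
      \<bar>f (p - q) - f p\<bar> \<le> K' * (real R ^ a / real R)"
    using f unfolding lattice_weight_def by blast
  define e' where "e' u' = e u' + ip q u'" for u'
  define W where "W u' k = {p \<in> int_box (R * k). ip p u = - int k \<and> \<bar>ip p u' + int k\<bar> \<le> int (D u')}"
    for u' k
  define H where "H k = (2 * (R * k) + 1) ^ (CARD('n) - 1)" for k
  define S where "S k = facet_points (\<lambda>_. 0) u k" for k
  define T where "T k = facet_points e' u k" for k
  have bound: "\<bar>(\<Sum>p\<in>facet_points e u k. f p) - facet_sum f u k\<bar> \<le>
      real (H k) * (\<bar>K'\<bar> * (real (R * k) ^ a / real (R * k))) +
      2 * (\<Sum>u'\<in>U - {u}. real (card (W u' k))) * (\<bar>K\<bar> * real (R * k) ^ a)" if k: "k > 0" for k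
  proof -
    have Rk: "R * k \<ge> 1" using R(1) k by simp
    have eu: "e' u = 0" by (simp add: e'_def qu)
    have T: "T k \<subseteq> {p \<in> int_box (R * k). ip p u = - int k}"
      using R(2)[OF k, of e'] C by (auto simp: T_def facet_points_def e'_def qu)
    have S: "S k \<subseteq> {p \<in> int_box (R * k). ip p u = - int k}"
      using R(2)[OF k, of "\<lambda>_. 0"] by (auto simp: S_def facet_points_def)
    have fin: "finite (T k)" "finite (S k)"
      using S T finite_int_box by (auto intro: finite_subset)
    have "facet_points e u k = (\<lambda>p. p - q) ` T k"
    proof (intro equalityI subsetI)
      fix p assume "p \<in> facet_points e u k"
      then have "p + q \<in> T k"
        by (auto simp: T_def e'_def facet_points_def shifted_points_def ip_add qu)
      then show "p \<in> (\<lambda>p. p - q) ` T k" by (rule rev_image_eqI) simp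
    next
      fix p assume "p \<in> (\<lambda>p. p - q) ` T k"
      then show "p \<in> facet_points e u k"
        by (auto simp: T_def e'_def facet_points_def shifted_points_def ip_diff qu)
    qed
    then have "(\<Sum>p\<in>facet_points e u k. f p) = (\<Sum>p\<in>T k. f (p - q))"
      by (simp add: sum.reindex inj_on_def)
    also have "\<dots> = (\<Sum>p\<in>T k. f (p - q) - f p) + (\<Sum>p\<in>T k. f p)"
      by (simp add: sum_subtractf)
    also have "(\<Sum>p\<in>T k. f p) = (\<Sum>p\<in>S k. f p) + (\<Sum>p\<in>T k - S k. f p) - (\<Sum>p\<in>S k - T k. f p)"
      using sum.Int_Diff[OF fin(1), of f "S k"] sum.Int_Diff[OF fin(2), of f "T k"]
      by (simp add: Int_commute)
    \<comment> \<open>Two errors: translation changes the weight by one order less on O(k^(n-1))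
      points, and the symmetric difference of \<open>T\<close> and \<open>S\<close> has only
      O(k^(n-2)) points, all near ridges.\<close>
    finally have split: "(\<Sum>p\<in>facet_points e u k. f p) - facet_sum f u k =
        (\<Sum>p\<in>T k. f (p - q) - f p) + ((\<Sum>p\<in>T k - S k. f p) - (\<Sum>p\<in>S k - T k. f p))"
      by (simp add: facet_sum_def S_def)
    have "card (T k) \<le> card {p \<in> int_box (R * k). ip p u = - int k}"
      using T by (intro card_mono finite_subset[OF _ finite_int_box[of "R * k"]]) auto
    also have "\<dots> \<le> H k"
      unfolding H_def by (rule card_box_hyperplane[OF U_nonzero[OF u]])
    finally have cardT: "real (card (T k)) \<le> real (H k)" by (simp only: of_nat_le_iff)
    have "\<bar>\<Sum>p\<in>T k. f (p - q) - f p\<bar> \<le> (\<Sum>p\<in>T k. \<bar>f (p - q) - f p\<bar>)"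
      by (rule sum_abs)
    also have "\<dots> \<le> real (card (T k)) * (\<bar>K'\<bar> * (real (R * k) ^ a / real (R * k)))"
    proof (rule sum_bounded_above)
      fix p assume "p \<in> T k"
      then have "\<bar>f (p - q) - f p\<bar> \<le> K' * (real (R * k) ^ a / real (R * k))"
        using T by (intro K' Rk) auto
      also have "\<dots> \<le> \<bar>K'\<bar> * (real (R * k) ^ a / real (R * k))"
        by (intro mult_right_mono) auto
      finally show "\<bar>f (p - q) - f p\<bar> \<le> \<bar>K'\<bar> * (real (R * k) ^ a / real (R * k))" .
    qed
    also have "\<dots> \<le> real (H k) * (\<bar>K'\<bar> * (real (R * k) ^ a / real (R * k)))"
      by (intro mult_right_mono cardT) auto
    finally have 1: "\<bar>\<Sum>p\<in>T k. f (p - q) - f p\<bar> \<le>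
      real (H k) * (\<bar>K'\<bar> * (real (R * k) ^ a / real (R * k)))" .
    have ridge: "\<bar>\<Sum>p\<in>X. f p\<bar> \<le> (\<Sum>u'\<in>U - {u}. real (card (W u' k))) * (\<bar>K\<bar> * real (R * k) ^ a)"
      if X: "X \<subseteq> (\<Union>u'\<in>U - {u}. W u' k)" for X
    proof -
      have finW: "finite (\<Union>u'\<in>U - {u}. W u' k)"
        using finite_U by (auto simp: W_def intro: finite_subset[OF _ finite_int_box[of "R * k"]])
      have "card X \<le> card (\<Union>u'\<in>U - {u}. W u' k)"
        using X finW by (rule card_mono[rotated])
      also have "\<dots> \<le> (\<Sum>u'\<in>U - {u}. card (W u' k))"
        using finite_U by (intro card_UN_le) auto
      finally have cardX: "real (card X) \<le> (\<Sum>u'\<in>U - {u}. real (card (W u' k)))"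
        by (simp only: of_nat_sum[symmetric] of_nat_le_iff)
      have "\<bar>\<Sum>p\<in>X. f p\<bar> \<le> (\<Sum>p\<in>X. \<bar>f p\<bar>)" by (rule sum_abs)
      also have "\<dots> \<le> real (card X) * (\<bar>K\<bar> * real (R * k) ^ a)"
      proof (rule sum_bounded_above)
        fix p assume "p \<in> X"
        then have "p \<in> int_box (R * k)" using X by (auto simp: W_def)
        then have "\<bar>f p\<bar> \<le> K * real (R * k) ^ a" by (intro K Rk)
        also have "\<dots> \<le> \<bar>K\<bar> * real (R * k) ^ a" by (intro mult_right_mono) auto
        finally show "\<bar>f p\<bar> \<le> \<bar>K\<bar> * real (R * k) ^ a" .
      qed
      also have "\<dots> \<le> (\<Sum>u'\<in>U - {u}. real (card (W u' k))) * (\<bar>K\<bar> * real (R * k) ^ a)"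
        by (intro mult_right_mono cardX) auto
      finally show ?thesis .
    qed
    have "T k - S k \<subseteq> (\<Union>u'\<in>U - {u}. W u' k)"
    proof
      fix p assume p: "p \<in> T k - S k"
      then obtain u' where u': "u' \<in> U" "ip p u' < - int k"
        by (auto simp: T_def S_def eu facet_points_def shifted_points_def not_le)
      moreover have "ip p u = - int k" "ip p u' \<ge> e' u' - int k" "p \<in> int_box (R * k)"
        using p u' T by (auto simp: T_def eu facet_points_def shifted_points_def)
      ultimately show "p \<in> (\<Union>u'\<in>U - {u}. W u' k)"
        by (intro UN_I[of u']) (auto simp: W_def D_def e'_def)
    qed
    note 2 = ridge[OF this]
    have "S k - T k \<subseteq> (\<Union>u'\<in>U - {u}. W u' k)"
    proof
      fix p assume p: "p \<in> S k - T k"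
      then obtain u' where u': "u' \<in> U" "ip p u' < e' u' - int k"
        by (auto simp: T_def S_def eu facet_points_def shifted_points_def not_le)
      moreover have "ip p u = - int k" "ip p u' \<ge> - int k" "p \<in> int_box (R * k)"
        using p u' S by (auto simp: S_def facet_points_def shifted_points_def)
      ultimately show "p \<in> (\<Union>u'\<in>U - {u}. W u' k)"
        using eu by (intro UN_I[of u']) (auto simp: W_def D_def e'_def)
    qed
    note 3 = ridge[OF this]
    show ?thesis
      unfolding split using 1 2 3 by (simp add: algebra_simps)
  qed
  have "(\<lambda>k. (\<Sum>p\<in>facet_points e u k. f p) - facet_sum f u k) \<in>
      O(\<lambda>k. real (H k) * (\<bar>K'\<bar> * (real (R * k) ^ a / real (R * k))) +
      2 * (\<Sum>u'\<in>U - {u}. real (card (W u' k))) * (\<bar>K\<bar> * real (R * k) ^ a))"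
    by (rule landau_o.big_mono, rule eventually_mono[OF eventually_gt_at_top[of 0]])
      (use bound in \<open>force intro: order_trans[OF _ abs_ge_self]\<close>)
  also have "(\<lambda>k. real (H k) * (\<bar>K'\<bar> * (real (R * k) ^ a / real (R * k))) +
      2 * (\<Sum>u'\<in>U - {u}. real (card (W u' k))) * (\<bar>K\<bar> * real (R * k) ^ a))
      \<in> O(\<lambda>k. real k ^ (CARD('n) + a) / real k ^ 2)"
  proof (rule sum_in_bigo(1))
    have "(\<lambda>k. real (H k)) \<in> O(\<lambda>k. real k ^ CARD('n) / real k ^ 1)"
      unfolding H_def by (rule power_box_bigo) (simp add: Suc_leI)
    moreover have "(\<lambda>k. \<bar>K'\<bar> * (real (R * k) ^ a / real (R * k))) \<in> O(\<lambda>k. real k ^ a / real k)"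
      by (rule landau_o.bigI[of "\<bar>K'\<bar> * (real R ^ a / real R) + 1"])
        (auto simp: power_mult_distrib abs_mult algebra_simps add_pos_nonneg)
    ultimately have "(\<lambda>k. real (H k) * (\<bar>K'\<bar> * (real (R * k) ^ a / real (R * k)))) \<in>
      O(\<lambda>k. real k ^ CARD('n) / real k ^ 1 * (real k ^ a / real k))"
      by (rule landau_o.big.mult)
    then show "(\<lambda>k. real (H k) * (\<bar>K'\<bar> * (real (R * k) ^ a / real (R * k)))) \<in>
      O(\<lambda>k. real k ^ (CARD('n) + a) / real k ^ 2)"
      by (simp add: power_add power2_eq_square)
  next
    have "(\<lambda>k. \<Sum>u'\<in>U - {u}. real (card (W u' k))) \<in> O(\<lambda>k. real k ^ CARD('n) / real k ^ 2)"
      unfolding W_def using u by (intro big_sum_in_bigo card_ridge_bigo) auto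
    then have "(\<lambda>k. 2 * (\<Sum>u'\<in>U - {u}. real (card (W u' k)))) \<in> O(\<lambda>k. real k ^ CARD('n) / real k ^ 2)"
      by simp
    moreover have "(\<lambda>k. \<bar>K\<bar> * real (R * k) ^ a) \<in> O(\<lambda>k. real k ^ a)"
      by (rule landau_o.bigI[of "\<bar>K\<bar> * real R ^ a + 1"])
        (auto simp: power_mult_distrib abs_mult algebra_simps add_pos_nonneg)
    ultimately have "(\<lambda>k. 2 * (\<Sum>u'\<in>U - {u}. real (card (W u' k))) * (\<bar>K\<bar> * real (R * k) ^ a))
      \<in> O(\<lambda>k. real k ^ CARD('n) / real k ^ 2 * real k ^ a)"
      by (rule landau_o.big.mult)
    then show "(\<lambda>k. 2 * (\<Sum>u'\<in>U - {u}. real (card (W u' k))) * (\<bar>K\<bar> * real (R * k) ^ a))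
      \<in> O(\<lambda>k. real k ^ (CARD('n) + a) / real k ^ 2)"
      by (simp add: power_add)
  qed
  finally show ?thesis .
qed

text \<open>Induction on the total size of \<open>e\<close> on \<open>U\<close>: each unit step
  moves one facet and changes the sum by one section, which \<open>facet_points_shift_bigo\<close>
  replaces by \<open>facet_sum\<close>. The implied constant depends on \<open>e\<close>.\<close>

lemma shifted_sum_affine_bigo:
  fixes f :: "int^'n \<Rightarrow> real"
  assumes f: "lattice_weight a f"
  shows "(\<lambda>k. shifted_sum f e k - shifted_sum f (\<lambda>_. 0) k + (\<Sum>u\<in>U. of_int (e u) * facet_sum f u k))
    \<in> O(\<lambda>k. real k ^ (CARD('n) + a) / real k ^ 2)" (is "?err e \<in> O(?g)")
proof (induction "\<Sum>u\<in>U. nat \<bar>e u\<bar>" arbitrary: e rule: less_induct)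
  case less
  show ?case
  proof (cases "\<exists>u\<in>U. e u \<noteq> 0")
    case False
    then have "shifted_sum f e = shifted_sum f (\<lambda>_. 0)"
      using shifted_points_cong[of e "\<lambda>_. 0"] by (auto simp: shifted_sum_def fun_eq_iff)
    with False show ?thesis by simp
  next
    case True
    then obtain u where u: "u \<in> U" "e u \<noteq> 0" by blast
    have sum_upd: "(\<Sum>w\<in>U. of_int ((e(u := x)) w) * facet_sum f w k) =
        (\<Sum>w\<in>U. of_int (e w) * facet_sum f w k) + of_int (x - e u) * facet_sum f u k" for x k
      using finite_U u(1) by (simp add: sum.remove[of U u] algebra_simps)
    have smaller: "(\<Sum>w\<in>U. nat \<bar>(e(u := x)) w\<bar>) < (\<Sum>w\<in>U. nat \<bar>e w\<bar>)" if "\<bar>x\<bar> < \<bar>e u\<bar>" for x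
      using finite_U u(1) that by (simp add: sum.remove[of U u])
    show ?thesis
    proof (cases "e u > 0")
      case True
      define d where "d = e(u := e u - 1)"
      have IH: "?err d \<in> O(?g)" unfolding d_def by (rule less.hyps[OF smaller]) (use True in simp)
      have "(\<lambda>k. ?err d k - ((\<Sum>p\<in>facet_points d u k. f p) - facet_sum f u k)) \<in> O(?g)"
        by (intro sum_in_bigo IH facet_points_shift_bigo[OF f u(1)])
      moreover have "\<forall>\<^sub>F k in sequentially. ?err e k =
          ?err d k - ((\<Sum>p\<in>facet_points d u k. f p) - facet_sum f u k)"
        using eventually_gt_at_top[of 0]
      proof eventually_elim
        case (elim k)
        have "d(u := d u + 1) = e" by (simp add: d_def fun_eq_iff)
        with shifted_sum_step[OF elim u(1), of f d]
        have "shifted_sum f d k = shifted_sum f e k + (\<Sum>p\<in>facet_points d u k. f p)"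
          by (simp only:)
        moreover have "(\<Sum>w\<in>U. of_int (d w) * facet_sum f w k) =
            (\<Sum>w\<in>U. of_int (e w) * facet_sum f w k) - facet_sum f u k"
          unfolding d_def sum_upd by simp
        ultimately show ?case by simp
      qed
      ultimately show ?thesis by (subst landau_o.big.in_cong)
    next
      case False
      define d where "d = e(u := e u + 1)"
      have IH: "?err d \<in> O(?g)" unfolding d_def by (rule less.hyps[OF smaller]) (use False u in simp)
      have "(\<lambda>k. ?err d k + ((\<Sum>p\<in>facet_points e u k. f p) - facet_sum f u k)) \<in> O(?g)"
        by (intro sum_in_bigo IH facet_points_shift_bigo[OF f u(1)])
      moreover have "\<forall>\<^sub>F k in sequentially. ?err e k =
          ?err d k + ((\<Sum>p\<in>facet_points e u k. f p) - facet_sum f u k)"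
        using eventually_gt_at_top[of 0]
      proof eventually_elim
        case (elim k)
        have "shifted_sum f e k = shifted_sum f d k + (\<Sum>p\<in>facet_points e u k. f p)"
          unfolding d_def by (rule shifted_sum_step[OF elim u(1)])
        moreover have "(\<Sum>w\<in>U. of_int (d w) * facet_sum f w k) =
            (\<Sum>w\<in>U. of_int (e w) * facet_sum f w k) + facet_sum f u k"
          unfolding d_def sum_upd by simp
        ultimately show ?case by simp
      qed
      ultimately show ?thesis by (subst landau_o.big.in_cong)
    qed
  qed
qed

end

subsection \<open>Averaging over translates of the lattice\<close>

lemma lborel_integrable_affine:
  fixes h :: "'a::euclidean_space \<Rightarrow> real"
  assumes h: "integrable lborel h" and c: "c \<noteq> 0"
  shows "integrable lborel (\<lambda>x. h (t + c *\<^sub>R x))"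
proof -
  have [measurable]: "h \<in> borel_measurable borel"
    using borel_measurable_integrable[OF h] by simp
  have "integrable (density (distr lborel borel (\<lambda>x. t + c *\<^sub>R x)) (\<lambda>_. \<bar>c\<bar> ^ DIM('a))) h"
    using h c lborel_affine[OF c, of t] by simp
  then have "integrable (distr lborel borel (\<lambda>x. t + c *\<^sub>R x)) (\<lambda>x. \<bar>c\<bar> ^ DIM('a) *\<^sub>R h x)"
    by (subst (asm) integrable_density) auto
  then have "integrable lborel (\<lambda>x. \<bar>c\<bar> ^ DIM('a) *\<^sub>R h (t + c *\<^sub>R x))"
    by (subst (asm) integrable_distr_eq) auto
  then show ?thesis using c by simp
qed

lemma lborel_integral_affine:
  fixes h :: "'a::euclidean_space \<Rightarrow> real"
  assumes [measurable]: "h \<in> borel_measurable borel" and c: "c \<noteq> 0"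
  shows "(LINT x|lborel. h x) = \<bar>c\<bar> ^ DIM('a) * (LINT x|lborel. h (t + c *\<^sub>R x))"
proof -
  have "(LINT x|lborel. h x) =
      (LINT x|density (distr lborel borel (\<lambda>x. t + c *\<^sub>R x)) (\<lambda>_. \<bar>c\<bar> ^ DIM('a)). h x)"
    using lborel_affine[OF c, of t] by simp
  also have "\<dots> = (LINT x|distr lborel borel (\<lambda>x. t + c *\<^sub>R x). \<bar>c\<bar> ^ DIM('a) *\<^sub>R h x)"
    by (rule integral_density) auto
  also have "\<dots> = (LINT x|lborel. \<bar>c\<bar> ^ DIM('a) *\<^sub>R h (t + c *\<^sub>R x))"
    by (rule integral_distr) auto
  finally show ?thesis by simp
qed

text \<open>Half-open, so that the lattice translates tile the space pointwise and not merely almost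
  everywhere.\<close>

definition unit_cell :: "(real^'n) set" where
  "unit_cell = {x. \<forall>i. 0 \<le> x $ i \<and> x $ i < 1}"

lemma unit_cell_borel [measurable]: "unit_cell \<in> sets borel"
proof -
  have "unit_cell = (\<Inter>i. {x :: real^'n. x $ i \<ge> 0} \<inter> {x. x $ i < 1})"
    by (auto simp: unit_cell_def)
  also have "\<dots> \<in> sets borel"
    by (intro sets.countable_INT' sets.Int borel_closed borel_open
        closed_halfspace_component_ge_cart open_halfspace_component_lt_cart) auto
  finally show ?thesis .
qed

lemma emeasure_unit_cell: "emeasure lborel (unit_cell :: (real^'n) set) = 1"
proof (rule antisym)
  have one: "(1 :: real^'n) \<bullet> b = 1" if "b \<in> Basis" for b
    using that by (auto simp: Basis_vec_def inner_axis)
  have "emeasure lborel (unit_cell :: (real^'n) set) \<le> emeasure lborel (cbox 0 (1 :: real^'n))"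
    by (intro emeasure_mono) (auto simp: unit_cell_def mem_box_cart less_imp_le)
  then show "emeasure lborel (unit_cell :: (real^'n) set) \<le> 1"
    by (simp add: emeasure_lborel_cbox_eq one)
  have "emeasure lborel (box 0 (1 :: real^'n)) \<le> emeasure lborel (unit_cell :: (real^'n) set)"
    by (intro emeasure_mono) (auto simp: unit_cell_def mem_box_cart less_imp_le)
  then show "1 \<le> emeasure lborel (unit_cell :: (real^'n) set)"
    by (simp add: emeasure_lborel_box_eq one)
qed

text \<open>Tiling: the only translate containing \<open>y\<close> is the one by its coordinatewise
  floor.\<close>

lemma sum_indicator_unit_cell:
  fixes y :: "real^'n"
  assumes "\<And>i. \<bar>y $ i\<bar> \<le> real R"
  shows "(\<Sum>p\<in>int_box (Suc R). indicator unit_cell (y - rvec p)) = (1 :: real)"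
proof -
  define q :: "int^'n" where "q = (\<chi> i. \<lfloor>y $ i\<rfloor>)"
  have "\<bar>q $ i\<bar> \<le> int (Suc R)" for i
    using assms[of i] unfolding q_def by simp linarith
  then have q: "q \<in> int_box (Suc R)" by (simp add: int_box_def)
  have "y - rvec p \<in> unit_cell \<longleftrightarrow> p = q" for p
  proof -
    have "0 \<le> y $ i - of_int (p $ i) \<and> y $ i - of_int (p $ i) < 1 \<longleftrightarrow> p $ i = q $ i" for i
      unfolding q_def by simp linarith
    then show ?thesis by (simp add: unit_cell_def rvec_nth vec_eq_iff)
  qed
  then have "(\<Sum>p\<in>int_box (Suc R). indicator unit_cell (y - rvec p)) =
      (\<Sum>p\<in>int_box (Suc R). if p = q then 1 else (0::real))"
    by (intro sum.cong) (auto simp: indicator_def)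
  also have "\<dots> = 1" using q by (simp add: finite_int_box)
  finally show ?thesis .
qed

text \<open>Cutting space into translates of the cell turns an integral into an average of sums over
  x + Z^n; bounded support makes these sums finite.\<close>

lemma integral_unit_cell_fold:
  fixes h :: "real^'n \<Rightarrow> real"
  assumes h: "integrable lborel h" and supp: "\<And>y. h y \<noteq> 0 \<Longrightarrow> \<forall>i. \<bar>y $ i\<bar> \<le> real R"
  defines "H \<equiv> \<lambda>x. indicator unit_cell x * (\<Sum>p\<in>int_box (Suc R). h (rvec p + x))"
  shows "integrable lborel H" "(LINT y|lborel. h y) = (LINT x|lborel. H x)"
proof -
  have h_meas [measurable]: "h \<in> borel_measurable borel"
    using borel_measurable_integrable[OF h] by simp
  define F where "F p x = indicator unit_cell x * h (rvec p + x)" for p :: "int^'n" and x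
  have H: "H = (\<lambda>x. \<Sum>p\<in>int_box (Suc R). F p x)"
    by (simp add: H_def F_def sum_distrib_left)
  have F: "integrable lborel (F p)" for p
  proof -
    have "integrable lborel (\<lambda>x. h (rvec p + 1 *\<^sub>R x))"
      by (rule lborel_integrable_affine[OF h]) simp
    then have "integrable lborel (\<lambda>x. indicator unit_cell x *\<^sub>R h (rvec p + 1 *\<^sub>R x))"
      by (rule integrable_mult_indicator[rotated]) simp
    then show ?thesis by (simp add: F_def[abs_def])
  qed
  show "integrable lborel H"
    unfolding H by (intro Bochner_Integration.integrable_sum F)
  have F': "integrable lborel (\<lambda>y. F p (y - rvec p))" for p
    using lborel_integrable_affine[OF F, of 1 p "- rvec p"] by simp
  have F_meas [measurable]: "F p \<in> borel_measurable borel" for p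
    using borel_measurable_integrable[OF F[of p]] by simp
  have "h y = (\<Sum>p\<in>int_box (Suc R). F p (y - rvec p))" for y
  proof (cases "h y = 0")
    case False
    have "(\<Sum>p\<in>int_box (Suc R). F p (y - rvec p)) =
        (\<Sum>p\<in>int_box (Suc R). indicator unit_cell (y - rvec p)) * h y"
      by (simp add: F_def sum_distrib_right)
    also have "\<dots> = h y"
      using supp[OF False] by (subst sum_indicator_unit_cell) auto
    finally show ?thesis by simp
  qed (simp add: F_def)
  then have "(LINT y|lborel. h y) = (LINT y|lborel. (\<Sum>p\<in>int_box (Suc R). F p (y - rvec p)))"
    by simp
  also have "\<dots> = (\<Sum>p\<in>int_box (Suc R). LINT y|lborel. F p (y - rvec p))"
    by (intro Bochner_Integration.integral_sum F')
  also have "\<dots> = (\<Sum>p\<in>int_box (Suc R). LINT x|lborel. F p x)"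
  proof (intro sum.cong refl)
    fix p :: "int^'n"
    show "(LINT y|lborel. F p (y - rvec p)) = (LINT x|lborel. F p x)"
      using lborel_integral_affine[OF F_meas[of p], of 1 "- rvec p"] by simp
  qed
  also have "\<dots> = (LINT x|lborel. H x)"
    unfolding H by (intro Bochner_Integration.integral_sum[symmetric] F)
  finally show "(LINT y|lborel. h y) = (LINT x|lborel. H x)" .
qed

lemma integral_unit_cell_approx:
  fixes \<Phi> :: "real^'n \<Rightarrow> real"
  assumes int: "integrable lborel (\<lambda>x. indicator unit_cell x * \<Phi> x)"
    and bound: "\<And>x. x \<in> unit_cell \<Longrightarrow> \<bar>\<Phi> x - c\<bar> \<le> E"
  shows "\<bar>(LINT x|lborel. indicator unit_cell x * \<Phi> x) - c\<bar> \<le> E"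
proof -
  have ind: "integrable lborel (indicator (unit_cell :: (real^'n) set) :: _ \<Rightarrow> real)"
    by (intro integrable_real_indicator) (simp_all add: emeasure_unit_cell)
  have one: "(LINT x|lborel. indicator (unit_cell :: (real^'n) set) x) = (1::real)"
    by (simp add: measure_def emeasure_unit_cell)
  have "(LINT x|lborel. indicator unit_cell x * \<Phi> x) - c =
      (LINT x|lborel. indicator unit_cell x * \<Phi> x - indicator unit_cell x * c)"
    using int ind one by simp
  also have "\<bar>\<dots>\<bar> \<le> (LINT x|lborel. \<bar>indicator unit_cell x * \<Phi> x - indicator unit_cell x * c\<bar>)"
    by (rule integral_abs_bound)
  also have "\<dots> \<le> (LINT x|lborel. indicator (unit_cell :: (real^'n) set) x * E)"
  proof (rule integral_mono)
    show "integrable lborel (\<lambda>x. \<bar>indicator unit_cell x * \<Phi> x - indicator unit_cell x * c\<bar>)"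
      using int ind by (intro Bochner_Integration.integrable_abs Bochner_Integration.integrable_diff
          integrable_mult_left)
    show "integrable lborel (\<lambda>x. indicator (unit_cell :: (real^'n) set) x * E)"
      using ind by (rule integrable_mult_left)
    show "\<bar>indicator unit_cell x * \<Phi> x - indicator unit_cell x * c\<bar> \<le> indicator unit_cell x * E"
      for x
      using bound[of x] by (cases "x \<in> unit_cell") simp_all
  qed
  also have "\<dots> = E" using ind one by simp
  finally show ?thesis .
qed

section \<open>Dilates of the polytope and translated lattices\<close>

context facet_polytope
begin

lemma compact_dilate: "compact ((*\<^sub>R) k ` P)"
  using compact_lattice_polytope[OF lattice] by (rule compact_scaling)

lemma dilate_eq:
  assumes "k > 0"
  shows "(*\<^sub>R) k ` P = {y. \<forall>u\<in>U. y \<bullet> rvec u \<ge> - k}"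
proof -
  have "y \<in> (*\<^sub>R) k ` P \<longleftrightarrow> (1 / k) *\<^sub>R y \<in> P" for y
    using assms by (force simp: image_iff)
  then show ?thesis
    using assms by (auto simp: P_eq field_simps)
qed

lemma integrable_dilate:
  fixes g :: "real^'n \<Rightarrow> real"
  assumes "continuous_on UNIV g"
  shows "integrable lborel (\<lambda>y. indicator ((*\<^sub>R) k ` P) y * g y)"
  using borel_integrable_compact[OF compact_dilate continuous_on_subset[OF assms subset_UNIV]]
  by simp

lemma integral_dilate:
  fixes g :: "real^'n \<Rightarrow> real"
  assumes k: "k > 0" and g: "continuous_on UNIV g" and hom: "\<And>x. g (k *\<^sub>R x) = k ^ a * g x"
  shows "(LINT y|lborel. indicator ((*\<^sub>R) k ` P) y * g y) =
    k ^ (CARD('n) + a) * (LINT x|lborel. indicator P x * g x)"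
proof -
  have "(LINT y|lborel. indicator ((*\<^sub>R) k ` P) y * g y) =
      \<bar>k\<bar> ^ DIM(real^'n) * (LINT x|lborel. indicator ((*\<^sub>R) k ` P) (0 + k *\<^sub>R x) * g (0 + k *\<^sub>R x))"
    using k borel_measurable_integrable[OF integrable_dilate[OF g, of k]]
    by (intro lborel_integral_affine) auto
  also have "(\<lambda>x. indicator ((*\<^sub>R) k ` P) (0 + k *\<^sub>R x) * g (0 + k *\<^sub>R x)) =
      (\<lambda>x. k ^ a * (indicator P x * g x))"
    using k hom by (auto simp: fun_eq_iff indicator_def image_iff)
  finally show ?thesis using k by (simp add: power_add)
qed

text \<open>The finitely many bounding hyperplanes are null sets, so the closed and the open dilate
  may be exchanged under the integral.\<close>

lemma AE_open_dilate:
  assumes "k > 0"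
  shows "AE y in lborel. y \<in> (*\<^sub>R) k ` P \<longleftrightarrow> (\<forall>u\<in>U. y \<bullet> rvec u > - k)"
proof -
  have "AE y in lborel. y \<bullet> rvec u \<noteq> - k" if "u \<in> U" for u :: "int^'n"
  proof -
    have "negligible {y. rvec u \<bullet> y = - k}"
      using assms by (intro negligible_hyperplane) auto
    moreover have "{y. rvec u \<bullet> y = - k} \<in> sets lborel"
      by (simp add: borel_closed closed_hyperplane)
    ultimately have "{y. rvec u \<bullet> y = - k} \<in> null_sets lborel"
      by (simp only: negligible_iff_null_sets null_sets_completion_iff)
    from AE_not_in[OF this] show ?thesis by (simp add: inner_commute)
  qed
  then have "AE y in lborel. \<forall>u\<in>U. y \<bullet> rvec u \<noteq> - k"
    using finite_U by (intro AE_finite_allI)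
  then show ?thesis
  proof eventually_elim
    case (elim y)
    show ?case
      unfolding dilate_eq[OF assms] using elim by (auto simp: less_le)
  qed
qed

text \<open>The shift caused by replacing Z^n with x + Z^n: as <p,u> is an integer, <p + x,u> >= -k
  can be rounded up.\<close>

definition cell_shift :: "real^'n \<Rightarrow> int^'n \<Rightarrow> int" where
  "cell_shift x u = \<lceil>- (x \<bullet> rvec u)\<rceil>"

lemma cell_shift_closed:
  assumes "k > 0"
  shows "rvec p + x \<in> (*\<^sub>R) (real k) ` P \<longleftrightarrow> p \<in> shifted_points (cell_shift x) k"
proof -
  have "(rvec p + x) \<bullet> rvec u \<ge> - real k \<longleftrightarrow> ip p u \<ge> cell_shift x u - int k" for u
  proof -
    have "(rvec p + x) \<bullet> rvec u \<ge> - real k \<longleftrightarrow> - (x \<bullet> rvec u) \<le> of_int (ip p u + int k)"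
      by (auto simp: inner_add_left inner_rvec)
    also have "\<dots> \<longleftrightarrow> cell_shift x u \<le> ip p u + int k"
      unfolding cell_shift_def by (rule ceiling_le_iff[symmetric])
    finally show ?thesis by auto
  qed
  with assms show ?thesis by (simp add: dilate_eq shifted_points_def)
qed

text \<open>The strict inequality <p,u> > <x,u> - k rounds to floor(<x,u>) + 1 - k, and floor(<x,u>)
  = -ceiling(-<x,u>). This yields the complementary shift also for integral <x,u>, where the closed
  inequality would not.\<close>

lemma cell_shift_open:
  "(\<forall>u\<in>U. (rvec p - x) \<bullet> rvec u > - real k) \<longleftrightarrow> p \<in> shifted_points (\<lambda>u. 1 - cell_shift x u) k"
proof -
  have "(rvec p - x) \<bullet> rvec u > - real k \<longleftrightarrow> ip p u \<ge> 1 - cell_shift x u - int k" for u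
  proof -
    have "(rvec p - x) \<bullet> rvec u > - real k \<longleftrightarrow> of_int (- ip p u - int k) < - (x \<bullet> rvec u)"
      by (auto simp: inner_diff_left inner_rvec)
    also have "\<dots> \<longleftrightarrow> - ip p u - int k < cell_shift x u"
      unfolding cell_shift_def by (rule less_ceiling_iff[symmetric])
    finally show ?thesis by auto
  qed
  then show ?thesis by (simp add: shifted_points_def)
qed

(* The closed and the open dilate have the same integral; folding the first over x + Z^n and the second
   over -x + Z^n produces the complementary shifts e and 1 - e. *)
lemma dilate_integral_as_average:
  fixes \<alpha> :: real and l :: "real^'n"
  defines "g \<equiv> \<lambda>x. \<alpha> + x \<bullet> l" and "f \<equiv> \<lambda>p. \<alpha> + rvec p \<bullet> l"
  assumes k: "k > 0"
  obtains \<Phi> where "integrable lborel (\<lambda>x. indicator unit_cell x * \<Phi> x)"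
    "2 * (LINT y|lborel. indicator ((*\<^sub>R) (real k) ` P) y * g y) = (LINT x|lborel. indicator unit_cell x * \<Phi> x)"
    "\<And>x. x \<in> unit_cell \<Longrightarrow> \<Phi> x =
       shifted_sum f (cell_shift x) k + shifted_sum f (\<lambda>u. 1 - cell_shift x u) k +
       (x \<bullet> l) * (shifted_sum (\<lambda>_. 1) (cell_shift x) k - shifted_sum (\<lambda>_. 1) (\<lambda>u. 1 - cell_shift x u) k)"
proof -
  let ?D = "(*\<^sub>R) (real k) ` P" and ?O = "{y. \<forall>u\<in>U. y \<bullet> rvec u > - real k}"
  have k': "real k > 0" using k by simp
  have OD: "?O \<subseteq> ?D" unfolding dilate_eq[OF k'] by (auto simp: less_imp_le)
  obtain B where B: "\<And>y. y \<in> ?D \<Longrightarrow> norm y \<le> B"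
    using compact_imp_bounded[OF compact_dilate] unfolding bounded_iff by blast
  define R where "R = nat \<lceil>B\<rceil>"
  have R: "\<bar>y $ i\<bar> \<le> real R" if "y \<in> ?D" for y i
  proof -
    have "\<bar>y $ i\<bar> \<le> B" using component_le_norm_cart B[OF that] by (rule order_trans)
    then show ?thesis unfolding R_def by linarith
  qed
  define h1 where "h1 y = indicator ?D y * g y" for y
  define h0 where "h0 y = indicator ?O y * g y" for y
  \<comment> \<open>Reflected so that folding over the same cell evaluates \<open>h0\<close> on -x +
    Z^n; the sign of p is reversed later to recover the points p - x.\<close>
  define h2 where "h2 y = h0 (- y)" for y
  have cont: "continuous_on UNIV g" unfolding g_def by (intro continuous_intros)
  have h1: "integrable lborel h1"
    unfolding h1_def[abs_def] by (rule integrable_dilate[OF cont])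
  have "open ?O"
  proof -
    have "?O = (\<Inter>u\<in>U. {y. rvec u \<bullet> y > - real k})" by (auto simp: inner_commute)
    then show ?thesis using finite_U by (auto intro!: open_INT open_halfspace_gt)
  qed
  moreover have "g \<in> borel_measurable borel"
    using cont by (simp add: borel_measurable_continuous_onI)
  ultimately have h0_meas [measurable]: "h0 \<in> borel_measurable borel"
    unfolding h0_def[abs_def] by (intro borel_measurable_times borel_measurable_indicator) auto
  have AE: "AE y in lborel. h1 y = h0 y"
    using AE_open_dilate[OF k'] by eventually_elim (simp add: h1_def h0_def indicator_def)
  have h1_meas: "h1 \<in> borel_measurable lborel" by (rule borel_measurable_integrable[OF h1])
  have h0: "integrable lborel h0"
    by (rule Bochner_Integration.integrable_cong_AE_imp[OF h1]) (use AE in \<open>auto simp: eq_commute\<close>)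
  have int0: "(LINT y|lborel. h0 y) = (LINT y|lborel. h1 y)"
    using AE h1_meas by (intro integral_cong_AE) (auto simp: eq_commute)
  have h2: "integrable lborel h2"
    using lborel_integrable_affine[OF h0, of "- 1" 0] by (simp add: h2_def[abs_def])
  have int2: "(LINT y|lborel. h2 y) = (LINT y|lborel. h1 y)"
    using lborel_integral_affine[OF h0_meas, of "- 1" 0] int0 by (simp add: h2_def[abs_def])
  have supp1: "\<forall>i. \<bar>y $ i\<bar> \<le> real R" if "h1 y \<noteq> 0" for y
    using that R by (auto simp: h1_def indicator_def split: if_splits)
  have supp2: "\<forall>i. \<bar>y $ i\<bar> \<le> real R" if "h2 y \<noteq> 0" for y
  proof -
    have "- y \<in> ?D" using that OD by (auto simp: h2_def h0_def indicator_def split: if_splits)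
    from R[OF this] show ?thesis by simp
  qed
  define \<Phi>1 where "\<Phi>1 x = (\<Sum>p\<in>int_box (Suc R). h1 (rvec p + x))" for x
  define \<Phi>2 where "\<Phi>2 x = (\<Sum>p\<in>int_box (Suc R). h2 (rvec p + x))" for x
  note fold1 = integral_unit_cell_fold[OF h1 supp1, folded \<Phi>1_def]
  note fold2 = integral_unit_cell_fold[OF h2 supp2, folded \<Phi>2_def]
  have in_box: "p \<in> int_box (Suc R)"
    if x: "x \<in> unit_cell" and p: "\<And>i. \<bar>(rvec p + x) $ i\<bar> \<le> real R \<or> \<bar>(rvec p - x) $ i\<bar> \<le> real R" for p x
  proof -
    have "\<bar>p $ i\<bar> \<le> int (Suc R)" for i
    proof -
      have "0 \<le> x $ i" "x $ i < 1" using x by (auto simp: unit_cell_def)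
      with p[of i] have "\<bar>real_of_int (p $ i)\<bar> \<le> real (Suc R)" by (auto simp: rvec_nth)
      then show ?thesis by linarith
    qed
    then show ?thesis by (simp add: int_box_def)
  qed
  \<comment> \<open>The affine weight at p + x exceeds \<open>f p\<close> by <x,l> and at p - x
    falls short by the same amount. Adding both folds therefore leaves <x,l> times the difference of
    two lattice counts.\<close>
  have \<Phi>1: "\<Phi>1 x = shifted_sum f (cell_shift x) k + (x \<bullet> l) * shifted_sum (\<lambda>_. 1) (cell_shift x) k"
    if x: "x \<in> unit_cell" for x
  proof -
    have "\<Phi>1 x = (\<Sum>p\<in>int_box (Suc R). if p \<in> shifted_points (cell_shift x) k then f p + x \<bullet> l else 0)"
      unfolding \<Phi>1_def
      by (intro sum.cong)
        (auto simp: h1_def cell_shift_closed[OF k] g_def f_def inner_add_left indicator_def)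
    also have "\<dots> = (\<Sum>p\<in>int_box (Suc R) \<inter> shifted_points (cell_shift x) k. f p + x \<bullet> l)"
      by (simp add: sum.inter_restrict finite_int_box)
    also have "int_box (Suc R) \<inter> shifted_points (cell_shift x) k = shifted_points (cell_shift x) k"
      using in_box[OF x] R cell_shift_closed[OF k, where x = x] by blast
    finally show ?thesis
      by (simp add: shifted_sum_def sum.distrib mult.commute)
  qed
  have \<Phi>2: "\<Phi>2 x = shifted_sum f (\<lambda>u. 1 - cell_shift x u) k -
      (x \<bullet> l) * shifted_sum (\<lambda>_. 1) (\<lambda>u. 1 - cell_shift x u) k"
    if x: "x \<in> unit_cell" for x
  proof -
    let ?S = "shifted_points (\<lambda>u. 1 - cell_shift x u) k"
    have "\<Phi>2 x = (\<Sum>p\<in>uminus ` int_box (Suc R). h2 (rvec p + x))"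
    proof -
      have "uminus ` int_box (Suc R) = (int_box (Suc R) :: (int^'n) set)"
      proof (intro equalityI subsetI)
        fix p :: "int^'n" assume "p \<in> int_box (Suc R)"
        then have "- p \<in> int_box (Suc R)" by (simp add: int_box_def)
        then show "p \<in> uminus ` int_box (Suc R)" by (rule rev_image_eqI) simp
      qed (auto simp: int_box_def)
      then show ?thesis by (simp add: \<Phi>2_def)
    qed
    also have "\<dots> = (\<Sum>p\<in>int_box (Suc R). h2 (rvec (- p) + x))"
      by (subst sum.reindex) (auto simp: inj_on_def)
    also have "\<dots> = (\<Sum>p\<in>int_box (Suc R). if p \<in> ?S then f p - x \<bullet> l else 0)"
      using cell_shift_open[where x = x and k = k]
      by (intro sum.cong)
        (auto simp: h2_def h0_def rvec_minus g_def f_def inner_diff_left indicator_def)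
    also have "\<dots> = (\<Sum>p\<in>int_box (Suc R) \<inter> ?S. f p - x \<bullet> l)"
      by (simp add: sum.inter_restrict finite_int_box)
    also have "int_box (Suc R) \<inter> ?S = ?S"
      using in_box[OF x] R OD cell_shift_open[where x = x and k = k] by blast
    finally show ?thesis
      by (simp add: shifted_sum_def sum_subtractf mult.commute)
  qed
  show thesis
  proof (rule that[of "\<lambda>x. \<Phi>1 x + \<Phi>2 x"])
    show "integrable lborel (\<lambda>x. indicator unit_cell x * (\<Phi>1 x + \<Phi>2 x))"
      using fold1(1) fold2(1) by (simp add: distrib_left)
    show "2 * (LINT y|lborel. indicator ?D y * g y) =
        (LINT x|lborel. indicator unit_cell x * (\<Phi>1 x + \<Phi>2 x))"
      using fold1 fold2 int2 by (simp add: distrib_left h1_def)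
    show "\<Phi>1 x + \<Phi>2 x =
       shifted_sum f (cell_shift x) k + shifted_sum f (\<lambda>u. 1 - cell_shift x u) k +
       (x \<bullet> l) * (shifted_sum (\<lambda>_. 1) (cell_shift x) k - shifted_sum (\<lambda>_. 1) (\<lambda>u. 1 - cell_shift x u) k)"
      if "x \<in> unit_cell" for x
      by (simp add: \<Phi>1[OF that] \<Phi>2[OF that] algebra_simps)
  qed
qed

end

subsection \<open>Asymptotics of lattice sums\<close>

text \<open>One affine form serves both asymptotics: a constant with a = 0 for dimensions and the
  linear form <p,l> with a = 1 for weights.\<close>

lemma lattice_weight_affine:
  fixes l :: "real^'n"
  assumes "a = 0 \<and> l = 0 \<or> a = 1 \<and> \<alpha> = 0"
  shows "lattice_weight a (\<lambda>p. \<alpha> + rvec p \<bullet> l)"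
  unfolding lattice_weight_def
proof (intro conjI allI)
  have bound: "\<bar>\<alpha> + rvec p \<bullet> l\<bar> \<le> (\<bar>\<alpha>\<bar> + real CARD('n) * norm l) * real R ^ a"
    if "R \<ge> 1" "p \<in> int_box R" for R and p :: "int^'n"
  proof (cases "a = 0")
    case False
    then have a: "a = 1" "\<alpha> = 0" using assms by auto
    have "norm (rvec p) \<le> (\<Sum>i\<in>UNIV. \<bar>rvec p $ i\<bar>)" by (rule norm_le_l1_cart)
    also have "\<dots> \<le> (\<Sum>i\<in>(UNIV :: 'n set). real R)"
    proof (rule sum_mono)
      fix i
      have "real_of_int \<bar>p $ i\<bar> \<le> real_of_int (int R)"
        using that(2) by (simp only: of_int_le_iff) (simp add: int_box_def)
      then show "\<bar>rvec p $ i\<bar> \<le> real R" by (simp add: rvec_nth)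
    qed
    finally have "norm (rvec p) * norm l \<le> real CARD('n) * real R * norm l"
      by (intro mult_right_mono) auto
    with Cauchy_Schwarz_ineq2[of "rvec p" l] show ?thesis by (simp add: a algebra_simps)
  qed (use assms in simp)
  then show "\<exists>K. \<forall>R\<ge>1. \<forall>p\<in>int_box R. \<bar>\<alpha> + rvec p \<bullet> l\<bar> \<le> K * real R ^ a" by blast
  fix q
  show "\<exists>K. \<forall>R\<ge>1. \<forall>p\<in>int_box R. \<bar>\<alpha> + rvec (p - q) \<bullet> l - (\<alpha> + rvec p \<bullet> l)\<bar> \<le> K * (real R ^ a / real R)"
    using assms by (intro exI[of _ "\<bar>rvec q \<bullet> l\<bar>"]) (auto simp: rvec_diff inner_diff_left)
qed

lemma power_Suc_expansion:
  "(\<lambda>k. real (Suc k) ^ m - real k ^ m - real m * (real k ^ m / real k)) \<in> O(\<lambda>k. real k ^ m / real k ^ 2)"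
proof (induction m)
  case (Suc m)
  let ?E = "\<lambda>m k. real (Suc k) ^ m - real k ^ m - real m * (real k ^ m / real k)"
  have "(\<lambda>k. real (Suc k)) \<in> O(\<lambda>k. real k)"
    by (rule bigoI[where c = 2]) (auto intro!: eventually_mono[OF eventually_gt_at_top[of 0]])
  from landau_o.big.mult[OF this Suc.IH]
  have "(\<lambda>k. real (Suc k) * ?E m k) \<in> O(\<lambda>k. real k ^ Suc m / real k ^ 2)" by simp
  moreover have "(\<lambda>k. real m * (real k ^ m / real k)) \<in> O(\<lambda>k. real k ^ Suc m / real k ^ 2)"
    by (rule bigoI[where c = "real m"]) (simp add: power2_eq_square)
  ultimately have "(\<lambda>k. real (Suc k) * ?E m k + real m * (real k ^ m / real k)) \<in> O(\<lambda>k. real k ^ Suc m / real k ^ 2)"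
    by (rule sum_in_bigo)
  moreover have "\<forall>\<^sub>F k in sequentially. ?E (Suc m) k = real (Suc k) * ?E m k + real m * (real k ^ m / real k)"
    using eventually_gt_at_top[of 0] by eventually_elim (simp add: field_simps)
  ultimately show ?case by (subst landau_o.big.in_cong)
qed simp

context facet_polytope
begin

text \<open>The shift vectors satisfy e + (1 - e) = 0 + 1, so the linear terms of the affine formula
  cancel.\<close>

lemma shifted_sum_complement_bigo:
  fixes f :: "int^'n \<Rightarrow> real"
  assumes f: "lattice_weight a f"
  shows "(\<lambda>k. shifted_sum f e k + shifted_sum f (\<lambda>u. 1 - e u) k -
      (shifted_sum f (\<lambda>_. 0) k + shifted_sum f (\<lambda>_. 1) k)) \<in> O(\<lambda>k. real k ^ (CARD('n) + a) / real k ^ 2)"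
proof -
  note A = shifted_sum_affine_bigo[OF f]
  from sum_in_bigo(2)[OF sum_in_bigo(1)[OF A[of e] A[of "\<lambda>u. 1 - e u"]] A[of "\<lambda>_. 1"]]
  show ?thesis by (simp add: sum_subtractf left_diff_distrib algebra_simps)
qed

text \<open>A coarser estimate, one order weaker, for lattice counts that are multiplied by the
  bounded factor <x,l> in place of the growing weight <p,l>.\<close>

lemma shifted_sum_diff_bigo:
  fixes f :: "int^'n \<Rightarrow> real"
  assumes f: "lattice_weight a f"
  shows "(\<lambda>k. shifted_sum f e k - shifted_sum f e' k) \<in> O(\<lambda>k. real k ^ (CARD('n) + a) / real k)"
proof -
  let ?g = "\<lambda>k. real k ^ (CARD('n) + a) / real k"
  have le: "(\<lambda>k. real k ^ (CARD('n) + a) / real k ^ 2) \<in> O(?g)"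
  proof (rule landau_o.big_mono, rule eventually_mono[OF eventually_gt_at_top[of 0]])
    fix k :: nat assume "0 < k"
    then show "norm (real k ^ (CARD('n) + a) / real k ^ 2) \<le> norm (?g k)"
      by (simp add: power2_eq_square divide_simps)
  qed
  have B: "(\<lambda>k. shifted_sum f e k - shifted_sum f (\<lambda>_. 0) k) \<in> O(?g)" for e
  proof -
    have "(\<lambda>k. \<Sum>u\<in>U. of_int (e u) * facet_sum f u k) \<in> O(?g)"
      using facet_sum_bigo[OF f] by (intro big_sum_in_bigo landau_o.big.cmult_in_iff'[THEN iffD2]) simp_all
    from sum_in_bigo(2)[OF landau_o.big.trans[OF shifted_sum_affine_bigo[OF f, of e] le] this]
    show ?thesis by simp
  qed
  from sum_in_bigo(2)[OF B[of e] B[of e']] show ?thesis by simp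
qed

text \<open>Only finitely many shift vectors on \<open>U\<close> arise from the cell, which turns
  estimates for each fixed shift into an estimate uniform in x.\<close>

lemma cell_shift_bounded:
  obtains C :: int where "\<forall>x\<in>unit_cell. \<forall>u\<in>U. cell_shift x u \<in> {- C..C}"
proof -
  define C where "C = \<lceil>\<Sum>u\<in>U. real CARD('n) * norm (rvec u :: real^'n)\<rceil> + 1"
  have "cell_shift x u \<in> {- C..C}" if x: "x \<in> unit_cell" and u: "u \<in> U" for x u
  proof -
    have "norm x \<le> (\<Sum>i\<in>UNIV. \<bar>x $ i\<bar>)" by (rule norm_le_l1_cart)
    also have "\<dots> \<le> (\<Sum>i\<in>(UNIV :: 'n set). 1)"
      using x by (intro sum_mono) (auto simp: unit_cell_def less_imp_le)
    finally have "norm x * norm (rvec u) \<le> real CARD('n) * norm (rvec u :: real^'n)"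
      by (intro mult_right_mono) auto
    also have "\<dots> \<le> (\<Sum>u\<in>U. real CARD('n) * norm (rvec u :: real^'n))"
      using finite_U u by (intro member_le_sum) auto
    finally have "\<bar>x \<bullet> rvec u\<bar> \<le> (\<Sum>u\<in>U. real CARD('n) * norm (rvec u :: real^'n))"
      using Cauchy_Schwarz_ineq2[of x "rvec u"] by linarith
    then show ?thesis
      unfolding cell_shift_def C_def by simp linarith
  qed
  then show thesis using that by blast
qed

text \<open>At each point of the cell the integrand is S(0) + S(1) up to errors depending only on
  its shift vector. Summing the errors over the finite set \<E> bounds them uniformly, and averaging
  over a cell of measure 1 preserves the bound.\<close>

lemma lattice_sum_average:
  fixes l :: "real^'n" and a :: nat
  assumes al: "a = 0 \<and> l = 0 \<or> a = 1 \<and> \<alpha> = 0"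
  defines "f \<equiv> \<lambda>p. \<alpha> + rvec p \<bullet> l" and "I \<equiv> (LINT x|lborel. indicator P x * (\<alpha> + x \<bullet> l))"
  shows "(\<lambda>k. shifted_sum f (\<lambda>_. 0) k + shifted_sum f (\<lambda>_. 1) k - 2 * I * real k ^ (CARD('n) + a))
    \<in> O(\<lambda>k. real k ^ (CARD('n) + a) / real k ^ 2)" (is "_ \<in> O(?g)")
proof -
  obtain C :: int where C: "\<forall>x\<in>unit_cell. \<forall>u\<in>U. cell_shift x u \<in> {- C..C}"
    by (rule cell_shift_bounded)
  define \<E> where "\<E> = PiE U (\<lambda>_. {- C..C})"
  have fin: "finite \<E>" unfolding \<E>_def using finite_U by (intro finite_PiE) auto
  define X where "X e k = shifted_sum f e k + shifted_sum f (\<lambda>u. 1 - e u) k -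
      (shifted_sum f (\<lambda>_. 0) k + shifted_sum f (\<lambda>_. 1) k)" for e k
  \<comment> \<open>Majorises the term with <x,l>, because |<x,l>| <= n |l| on the cell. For a = 1
    the difference of counts is O(k^(n-1)), the permitted order; for a = 0 the vector l
    vanishes.\<close>
  define Y where "Y e k = (real CARD('n) * norm l) *
      (shifted_sum (\<lambda>_. 1) e k - shifted_sum (\<lambda>_. 1) (\<lambda>u. 1 - e u) k)" for e k
  have X: "X e \<in> O(?g)" for e
    unfolding X_def[abs_def] f_def by (rule shifted_sum_complement_bigo[OF lattice_weight_affine[OF al]])
  have Y: "Y e \<in> O(?g)" for e
  proof (cases "a = 0")
    case True
    then show ?thesis using al by (simp add: Y_def[abs_def])
  next
    case False
    then have "a = 1" using al by auto
    have w: "lattice_weight 0 (\<lambda>_::int^'n. 1 :: real)"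
      using lattice_weight_affine[of 0 "0 :: real^'n" 1] by simp
    from shifted_sum_diff_bigo[OF w, of e "\<lambda>u. 1 - e u"]
    have "Y e \<in> O(\<lambda>k. real k ^ CARD('n) / real k)"
      unfolding Y_def[abs_def] by simp
    also have "(\<lambda>k. real k ^ CARD('n) / real k) = ?g"
      by (auto simp: \<open>a = 1\<close> fun_eq_iff power2_eq_square)
    finally show ?thesis .
  qed
  have bound: "\<bar>2 * I * real k ^ (CARD('n) + a) - (shifted_sum f (\<lambda>_. 0) k + shifted_sum f (\<lambda>_. 1) k)\<bar>
      \<le> (\<Sum>e\<in>\<E>. \<bar>X e k\<bar> + \<bar>Y e k\<bar>)" if k: "k > 0" for k
  proof -
    obtain \<Phi> where \<Phi>: "integrable lborel (\<lambda>x. indicator unit_cell x * \<Phi> x)"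
      "2 * (LINT y|lborel. indicator ((*\<^sub>R) (real k) ` P) y * (\<alpha> + y \<bullet> l)) =
        (LINT x|lborel. indicator unit_cell x * \<Phi> x)"
      "\<And>x. x \<in> unit_cell \<Longrightarrow> \<Phi> x =
         shifted_sum f (cell_shift x) k + shifted_sum f (\<lambda>u. 1 - cell_shift x u) k +
         (x \<bullet> l) * (shifted_sum (\<lambda>_. 1) (cell_shift x) k - shifted_sum (\<lambda>_. 1) (\<lambda>u. 1 - cell_shift x u) k)"
      unfolding f_def using dilate_integral_as_average[OF k, of \<alpha> l] by blast
    have "(LINT y|lborel. indicator ((*\<^sub>R) (real k) ` P) y * (\<alpha> + y \<bullet> l)) = real k ^ (CARD('n) + a) * I"
      unfolding I_def using k al
      by (intro integral_dilate continuous_intros) auto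
    with \<Phi>(2) have eq: "2 * I * real k ^ (CARD('n) + a) = (LINT x|lborel. indicator unit_cell x * \<Phi> x)"
      by (simp only: ac_simps)
    show ?thesis
      unfolding eq
    proof (rule integral_unit_cell_approx[OF \<Phi>(1)])
      fix x :: "real^'n" assume x: "x \<in> unit_cell"
      \<comment> \<open>Restricted to \<open>U\<close> so that it belongs to the finite function set
        \<E>; the lattice sums depend only on the values on \<open>U\<close>.\<close>
      define e where "e = restrict (cell_shift x) U"
      have e: "e \<in> \<E>" unfolding \<E>_def e_def using C x by auto
      have "shifted_points (cell_shift x) k = shifted_points e k"
        "shifted_points (\<lambda>u. 1 - cell_shift x u) k = shifted_points (\<lambda>u. 1 - e u) k"
        by (rule shifted_points_cong, simp add: e_def)+
      then have cong: "shifted_sum f' (cell_shift x) k = shifted_sum f' e k"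
        "shifted_sum f' (\<lambda>u. 1 - cell_shift x u) k = shifted_sum f' (\<lambda>u. 1 - e u) k" for f'
        by (simp_all only: shifted_sum_def)
      define D where "D = shifted_sum (\<lambda>_. 1) e k - shifted_sum (\<lambda>_. 1) (\<lambda>u. 1 - e u) k"
      have "\<Phi> x - (shifted_sum f (\<lambda>_. 0) k + shifted_sum f (\<lambda>_. 1) k) = X e k + (x \<bullet> l) * D"
        by (simp add: \<Phi>(3)[OF x] cong X_def D_def)
      moreover have "\<bar>(x \<bullet> l) * D\<bar> \<le> \<bar>Y e k\<bar>"
      proof -
        have "norm x \<le> (\<Sum>i\<in>UNIV. \<bar>x $ i\<bar>)" by (rule norm_le_l1_cart)
        also have "\<dots> \<le> (\<Sum>i\<in>(UNIV :: 'n set). 1)"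
          using x by (intro sum_mono) (auto simp: unit_cell_def less_imp_le)
        finally have "norm x * norm l \<le> real CARD('n) * norm l"
          by (intro mult_right_mono) auto
        then have "\<bar>x \<bullet> l\<bar> \<le> real CARD('n) * norm l"
          using Cauchy_Schwarz_ineq2[of x l] by linarith
        then have "\<bar>x \<bullet> l\<bar> * \<bar>D\<bar> \<le> real CARD('n) * norm l * \<bar>D\<bar>"
          by (intro mult_right_mono) auto
        then show ?thesis by (simp add: Y_def D_def abs_mult)
      qed
      ultimately have "\<bar>\<Phi> x - (shifted_sum f (\<lambda>_. 0) k + shifted_sum f (\<lambda>_. 1) k)\<bar> \<le> \<bar>X e k\<bar> + \<bar>Y e k\<bar>"
        by linarith
      also have "\<dots> \<le> (\<Sum>e\<in>\<E>. \<bar>X e k\<bar> + \<bar>Y e k\<bar>)"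
        using fin e by (intro member_le_sum) auto
      finally show "\<bar>\<Phi> x - (shifted_sum f (\<lambda>_. 0) k + shifted_sum f (\<lambda>_. 1) k)\<bar> \<le>
        (\<Sum>e\<in>\<E>. \<bar>X e k\<bar> + \<bar>Y e k\<bar>)" .
    qed
  qed
  have "(\<lambda>k. shifted_sum f (\<lambda>_. 0) k + shifted_sum f (\<lambda>_. 1) k - 2 * I * real k ^ (CARD('n) + a))
      \<in> O(\<lambda>k. \<Sum>e\<in>\<E>. \<bar>X e k\<bar> + \<bar>Y e k\<bar>)"
  proof (rule landau_o.big_mono, rule eventually_mono[OF eventually_gt_at_top[of 0]])
    fix k :: nat assume "0 < k"
    from bound[OF this]
    show "norm (shifted_sum f (\<lambda>_. 0) k + shifted_sum f (\<lambda>_. 1) k - 2 * I * real k ^ (CARD('n) + a))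
      \<le> norm (\<Sum>e\<in>\<E>. \<bar>X e k\<bar> + \<bar>Y e k\<bar>)"
      by (simp add: abs_minus_commute)
  qed
  also have "(\<lambda>k. \<Sum>e\<in>\<E>. \<bar>X e k\<bar> + \<bar>Y e k\<bar>) \<in> O(?g)"
    using X Y by (intro big_sum_in_bigo sum_in_bigo) simp_all
  finally show ?thesis .
qed

lemma lattice_sum_asymptotics:
  fixes l :: "real^'n" and a :: nat
  assumes al: "a = 0 \<and> l = 0 \<or> a = 1 \<and> \<alpha> = 0"
  defines "S \<equiv> \<lambda>k. \<Sum>p\<in>lattice_points P k. \<alpha> + rvec p \<bullet> l"
    and "I \<equiv> (LINT x|lborel. indicator P x * (\<alpha> + x \<bullet> l))" and "m \<equiv> CARD('n) + a"
  shows "(\<lambda>k. S k + S (k - 1) - 2 * I * real k ^ m) \<in> O(\<lambda>k. real k ^ m / real k ^ 2)"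
    and "(\<lambda>k. S k - I * (real k ^ m + real m / 2 * (real k ^ m / real k))) \<in> O(\<lambda>k. real k ^ m / real k ^ 2)"
proof -
  define f :: "int^'n \<Rightarrow> real" where "f = (\<lambda>p. \<alpha> + rvec p \<bullet> l)"
  have f: "lattice_weight a f" unfolding f_def by (rule lattice_weight_affine[OF al])
  let ?g = "\<lambda>k. real k ^ m / real k ^ 2"
  have S0: "shifted_sum f (\<lambda>_. 0) k = S k" if "k > 0" for k
    using that by (simp add: shifted_sum_def S_def f_def shifted_points_0)
  have S1: "shifted_sum f (\<lambda>_. 1) k = S (k - 1)" if "k > 1" for k
    using S0[of "k - 1"] shifted_points_add_const(2)[of k "\<lambda>_. 0"] that by (simp add: shifted_sum_def)
  have Sm: "shifted_sum f (\<lambda>_. - 1) k = S (Suc k)" for k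
    using S0[of "Suc k"] shifted_points_add_const(1)[of "\<lambda>_. 0" k] by (simp add: shifted_sum_def)
  have ev: "(\<lambda>k. S k + S (k - 1) - 2 * I * real k ^ m) \<in> O(?g) \<longleftrightarrow>
      (\<lambda>k. shifted_sum f (\<lambda>_. 0) k + shifted_sum f (\<lambda>_. 1) k - 2 * I * real k ^ m) \<in> O(?g)"
    by (rule landau_o.big.in_cong, rule eventually_mono[OF eventually_gt_at_top[of 1]])
      (simp add: S0 S1)
  show 1: "(\<lambda>k. S k + S (k - 1) - 2 * I * real k ^ m) \<in> O(?g)"
    unfolding ev unfolding f_def I_def m_def by (rule lattice_sum_average[OF al])
  have "(\<lambda>k. S (Suc k) + S (Suc k - 1) - 2 * I * real (Suc k) ^ m) \<in> O(\<lambda>k. real (Suc k) ^ m / real (Suc k) ^ 2)"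
    using 1 by (rule landau_o.big.compose) (rule filterlim_Suc)
  also have "(\<lambda>k. real (Suc k) ^ m / real (Suc k) ^ 2) \<in> O(?g)"
  proof (rule bigoI)
    show "\<forall>\<^sub>F k in sequentially. norm (real (Suc k) ^ m / real (Suc k) ^ 2) \<le> 2 ^ m * norm (?g k)"
      using eventually_gt_at_top[of 0]
    proof eventually_elim
      case (elim k)
      have "real (Suc k) ^ m / real (Suc k) ^ 2 \<le> (2 * real k) ^ m / real k ^ 2"
        using elim by (intro frac_le power_mono) auto
      then show ?case by (simp add: power_mult_distrib)
    qed
  qed
  finally have 2: "(\<lambda>k. S (Suc k) + S k - 2 * I * real (Suc k) ^ m) \<in> O(?g)" by simp
  note A = shifted_sum_affine_bigo[OF f, folded m_def]
  \<comment> \<open>The linear terms of the affine formula for e = -1 and e = 1 cancel, which makes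
    the second difference small.\<close>
  have "(\<lambda>k. shifted_sum f (\<lambda>_. - 1) k - 2 * shifted_sum f (\<lambda>_. 0) k + shifted_sum f (\<lambda>_. 1) k) \<in> O(?g)"
    using sum_in_bigo(1)[OF A[of "\<lambda>_. - 1"] A[of "\<lambda>_. 1"]]
    by (simp add: sum_negf algebra_simps)
  moreover have "\<forall>\<^sub>F k in sequentially. shifted_sum f (\<lambda>_. - 1) k - 2 * shifted_sum f (\<lambda>_. 0) k +
      shifted_sum f (\<lambda>_. 1) k = S (Suc k) - 2 * S k + S (k - 1)"
    by (rule eventually_mono[OF eventually_gt_at_top[of 1]]) (simp add: S0 S1 Sm)
  ultimately have 3: "(\<lambda>k. S (Suc k) - 2 * S k + S (k - 1)) \<in> O(?g)"
    by (simp only: landau_o.big.in_cong)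
  have 4: "(\<lambda>k. 2 * I * (real (Suc k) ^ m - real k ^ m - real m * (real k ^ m / real k))) \<in> O(?g)"
    using power_Suc_expansion[of m] by simp
  \<comment> \<open>Used here: (S k + S (k-1)) + (S (k+1) + S k) - (S (k+1) - 2 S k + S (k-1)) = 4 S
    k. The main terms are 2 I (k^m + (k+1)^m), expanded by \<open>4\<close>.\<close>
  from sum_in_bigo(1)[OF sum_in_bigo(2)[OF sum_in_bigo(1)[OF 1 2] 3] 4]
  have "(\<lambda>k. 4 * (S k - I * (real k ^ m + real m / 2 * (real k ^ m / real k)))) \<in> O(?g)"
    by (simp add: algebra_simps)
  then show "(\<lambda>k. S k - I * (real k ^ m + real m / 2 * (real k ^ m / real k))) \<in> O(?g)"
    by (rule landau_o.big.cmult_in_iff[THEN iffD1, rotated]) simp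
qed

end

subsection \<open>The log-Futaki invariant\<close>

lemma power_int_nat:
  assumes "k > 0"
  shows "real k powi (int n + 1) = real k ^ (n + 1)" "real k powi int n = real k ^ n"
    "real k powi (int n - 1) = real k ^ n / real k" "real k powi (int n - 2) = real k ^ n / real k ^ 2"
  using assms by (simp_all add: power_int_add power_int_diff)

lemma power_int_bigo_unique1:
  fixes c :: real and j :: int
  assumes "(\<lambda>k. c * real k powi j) \<in> O(\<lambda>k. real k powi (j - 1))"
  shows "c = 0"
proof (rule ccontr)
  assume c: "c \<noteq> 0"
  obtain K where "\<forall>\<^sub>F k in sequentially. norm (c * real k powi j) \<le> K * norm (real k powi (j - 1))"
    using assms by (elim landau_o.bigE)
  then have "\<forall>\<^sub>F k in sequentially. real k \<le> K / \<bar>c\<bar>"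
    using eventually_gt_at_top[of 0]
  proof eventually_elim
    case (elim k)
    have pos: "real k powi j > 0" using elim(2) by simp
    have "\<bar>c\<bar> * (real k powi j) \<le> K * (real k powi j) / real k"
      using elim pos by (simp add: abs_mult power_int_diff)
    then have "(\<bar>c\<bar> * real k) * (real k powi j) \<le> K * (real k powi j)"
      using elim(2) by (simp add: field_simps)
    then have "\<bar>c\<bar> * real k \<le> K" using pos by simp
    then show ?case using c by (simp add: field_simps)
  qed
  moreover have "\<forall>\<^sub>F k in sequentially. real k > K / \<bar>c\<bar>"
    using filterlim_real_sequentially by (simp add: filterlim_at_top_dense)
  ultimately have "\<forall>\<^sub>F k :: nat in sequentially. False" by eventually_elim simp
  then show False by simp
qed

lemma power_int_bigo_unique2:
  fixes c d :: real and j :: int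
  assumes "(\<lambda>k. c * real k powi (j + 1) + d * real k powi j) \<in> O(\<lambda>k. real k powi (j - 1))"
  shows "c = 0" "d = 0"
proof -
  have le: "(\<lambda>k. real k powi (j - 1)) \<in> O(\<lambda>k. real k powi j)"
  proof (rule landau_o.big_mono, rule eventually_mono[OF eventually_gt_at_top[of 0]])
    fix k :: nat assume "0 < k"
    then show "norm (real k powi (j - 1)) \<le> norm (real k powi j)"
      by (simp add: power_int_diff divide_simps)
  qed
  have "(\<lambda>k. d * real k powi j) \<in> O(\<lambda>k. real k powi j)" by simp
  from sum_in_bigo(2)[OF landau_o.big.trans[OF assms le] this]
  have "(\<lambda>k. c * real k powi (j + 1)) \<in> O(\<lambda>k. real k powi (j + 1 - 1))" by simp
  then show c: "c = 0" by (rule power_int_bigo_unique1)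
  show "d = 0" using assms unfolding c by (intro power_int_bigo_unique1[of d j]) simp
qed

text \<open>Subtracting two expansions leaves powers of k bounded by smaller powers, which forces
  zero coefficients. This makes the definite description in \<open>log_futaki\<close>
  meaningful.\<close>

lemma log_futaki_data_unique:
  fixes P :: "(real^'n) set"
  assumes "log_futaki_data P s l a0 a1 b0 b1 a0' b0'" "log_futaki_data P s l c0 c1 d0 d1 c0' d0'"
  shows "c0 = a0" "c1 = a1" "d0 = b0" "d1 = b1" "c0' = a0'" "d0' = b0'"
proof -
  let ?n = "int CARD('n)"
  note D = assms[unfolded log_futaki_data_def Let_def]
  have "(\<lambda>k. (c0 - a0) * real k powi (?n + 1) + (c1 - a1) * real k powi ?n) \<in> O(\<lambda>k. real k powi (?n - 1))"
    using sum_in_bigo(2)[OF D(1)[THEN conjunct1] D(2)[THEN conjunct1]] by (simp add: algebra_simps)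
  from power_int_bigo_unique2[OF this] show "c0 = a0" "c1 = a1" by simp_all
  have "(\<lambda>k. (d0 - b0) * real k powi (?n - 1 + 1) + (d1 - b1) * real k powi (?n - 1))
      \<in> O(\<lambda>k. real k powi (?n - 1 - 1))"
    using sum_in_bigo(2)[OF D(1)[THEN conjunct2, THEN conjunct1] D(2)[THEN conjunct2, THEN conjunct1]]
    by (simp add: algebra_simps)
  from power_int_bigo_unique2[OF this] show "d0 = b0" "d1 = b1" by simp_all
  have "(\<lambda>k. (c0' - a0') * real k powi ?n) \<in> O(\<lambda>k. real k powi (?n - 1))"
    using sum_in_bigo(2)[OF D(1)[THEN conjunct2, THEN conjunct2, THEN conjunct1]
        D(2)[THEN conjunct2, THEN conjunct2, THEN conjunct1]]
    by (simp add: algebra_simps)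
  from power_int_bigo_unique1[OF this] show "c0' = a0'" by simp
  have "(\<lambda>k. (d0' - b0') * real k powi (?n - 1)) \<in> O(\<lambda>k. real k powi (?n - 1 - 1))"
    using sum_in_bigo(2)[OF D(1)[THEN conjunct2, THEN conjunct2, THEN conjunct2]
        D(2)[THEN conjunct2, THEN conjunct2, THEN conjunct2]]
    by (simp add: algebra_simps)
  from power_int_bigo_unique1[OF this] show "d0' = b0'" by simp
qed

lemma log_futaki_eqI:
  assumes "log_futaki_data P s l a0 a1 b0 b1 a0' b0'"
  shows "log_futaki P s \<beta> l = 2 * (a1 * b0 - a0 * b1) / b0 + (1 - \<beta>) * (- a0' + b0' / b0 * a0)"
  unfolding log_futaki_def
proof (rule the_equality)
  show "\<exists>c0 c1 d0 d1 c0' d0'. log_futaki_data P s l c0 c1 d0 d1 c0' d0' \<and>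
      2 * (a1 * b0 - a0 * b1) / b0 + (1 - \<beta>) * (- a0' + b0' / b0 * a0) =
      2 * (c1 * d0 - c0 * d1) / d0 + (1 - \<beta>) * (- c0' + d0' / d0 * c0)"
    using assms by blast
next
  fix F assume "\<exists>c0 c1 d0 d1 c0' d0'. log_futaki_data P s l c0 c1 d0 d1 c0' d0' \<and>
      F = 2 * (c1 * d0 - c0 * d1) / d0 + (1 - \<beta>) * (- c0' + d0' / d0 * c0)"
  then obtain c0 c1 d0 d1 c0' d0' where c: "log_futaki_data P s l c0 c1 d0 d1 c0' d0'"
    and F: "F = 2 * (c1 * d0 - c0 * d1) / d0 + (1 - \<beta>) * (- c0' + d0' / d0 * c0)"
    by blast
  show "F = 2 * (a1 * b0 - a0 * b1) / b0 + (1 - \<beta>) * (- a0' + b0' / b0 * a0)"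
    unfolding F log_futaki_data_unique[OF assms c] ..
qed

section \<open>General members\<close>

lemma coeff_polynomial_prod:
  "finite K \<Longrightarrow> coeff_polynomial (\<lambda>s. \<Prod>p\<in>K. Poly_Mapping.lookup s p)"
proof (induction K rule: finite_induct)
  case empty
  show ?case using coeff_polynomial.const[of 1] by simp
next
  case (insert p K)
  then show ?case
    using coeff_polynomial.mult[OF coeff_polynomial.coeff[of p] insert.IH] by simp
qed

lemma homogeneous_polynomial_prod:
  assumes "finite K"
  shows "homogeneous_polynomial (\<lambda>s. \<Prod>p\<in>K. Poly_Mapping.lookup s p)"
  unfolding homogeneous_polynomial_def
proof (intro conjI exI allI)
  show "coeff_polynomial (\<lambda>s. \<Prod>p\<in>K. Poly_Mapping.lookup s p)"
    by (rule coeff_polynomial_prod[OF assms])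
  show "(\<Prod>p\<in>K. Poly_Mapping.lookup (lscale c s) p) = c ^ card K * (\<Prod>p\<in>K. Poly_Mapping.lookup s p)"
    for c and s :: "'a laurent"
    by (simp add: lookup_lscale prod.distrib)
qed

context facet_polytope
begin

definition vertex_points :: "(int^'n) set" where
  "vertex_points = {p. rvec p extreme_point_of P}"

lemma finite_vertex_points: "finite vertex_points"
proof -
  have "vertex_points \<subseteq> {p. rvec p \<in> P}"
    by (auto simp: vertex_points_def extreme_in_P)
  then show ?thesis
    using finite_lattice_points[OF bounded_P] by (rule finite_subset)
qed

text \<open>A minimiser of -l among the vertices; since vertices of a lattice polytope are lattice
  points, it is the exponent of a monomial in the central section.\<close>

lemma maximizing_vertex:
  obtains p where "p \<in> vertex_points" "rvec p \<in> max_face P l"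
proof -
  obtain v where v: "v extreme_point_of P" "\<And>x. x \<in> P \<Longrightarrow> v \<bullet> (- l) \<le> x \<bullet> (- l)"
    using minimizing_extreme_point[OF lattice, of "- l"] zero_in_P by blast
  obtain p where p: "v = rvec p" using finite_extreme_points(2)[OF lattice v(1)] by blast
  have "support_max P l = v \<bullet> l"
    unfolding support_max_def
    using v by (intro cSup_eq_maximum) (auto simp: extreme_in_P)
  then show thesis
    using that[of p] v(1) p by (simp add: vertex_points_def max_face_def extreme_in_P)
qed

text \<open>The complement of the coordinate hyperplanes of the vertex monomials, that is, the locus
  where one product of coefficients is nonzero. It is independent of \<open>l\<close>.\<close>

definition general_sections :: "'n laurent set" where
  "general_sections = {s \<in> sections P 1. \<forall>p\<in>vertex_points. Poly_Mapping.lookup s p \<noteq> 0}"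

lemma zariski_open_general_sections: "zariski_open_members P general_sections"
proof -
  let ?q = "\<lambda>s :: 'n laurent. \<Prod>p\<in>vertex_points. Poly_Mapping.lookup s p"
  obtain p where p: "p \<in> vertex_points" using maximizing_vertex by blast
  have "general_sections = {s \<in> sections P 1. s \<noteq> 0 \<and> (\<exists>q\<in>{?q}. q s \<noteq> 0)}"
    using p finite_vertex_points by (auto simp: general_sections_def)
  moreover have "\<forall>q\<in>{?q}. homogeneous_polynomial q"
    using homogeneous_polynomial_prod[OF finite_vertex_points] by simp
  ultimately show ?thesis unfolding zariski_open_members_def by blast
qed

lemma general_sections_nonempty: "general_sections \<noteq> {}"
proof -
  define s :: "'n laurent" where "s = (\<Sum>p\<in>vertex_points. monom p)"
  have lookup: "Poly_Mapping.lookup s p = (if p \<in> vertex_points then 1 else 0)" for p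
    using finite_vertex_points by (simp add: s_def lookup_sum lookup_single when_def)
  have "s \<in> sections P 1"
    by (auto simp: sections_def in_keys_iff lookup vertex_points_def extreme_in_P split: if_splits)
  then have "s \<in> general_sections" by (simp add: general_sections_def lookup)
  then show ?thesis by blast
qed

lemma central_section_general:
  assumes "s \<in> general_sections"
  shows "central_section P s l \<in> sections P 1" "central_section P s l \<noteq> 0"
    "p \<in> Poly_Mapping.keys (central_section P s l) \<Longrightarrow> rvec p \<bullet> l = support_max P l"
proof -
  note lookup = lookup_central_section[OF lattice, of s l]
  show "central_section P s l \<in> sections P 1"
    by (auto simp: sections_def in_keys_iff lookup max_face_def split: if_splits)
  show "p \<in> Poly_Mapping.keys (central_section P s l) \<Longrightarrow> rvec p \<bullet> l = support_max P l"
    by (auto simp: in_keys_iff lookup max_face_def split: if_splits)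
  obtain p where "p \<in> vertex_points" "rvec p \<in> max_face P l" by (rule maximizing_vertex)
  then have "Poly_Mapping.lookup (central_section P s l) p \<noteq> 0"
    using assms by (simp add: lookup general_sections_def)
  then show "central_section P s l \<noteq> 0" by auto
qed

lemma integral_indicator_P: "(LINT x|lborel. indicator P x * (1 + x \<bullet> (0 :: real^'n))) = measure lebesgue P"
proof -
  have "P \<in> sets borel" using closed_P by (rule borel_closed)
  then show ?thesis by simp
qed

text \<open>The barycenter is a gauge integral divided by the volume: the Lebesgue integral is
  converted first, and positivity of the volume undoes the division.\<close>

lemma integral_linear_P:
  assumes "measure lebesgue P > 0"
  shows "(LINT x|lborel. indicator P x * (0 + x \<bullet> l)) = (barycenter P \<bullet> l) * measure lebesgue P"
proof -
  have int: "set_integrable lborel P (\<lambda>x. x)"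
    unfolding set_integrable_def
    using borel_integrable_compact[OF compact_lattice_polytope[OF lattice] continuous_on_id] by simp
  have intl: "set_integrable lborel P (\<lambda>x. x \<bullet> l)"
    unfolding set_integrable_def
    by (intro borel_integrable_compact compact_lattice_polytope[OF lattice] continuous_intros)
  have "(LINT x|lborel. indicator P x * (0 + x \<bullet> l)) = (LINT x:P|lborel. x \<bullet> l)"
    by (simp add: set_lebesgue_integral_def)
  also have "\<dots> = integral P (\<lambda>x. x \<bullet> l)"
    by (rule set_borel_integral_eq_integral(2)[OF intl])
  also have "\<dots> = integral P (\<lambda>x. x) \<bullet> l"
    using integral_linear[OF set_borel_integral_eq_integral(1)[OF int] bounded_linear_inner_left[of l]]
    by (simp add: o_def)
  also have "\<dots> = (barycenter P \<bullet> l) * measure lebesgue P"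
    using assms by (simp add: barycenter_def)
  finally show ?thesis .
qed

text \<open>\<open>M\<close> is the integral of <x,l> over P. Differences S k - S (k-1) are computed
  as 2 S k - (S k + S (k-1)), so both parts of \<open>lattice_sum_asymptotics\<close> combine and
  nothing needs to be expanded at k - 1.\<close>

lemma log_futaki_data_general:
  fixes l :: "real^'n"
  assumes V: "measure lebesgue P > 0" and s: "s \<in> general_sections"
  defines "V \<equiv> measure lebesgue P" and "M \<equiv> (barycenter P \<bullet> l) * measure lebesgue P"
    and "n \<equiv> real CARD('n)"
  shows "log_futaki_data P s l (- M) (- (n + 1) / 2 * M) V (n / 2 * V)
    (- (n + 1) * M + support_max P l * V) (n * V)"
proof -
  let ?N = "CARD('n)"
  define d where "d k = (\<Sum>p\<in>lattice_points P k. 1 + rvec p \<bullet> (0 :: real^'n))" for k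
  define L where "L k = (\<Sum>p\<in>lattice_points P k. 0 + rvec p \<bullet> l)" for k
  have dX: "real (dim_X P k) = d k" and wX: "weight_X P l k = - L k" for k
    by (simp_all add: d_def L_def dim_X_eq weight_X_eq bounded_P)
  let ?g = "\<lambda>k. real k ^ ?N / real k" and ?g' = "\<lambda>k. real k ^ ?N / real k ^ 2"
  have le: "?g' \<in> O(?g)"
  proof (rule landau_o.big_mono, rule eventually_mono[OF eventually_gt_at_top[of 0]])
    fix k :: nat assume "0 < k"
    then show "norm (?g' k) \<le> norm (?g k)" by (simp add: power2_eq_square divide_simps)
  qed
  define D1 where "D1 k = d k + d (k - 1) - 2 * V * real k ^ ?N" for k
  define D2 where "D2 k = d k - V * (real k ^ ?N + n / 2 * ?g k)" for k
  define L1 where "L1 k = L k + L (k - 1) - 2 * M * real k ^ (?N + 1)" for k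
  define L2 where "L2 k = L k - M * (real k ^ (?N + 1) + (n + 1) / 2 * (real k ^ (?N + 1) / real k))" for k
  have D: "D1 \<in> O(?g')" "D2 \<in> O(?g')"
    using lattice_sum_asymptotics[of 0 "0 :: real^'n" 1]
    unfolding D1_def[abs_def] D2_def[abs_def] d_def n_def V_def integral_indicator_P[symmetric] by simp_all
  have g: "(\<lambda>k. real k ^ (?N + 1) / real k ^ 2) = ?g"
    by (auto simp: fun_eq_iff power2_eq_square)
  have L: "L1 \<in> O(?g)" "L2 \<in> O(?g)"
    using lattice_sum_asymptotics[of 1 l 0]
    unfolding g[symmetric] L1_def[abs_def] L2_def[abs_def] L_def n_def M_def integral_linear_P[OF V, symmetric]
    by (simp_all add: add.commute)
  note D' = landau_o.big.trans[OF D(1) le] landau_o.big.trans[OF D(2) le]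
  have O1: "O(\<lambda>k. real k powi (int ?N - 1)) = O(?g)" and O2: "O(\<lambda>k. real k powi (int ?N - 2)) = O(?g')"
    by (rule landau_o.big.cong, rule eventually_mono[OF eventually_gt_at_top[of 0]], rule power_int_nat, assumption)+
  let ?s = "central_section P s l"
  note c = central_section_general[OF s, where l = l]
  have s': "s \<in> sections P 1" "s \<noteq> 0"
  proof -
    obtain p where "p \<in> vertex_points" using maximizing_vertex by blast
    then show "s \<in> sections P 1" "s \<noteq> 0" using s by (auto simp: general_sections_def)
  qed
  have dY: "real (dim_Y P s k) = d k - d (k - 1)" if "k > 0" for k
    using dim_Y_eq[OF s', of "k - 1"] that by (simp add: dX)
  have wY: "weight_Y P ?s l k = - L k + L (k - 1) + support_max P l * d (k - 1)" if "k > 0" for k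
    using weight_Y_eq[OF c, of "k - 1"] that by (simp add: dX wX)
  have "(\<lambda>k. - L2 k) \<in> O(?g)" using L(2) by simp
  moreover have "\<forall>\<^sub>F k in sequentially. weight_X P l k -
      (- M * real k powi (int ?N + 1) + - (n + 1) / 2 * M * real k powi int ?N) = - L2 k"
    using eventually_gt_at_top[of 0]
    by eventually_elim (simp only: power_int_nat, simp add: wX L2_def field_simps)
  ultimately have 1: "(\<lambda>k. weight_X P l k -
      (- M * real k powi (int ?N + 1) + - (n + 1) / 2 * M * real k powi int ?N)) \<in> O(?g)"
    by (simp only: landau_o.big.in_cong)
  have "\<forall>\<^sub>F k in sequentially. real (dim_X P k) -
      (V * real k powi int ?N + n / 2 * V * real k powi (int ?N - 1)) = D2 k"
    using eventually_gt_at_top[of 0]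
    by eventually_elim (simp add: dX D2_def power_int_nat algebra_simps)
  with D(2) have 2: "(\<lambda>k. real (dim_X P k) -
      (V * real k powi int ?N + n / 2 * V * real k powi (int ?N - 1))) \<in> O(?g')"
    by (simp only: landau_o.big.in_cong)
  have "(\<lambda>k. n / 2 * V * ?g k) \<in> O(?g)"
    by (rule bigoI[where c = "\<bar>n / 2 * V\<bar>"]) (simp add: abs_mult)
  from sum_in_bigo(2)[OF sum_in_bigo(2)[OF D'] this]
  \<comment> \<open>For k > 0 the bracket equals d (k-1) - V k^n.\<close>
  have "(\<lambda>k. support_max P l * (D1 k - D2 k - n / 2 * V * ?g k)) \<in> O(?g)"
    by simp
  \<comment> \<open>For k > 0 this is -L k + L (k-1) + (n + 1) M k^n.\<close>
  moreover have "(\<lambda>k. L1 k - 2 * L2 k) \<in> O(?g)"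
    using L by (intro sum_in_bigo) simp_all
  ultimately have "(\<lambda>k. L1 k - 2 * L2 k + support_max P l * (D1 k - D2 k - n / 2 * V * ?g k)) \<in> O(?g)"
    by (rule sum_in_bigo(1)[rotated])
  moreover have "\<forall>\<^sub>F k in sequentially. weight_Y P ?s l k -
      (- (n + 1) * M + support_max P l * V) * real k powi int ?N =
      L1 k - 2 * L2 k + support_max P l * (D1 k - D2 k - n / 2 * V * ?g k)"
    using eventually_gt_at_top[of 0]
    by eventually_elim
      (simp add: wY L1_def L2_def D1_def D2_def power_int_nat field_simps)
  ultimately have 3: "(\<lambda>k. weight_Y P ?s l k -
      (- (n + 1) * M + support_max P l * V) * real k powi int ?N) \<in> O(?g)"
    by (simp only: landau_o.big.in_cong)
  \<comment> \<open>This is d k - d (k-1) - n V k^(n-1), with the last power read as k^n /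
    k.\<close>
  have "(\<lambda>k. 2 * D2 k - D1 k) \<in> O(?g')"
    using D by (intro sum_in_bigo) simp_all
  moreover have "\<forall>\<^sub>F k in sequentially. real (dim_Y P s k) - n * V * real k powi (int ?N - 1) =
      2 * D2 k - D1 k"
    using eventually_gt_at_top[of 0]
    by eventually_elim (simp add: dY D1_def D2_def power_int_nat algebra_simps)
  ultimately have 4: "(\<lambda>k. real (dim_Y P s k) - n * V * real k powi (int ?N - 1)) \<in> O(?g')"
    by (simp only: landau_o.big.in_cong)
  show ?thesis
    unfolding log_futaki_data_def Let_def O1 O2 using 1 2 3 4 by blast
qed

end

theorem proposition2:
  fixes P :: "(real^'n) set"
  assumes "reflexive_polytope P" and "smooth_polytope P"
  shows "\<exists>U. zariski_open_members P U \<and> U \<noteq> {} \<and>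
    (\<forall>s\<in>U. \<forall>\<beta>::real. \<forall>l :: real^'n. 0 < \<beta> \<and> \<beta> \<le> 1 \<longrightarrow>
       log_futaki P s \<beta> l =
         - (\<beta> * (barycenter P \<bullet> l) + (1 - \<beta>) * support_max P l) * measure lebesgue P)"
proof -
  obtain U where "facet_polytope P U" by (rule reflexive_polytope_facets[OF assms(1)])
  then interpret facet_polytope P U .
  have "interior P \<noteq> {}" using assms(1) by (auto simp: reflexive_polytope_def)
  then have "\<not> negligible P"
    using open_not_negligible[OF open_interior] negligible_subset[OF _ interior_subset] by blast
  moreover have "P \<in> lmeasurable"
    using compact_lattice_polytope[OF lattice] by (rule lmeasurable_compact)
  ultimately have V: "measure lebesgue P > 0"
    by (simp add: negligible_iff_measure zero_less_measure_iff)
  show ?thesis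
  proof (intro exI conjI ballI allI impI)
    show "zariski_open_members P general_sections" by (rule zariski_open_general_sections)
    show "general_sections \<noteq> {}" by (rule general_sections_nonempty)
    fix s \<beta> l assume "s \<in> general_sections"
    \<comment> \<open>With M = <P_c,l> V and W the support value, the first summand of the invariant
      is -M and the factor of 1 - \<beta> is (n + 1) M - W V - n M = M - W V.\<close>
    from log_futaki_eqI[OF log_futaki_data_general[OF V this, of l]]
    show "log_futaki P s \<beta> l =
         - (\<beta> * (barycenter P \<bullet> l) + (1 - \<beta>) * support_max P l) * measure lebesgue P"
      using V by (simp add: field_simps)
  qed
qed

end
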